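(* Let $d$ be a positive integer and let $\delta>d/2$ be a real number. Let $$\Psi_{d,\delta}(t)=\frac{1}{B(2\delta-d,\,2\delta)}\int_t^1(s^2-t^2)^{\delta-\frac{d+1}{2}}(1-s)^{2\delta-1}\,ds\quad\text{for }0\le t\le1,\qquad \Psi_{d,\delta}(t)=0\ \text{ for } t>1,$$ and write also $\Psi_{d,\delta}(\mathbf{x})=\Psi_{d,\delta}(|\mathbf{x}|)$ for $\mathbf{x}\in\mathbb{R}^d$. Let $$Q_\delta(r)={}_1F_2\left(\delta;\,2\delta,\,2\delta+\frac12;\,-\frac{r^2}{4}\right)\quad(r\ge0),$$ $$\tau_{d,\delta}=\frac{2^{1-d}\,\Gamma(4\delta)\,\Gamma\left(\delta-\frac d2\right)}{\Gamma(\delta)\,\Gamma(4\delta-d)\,\Gamma\left(\frac d2\right)},\qquad \eta_{d,\delta}=\frac{2\pi^{d/2}}{\Gamma(d/2)}\cdot\frac{1}{\tau_{d,\delta}}.$$ Then $\Psi_{d,\delta}$ is continuous and positive definite on $\mathbb{R}^d$, with $$\widehat{\Psi_{d,\delta}}(\xi)=\eta_{d,\delta}\,Q_\delta(|\xi|)\qquad(\xi\in\mathbb{R}^d).$$ As a consequence, $\Psi_{d,\delta}(\mathbf{x}-\mathbf{y})$ is a reproducing kernel for the Sobolev space $H^\delta(\mathbb{R}^d)$ with respect to the inner product $$(u,v)_{\Psi_{d,\delta}(\mathbb{R}^d)}=(2\pi)^{-d}\cdot\frac{1}{\eta_{d,\delta}}\int_{\mathbb{R}^d}\frac{\widehat u(\xi)\,\overline{\widehat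 v(\xi)}}{Q_\delta(|\xi|)}\,d\xi.$$
   Context: Notation. $|\cdot|$ is the Euclidean norm, $B(a,b)=\int_0^1 t^{a-1}(1-t)^{b-1}dt$ is the Euler beta function, and the Fourier transform is $\widehat f(\xi)=\int_{\mathbb{R}^d}e^{-i\xi\cdot\mathbf{x}}f(\mathbf{x})\,d\mathbf{x}$ for $f\in L^1(\mathbb{R}^d)$, extended to $L^2(\mathbb{R}^d)$ as usual. The generalized hypergeometric function is ${}_pF_q(a_1,\dots,a_p;b_1,\dots,b_q;r)=\sum_{k\ge0}\frac{(a_1)_k\cdots(a_p)_k}{k!\,(b_1)_k\cdots(b_q)_k}r^k$, with $(a)_0=1$ and $(a)_k=a(a+1)\cdots(a+k-1)$ for $k\ge1$. A function $\Phi$ on $\mathbb{R}^d$ is positive definite if $\sum_{j,k=1}^N\Phi(\mathbf{x}_j-\mathbf{x}_k)z_j\overline{z_k}\ge0$ for every $N$, all (pairwise distinct) $\mathbf{x}_1,\dots,\mathbf{x}_N\in\mathbb{R}^d$ and all $z_1,\dots,z_N\in\mathbb{C}$, with equality only when $z_1=\cdots=z_N=0$. For $\delta>0$, $H^\delta(\mathbb{R}^d)=\{u\in L^2(\mathbb{R}^d):(1+|\cdot|^2)^{\delta/2}\,\widehat u\in L^2(\mathbb{R}^d)\}$; when $\delta>d/2$ one has $H^\delta(\mathbb{R}^d)\subset C(\mathbb{R}^d)$, and elements are identified with their continuous representatives. For $\delta > d/2$, saying that $\Phi(\mathbf{x}-\mathbf{y})$ is a reproducing kernel for $H^\delta(\mathbb{R}^d)$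 with respect to an inner product $(\cdot,\cdot)$ means that $H^\delta(\mathbb{R}^d)$ is a Hilbert space under $(\cdot,\cdot)$ and, for every $u\in H^\delta(\mathbb{R}^d)$ and $\mathbf{x}\in\mathbb{R}^d$, (i) $\Phi(\cdot-\mathbf{x})\in H^\delta(\mathbb{R}^d)$ and (ii) $u(\mathbf{x})=(u,\Phi(\cdot-\mathbf{x}))$. *)

theory Defs
  imports "HOL-Analysis.Analysis"
begin

section \<open>Fourier transform\<close>

definition square_integrable :: "('a::euclidean_space \<Rightarrow> complex) \<Rightarrow> bool" where
  "square_integrable f \<longleftrightarrow>
     f \<in> borel_measurable borel \<and> integrable lborel (\<lambda>x. (norm (f x))\<^sup>2)"

definition fourier_L1 :: "('a::euclidean_space \<Rightarrow> complex) \<Rightarrow> 'a \<Rightarrow> complex" where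
  "fourier_L1 f \<xi> = (LBINT x. exp (- \<i> * complex_of_real (\<xi> \<bullet> x)) * f x)"

text \<open>Convergence in the \<open>L\<^sup>2\<close> norm. The (extended nonnegative) integral makes sense for all
  measurable functions, whereas the Bochner integral would be \<open>0\<close> if the difference is not
  square integrable.\<close>

definition tendsto_L2 ::
    "(nat \<Rightarrow> 'a::euclidean_space \<Rightarrow> complex) \<Rightarrow> ('a \<Rightarrow> complex) \<Rightarrow> bool" where
  "tendsto_L2 F f \<longleftrightarrow>
     (\<lambda>k. \<integral>\<^sup>+x. ennreal ((norm (F k x - f x))\<^sup>2) \<partial>lborel) \<longlonglongrightarrow> 0"

text \<open>\<open>g\<close> represents the Fourier transform of \<open>f \<in> L\<^sup>2\<close>, obtained by continuous extension
  from the dense subspace \<open>L\<^sup>1 \<inter> L\<^sup>2\<close>.\<close>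

definition is_fourier_L2 ::
    "('a::euclidean_space \<Rightarrow> complex) \<Rightarrow> ('a \<Rightarrow> complex) \<Rightarrow> bool" where
  "is_fourier_L2 f g \<longleftrightarrow> square_integrable f \<and> square_integrable g \<and>
     (\<exists>F. (\<forall>k. integrable lborel (F k) \<and> square_integrable (F k)) \<and>
          tendsto_L2 F f \<and> tendsto_L2 (\<lambda>k. fourier_L1 (F k)) g)"

text \<open>Outside \<open>L\<^sup>1\<close> the transform is determined only up to a null set, and one representative
  is chosen.\<close>

definition fourier :: "('a::euclidean_space \<Rightarrow> complex) \<Rightarrow> 'a \<Rightarrow> complex" where
  "fourier f = (if integrable lborel f then fourier_L1 f else (SOME g. is_fourier_L2 f g))"

section \<open>Positive definite functions\<close>

definition positive_definite :: "('a::euclidean_space \<Rightarrow> complex) \<Rightarrow> bool" where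
  "positive_definite \<Phi> \<longleftrightarrow>
     (\<forall>(N::nat) (x :: nat \<Rightarrow> 'a) (z :: nat \<Rightarrow> complex). inj_on x {..<N} \<longrightarrow>
        (\<Sum>j<N. \<Sum>k<N. \<Phi> (x j - x k) * z j * cnj (z k)) \<in> \<real>\<^sub>\<ge>\<^sub>0 \<and>
        ((\<Sum>j<N. \<Sum>k<N. \<Phi> (x j - x k) * z j * cnj (z k)) = 0 \<longrightarrow> (\<forall>j<N. z j = 0)))"

section \<open>Hilbert spaces of functions and reproducing kernels\<close>

definition function_subspace :: "('a \<Rightarrow> complex) set \<Rightarrow> bool" where
  "function_subspace V \<longleftrightarrow> (\<lambda>x. 0) \<in> V \<and>
     (\<forall>u\<in>V. \<forall>v\<in>V. (\<lambda>x. u x + v x) \<in> V) \<and>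
     (\<forall>c. \<forall>u\<in>V. (\<lambda>x. c * u x) \<in> V)"

definition inner_product_on ::
    "('a \<Rightarrow> complex) set \<Rightarrow> (('a \<Rightarrow> complex) \<Rightarrow> ('a \<Rightarrow> complex) \<Rightarrow> complex) \<Rightarrow> bool" where
  "inner_product_on V ip \<longleftrightarrow>
     (\<forall>u\<in>V. \<forall>v\<in>V. \<forall>w\<in>V. ip (\<lambda>x. u x + v x) w = ip u w + ip v w) \<and>
     (\<forall>c. \<forall>u\<in>V. \<forall>v\<in>V. ip (\<lambda>x. c * u x) v = c * ip u v) \<and>
     (\<forall>u\<in>V. \<forall>v\<in>V. ip v u = cnj (ip u v)) \<and>
     (\<forall>u\<in>V. ip u u \<in> \<real>\<^sub>\<ge>\<^sub>0) \<and>
     (\<forall>u\<in>V. ip u u = 0 \<longrightarrow> u = (\<lambda>x. 0))"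

definition ip_dist ::
    "(('a \<Rightarrow> complex) \<Rightarrow> ('a \<Rightarrow> complex) \<Rightarrow> complex) \<Rightarrow> ('a \<Rightarrow> complex) \<Rightarrow> ('a \<Rightarrow> complex) \<Rightarrow> real" where
  "ip_dist ip u v = sqrt (Re (ip (\<lambda>x. u x - v x) (\<lambda>x. u x - v x)))"

definition hilbert_space_on ::
    "('a \<Rightarrow> complex) set \<Rightarrow> (('a \<Rightarrow> complex) \<Rightarrow> ('a \<Rightarrow> complex) \<Rightarrow> complex) \<Rightarrow> bool" where
  "hilbert_space_on V ip \<longleftrightarrow> function_subspace V \<and> inner_product_on V ip \<and>
     (\<forall>U :: nat \<Rightarrow> 'a \<Rightarrow> complex.
        (\<forall>n. U n \<in> V) \<and> (\<forall>e>0. \<exists>M. \<forall>m\<ge>M. \<forall>n\<ge>M. ip_dist ip (U m) (U n) < e) \<longrightarrow>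
        (\<exists>u\<in>V. (\<lambda>n. ip_dist ip (U n) u) \<longlonglongrightarrow> 0))"

definition translation_reproducing_kernel ::
    "('a::euclidean_space \<Rightarrow> complex) \<Rightarrow> ('a \<Rightarrow> complex) set \<Rightarrow>
      (('a \<Rightarrow> complex) \<Rightarrow> ('a \<Rightarrow> complex) \<Rightarrow> complex) \<Rightarrow> bool" where
  "translation_reproducing_kernel \<Phi> V ip \<longleftrightarrow> hilbert_space_on V ip \<and>
     (\<forall>u\<in>V. \<forall>x. (\<lambda>y. \<Phi> (y - x)) \<in> V \<and> u x = ip u (\<lambda>y. \<Phi> (y - x)))"

section \<open>Sobolev spaces\<close>

definition sobolev_L2 :: "real \<Rightarrow> ('a::euclidean_space \<Rightarrow> complex) set" where
  "sobolev_L2 \<delta> = {u. square_integrable u \<and>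
     square_integrable (\<lambda>\<xi>. complex_of_real ((1 + (norm \<xi>)\<^sup>2) powr (\<delta> / 2)) * fourier u \<xi>)}"

text \<open>For \<open>\<delta> > d/2\<close> every class in \<open>H\<^sup>\<delta>\<close> has exactly one continuous representative, with
  which it is identified; the elements are thus genuine functions.\<close>

definition sobolev :: "real \<Rightarrow> ('a::euclidean_space \<Rightarrow> complex) set" where
  "sobolev \<delta> = {u \<in> sobolev_L2 \<delta>. continuous_on UNIV u}"

section \<open>The radial functions\<close>

definition \<Psi>_radial :: "nat \<Rightarrow> real \<Rightarrow> real \<Rightarrow> real" where
  "\<Psi>_radial d \<delta> t =
     (if t \<le> 1 then 1 / Beta (2 * \<delta> - real d) (2 * \<delta>) *
        (LBINT s:{t..1}. (s\<^sup>2 - t\<^sup>2) powr (\<delta> - (real d + 1) / 2) * (1 - s) powr (2 * \<delta> - 1))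
      else 0)"

definition \<Psi> :: "nat \<Rightarrow> real \<Rightarrow> 'a::euclidean_space \<Rightarrow> complex" where
  "\<Psi> d \<delta> x = complex_of_real (\<Psi>_radial d \<delta> (norm x))"

definition Q :: "real \<Rightarrow> real \<Rightarrow> real" where
  "Q \<delta> r = eval_fps (fps_hypergeo [\<delta>] [2 * \<delta>, 2 * \<delta> + 1 / 2] 1) (- r\<^sup>2 / 4)"

lemma Q_series:
  "Q \<delta> r = (\<Sum>k. pochhammer \<delta> k / (fact k * pochhammer (2 * \<delta>) k * pochhammer (2 * \<delta> + 1 / 2) k)
                 * (- r\<^sup>2 / 4) ^ k)"
  by (simp add: Q_def eval_fps_def mult_ac)

definition \<tau> :: "nat \<Rightarrow> real \<Rightarrow> real" where
  "\<tau> d \<delta> = 2 powr (1 - real d) * Gamma (4 * \<delta>) * Gamma (\<delta> - real d / 2) /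
           (Gamma \<delta> * Gamma (4 * \<delta> - real d) * Gamma (real d / 2))"

definition \<eta> :: "nat \<Rightarrow> real \<Rightarrow> real" where
  "\<eta> d \<delta> = 2 * pi powr (real d / 2) / Gamma (real d / 2) * (1 / \<tau> d \<delta>)"

definition \<Psi>_inner ::
    "nat \<Rightarrow> real \<Rightarrow> ('a::euclidean_space \<Rightarrow> complex) \<Rightarrow> ('a \<Rightarrow> complex) \<Rightarrow> complex" where
  "\<Psi>_inner d \<delta> u v =
     complex_of_real ((2 * pi) powr (- real d) * (1 / \<eta> d \<delta>)) *
     (LBINT \<xi>. fourier u \<xi> * cnj (fourier v \<xi>) / complex_of_real (Q \<delta> (norm \<xi>)))"

end

theory Submission
  imports Defs "HOL-Probability.Probability"
begin

text \<open>
  The Fourier transform of a radial function is expanded in a series whose terms are radial moments;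
  the angular constants in it are read off from the Gaussian. For \<open>\<Psi>\<close> the moments are products of
  two Beta integrals and the series is \<open>\<eta> Q\<close>.

  With \<open>j(x) = \<^sub>0F\<^sub>1(; \<delta> + 1/2; - x\<^sup>2 / 4)\<close>, a Bessel function up to a power of \<open>x\<close>, Vandermonde's identity
  gives the series of \<open>j\<^sup>2\<close>, and termwise integration shows that \<open>Q(r)\<close> is a positive multiple of
  \<open>\<integral>\<^sub>0\<^sup>1 u\<^sup>2\<^sup>\<delta> (1 - u\<^sup>2)\<^sup>\<delta>\<^sup>-\<^sup>1 j(r u / 2)\<^sup>2 du\<close>; in particular \<open>Q > 0\<close>. The function \<open>w(x) = x\<^sup>\<delta> j(x)\<close> satisfies
  \<open>w'' = (\<delta> (\<delta> - 1) / x\<^sup>2 - 1) w\<close>, so its energy \<open>w'\<^sup>2 + w\<^sup>2\<close> stays between positive constants, which makes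
  \<open>Q(r)\<close> comparable to \<open>(1 + r\<^sup>2)\<^sup>-\<^sup>\<delta>\<close>. Hence the given inner product is equivalent to the Sobolev one, and
  the reproducing property and positive definiteness are the Fourier inversion formula.

  The theory of the Fourier transform on \<open>L\<^sup>2\<close> needs only one half of Plancherel's theorem, the bound
  \<open>\<parallel>F f\<parallel>\<^sup>2 \<le> (2 \<pi>)\<^sup>d \<parallel>f\<parallel>\<^sup>2\<close>, together with the multiplication formula \<open>\<integral> F f g = \<integral> f F g\<close> tested against Gaussians.
\<close>


section \<open>Gaussians and integrals over Euclidean space\<close>

text \<open>The alternating series of \<open>Q\<close> shows neither its sign nor its decay, yet the
  sign is needed for positive definiteness and the exact rate for the equivalence of norms. The
  weight u^(2\<delta>) (1 - u^2)^(\<delta>-1) is chosen because its even moments are proportional to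
  (\<delta>+1/2)_k / (2\<delta>+1/2)_k, exactly the exchange of parameters that leads from the
  series of j^2 to that of \<open>Q\<close>. Moreover (r/2)^(2\<delta>) u^(2\<delta>) completes j^2
  to w^2, so the rate r^(-2\<delta>) amounts to two-sided bounds for a weighted mean of w^2. The
  energy bounds w^2 from above pointwise; from below only a mean can be bounded, since the energy
  may sit entirely in w'. A second obstacle is that \<open>fourier\<close> outside L1 is a chosen
  representative: identities between transforms hold almost everywhere, while the elements of the
  space are genuine functions. Continuity of those elements closes the gap. One half of Plancherel
  is enough because only boundedness and injectivity of the transform are used, and injectivity
  comes from Gaussians, whose transforms are explicit.\<close>

lemma lborel_integral_prod:
  fixes f :: "'a::euclidean_space \<Rightarrow> real \<Rightarrow> complex"
  assumes f: "\<And>b. b \<in> Basis \<Longrightarrow> integrable lborel (f b)"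
  shows "integrable lborel (\<lambda>x. \<Prod>b\<in>Basis. f b (x \<bullet> b))"
    and "(LBINT x. (\<Prod>b\<in>Basis. f b (x \<bullet> b))) = (\<Prod>b\<in>Basis. LBINT x. f b x)"
proof -
  interpret product_sigma_finite "\<lambda>b::'a. lborel :: real measure" ..
  have m[measurable]: "\<And>b. b \<in> Basis \<Longrightarrow> f b \<in> borel_measurable borel"
    using borel_measurable_integrable[OF f] by simp
  have T: "(\<lambda>f. \<Sum>b\<in>Basis. f b *\<^sub>R b) \<in> measurable (\<Pi>\<^sub>M b\<in>Basis. lborel) (borel::'a measure)"
    by measurable
  have eq: "(\<Prod>b\<in>Basis. f b ((\<Sum>c\<in>Basis. g c *\<^sub>R c) \<bullet> b)) = (\<Prod>b\<in>Basis. f b (g b))" for g :: "'a \<Rightarrow> real"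
    by (intro prod.cong) simp_all
  have P: "(\<lambda>x. \<Prod>b\<in>Basis. f b (x \<bullet> b)) \<in> borel_measurable (borel::'a measure)"
    by measurable
  show "integrable lborel (\<lambda>x. \<Prod>b\<in>Basis. f b (x \<bullet> b))"
    unfolding lborel_eq[where 'a='a] integrable_distr_eq[OF T P] eq
    by (rule product_integrable_prod) (use f in auto)
  have "(LBINT x. (\<Prod>b\<in>Basis. f b (x \<bullet> b))) = integral\<^sup>L (\<Pi>\<^sub>M b\<in>Basis. lborel) (\<lambda>g. \<Prod>b\<in>Basis. f b (g b))"
    by (subst lborel_eq[where 'a='a], subst integral_distr[OF T P]) (simp add: eq)
  also have "\<dots> = (\<Prod>b\<in>Basis. LBINT x. f b x)"
    by (rule product_integral_prod) (use f in auto)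
  finally show "(LBINT x. (\<Prod>b\<in>Basis. f b (x \<bullet> b))) = (\<Prod>b\<in>Basis. LBINT x. f b x)" .
qed

section \<open>Characters and Gaussians\<close>

definition wave :: "'a::euclidean_space \<Rightarrow> 'a \<Rightarrow> complex" where
  "wave \<xi> x = exp (- \<i> * complex_of_real (\<xi> \<bullet> x))"

lemma fourier_L1_wave: "fourier_L1 f \<xi> = (LBINT x. wave \<xi> x * f x)"
  by (simp add: fourier_L1_def wave_def)

lemma norm_wave [simp]: "norm (wave \<xi> x) = 1"
  by (simp add: wave_def norm_exp_eq_Re)

lemma wave_0 [simp]: "wave 0 x = 1" "wave \<xi> 0 = 1"
  by (simp_all add: wave_def)

lemma wave_add: "wave (a + b) x = wave a x * wave b x"
  and wave_add_right: "wave x (a + b) = wave x a * wave x b"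
  by (simp_all add: wave_def inner_add_left inner_add_right exp_add[symmetric] algebra_simps)

lemma wave_commute: "wave x y = wave y x"
  by (simp add: wave_def inner_commute)

lemma cnj_wave: "cnj (wave \<xi> x) = wave (- \<xi>) x"
  by (simp add: wave_def exp_cnj)

lemma wave_minus: "wave (- \<xi>) x = wave \<xi> (- x)"
  by (simp add: wave_def)

lemma continuous_on_wave [continuous_intros]:
  "continuous_on A f \<Longrightarrow> continuous_on A g \<Longrightarrow> continuous_on A (\<lambda>x. wave (f x) (g x))"
  unfolding wave_def by (intro continuous_intros)

lemma measurable_wave [measurable (raw)]:
  "f \<in> borel_measurable M \<Longrightarrow> g \<in> borel_measurable M \<Longrightarrow> (\<lambda>x. wave (f x) (g x)) \<in> borel_measurable M"
  unfolding wave_def by measurable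

definition gauss :: "real \<Rightarrow> 'a::euclidean_space \<Rightarrow> real" where
  "gauss a x = exp (- a * (norm x)\<^sup>2)"

abbreviation cgauss :: "real \<Rightarrow> 'a::euclidean_space \<Rightarrow> complex" where
  "cgauss a x \<equiv> complex_of_real (gauss a x)"

lemma gauss_pos [simp]: "gauss a x > 0" "gauss a x \<ge> 0" "gauss a x \<noteq> 0"
  by (simp_all add: gauss_def)

lemma gauss_le_1: "a \<ge> 0 \<Longrightarrow> gauss a x \<le> 1"
  by (simp add: gauss_def)

lemma gauss_minus [simp]: "gauss a (- x) = gauss a x"
  by (simp add: gauss_def)

lemma measurable_gauss [measurable (raw)]:
  "f \<in> borel_measurable M \<Longrightarrow> (\<lambda>x. gauss a (f x)) \<in> borel_measurable M"
  unfolding gauss_def by measurable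

lemma continuous_on_gauss [continuous_intros]:
  "continuous_on A f \<Longrightarrow> continuous_on A (\<lambda>x. gauss a (f x))"
  unfolding gauss_def by (intro continuous_intros)

text \<open>This is the characteristic function of the standard normal distribution, rescaled: x =
  sqrt (2 a) y turns exp (- x^2 / 2) into exp (- a y^2), and the frequency becomes - t / sqrt (2
  a).\<close>

lemma gauss_real_fourier:
  fixes a t :: real
  assumes a: "a > 0"
  shows "integrable lborel (\<lambda>x. exp (- \<i> * complex_of_real (t * x)) * complex_of_real (exp (- a * x\<^sup>2)))" (is ?int)
    and "(LBINT x. exp (- \<i> * complex_of_real (t * x)) * complex_of_real (exp (- a * x\<^sup>2)))
      = complex_of_real (sqrt (pi / a) * exp (- t\<^sup>2 / (4 * a)))"
proof -
  let ?I = "LBINT x. exp (- \<i> * complex_of_real (t * x)) * complex_of_real (exp (- a * x\<^sup>2))"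
  let ?c = "sqrt (2 * a)"
  have c: "?c > 0" using a by simp
  have int0: "integrable lborel (\<lambda>x. exp (- a * x\<^sup>2))"
  proof -
    have "integrable lborel (\<lambda>x. std_normal_density (0 + ?c * x))"
      using c by (intro lborel_integrable_real_affine) auto
    then have "integrable lborel (\<lambda>x. sqrt (2 * pi) * std_normal_density (0 + ?c * x))"
      by simp
    then show ?thesis
      using a by (simp add: std_normal_density_def power_mult_distrib field_simps)
  qed
  show ?int
    by (rule Bochner_Integration.integrable_bound[OF int0]) (auto simp: norm_mult norm_exp_eq_Re)
  have "char std_normal_distribution s = (LBINT x. complex_of_real (std_normal_density x) * iexp (s * x))" for s
    unfolding char_def
    by (subst integral_density) (auto simp: scaleR_conv_of_real)
  then have ch: "(LBINT x. complex_of_real (std_normal_density x) * iexp (s * x)) = complex_of_real (exp (- s\<^sup>2 / 2))" for s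
    using char_std_normal_distribution by metis
  have "complex_of_real (exp (- (- t / ?c)\<^sup>2 / 2)) = (LBINT x. complex_of_real (std_normal_density x) * iexp (- t / ?c * x))"
    by (rule ch[symmetric])
  also have "\<dots> = ?c *\<^sub>R (LBINT x. complex_of_real (std_normal_density (0 + ?c * x)) * iexp (- t / ?c * (0 + ?c * x)))"
    by (subst lborel_integral_real_affine[of ?c _ 0]) (use c in auto)
  also have "(\<lambda>x. complex_of_real (std_normal_density (0 + ?c * x)) * iexp (- t / ?c * (0 + ?c * x)))
      = (\<lambda>x. complex_of_real (1 / sqrt (2 * pi)) * (exp (- \<i> * complex_of_real (t * x)) * complex_of_real (exp (- a * x\<^sup>2))))"
    using a by (auto simp: std_normal_density_def power_mult_distrib field_simps fun_eq_iff)
  also have "?c *\<^sub>R (LBINT x. \<dots> x) = complex_of_real (?c / sqrt (2 * pi)) * ?I"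
    by (subst integral_mult_right_zero) (simp add: scaleR_conv_of_real)
  finally have e: "complex_of_real (?c / sqrt (2 * pi)) * ?I
     = complex_of_real (exp (- (- t / ?c)\<^sup>2 / 2))" by simp
  have s: "sqrt (pi / a) * (?c / sqrt (2 * pi)) = 1"
    using a by (simp add: real_sqrt_divide real_sqrt_mult)
  have "?I
    = complex_of_real (sqrt (pi / a) * (?c / sqrt (2 * pi))) * ?I"
    unfolding s by simp
  also have "\<dots> = complex_of_real (sqrt (pi / a)) * complex_of_real (exp (- (- t / ?c)\<^sup>2 / 2))"
    unfolding e[symmetric] of_real_mult by (simp only: mult_ac)
  also have "\<dots> = complex_of_real (sqrt (pi / a) * exp (- t\<^sup>2 / (4 * a)))"
    using a by (simp add: power_divide)
  finally show "?I
      = complex_of_real (sqrt (pi / a) * exp (- t\<^sup>2 / (4 * a)))" .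
qed

lemma gauss_prod_Basis: "cgauss a x = (\<Prod>b\<in>Basis. complex_of_real (exp (- a * (x \<bullet> b)\<^sup>2)))"
proof -
  have "(norm x)\<^sup>2 = (\<Sum>b\<in>Basis. (x \<bullet> b)\<^sup>2)"
    by (subst power2_norm_eq_inner, subst euclidean_inner) (simp add: power2_eq_square)
  then show ?thesis
    by (simp only: gauss_def sum_distrib_left exp_sum finite_Basis of_real_prod)
qed

lemma wave_prod_Basis: "wave \<xi> x = (\<Prod>b\<in>Basis. exp (- \<i> * complex_of_real ((\<xi> \<bullet> b) * (x \<bullet> b))))"
  by (simp add: wave_def euclidean_inner[of \<xi> x] exp_sum[symmetric] sum_distrib_left sum_negf)

lemma gauss_fourier:
  fixes \<xi> :: "'a::euclidean_space"
  assumes a: "a > 0"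
  shows "integrable lborel (\<lambda>x. wave \<xi> x * cgauss a x)"
    and "(LBINT x. wave \<xi> x * cgauss a x)
      = complex_of_real (sqrt (pi / a) ^ DIM('a) * gauss (1 / (4 * a)) \<xi>)"
proof -
  let ?f = "\<lambda>b x. exp (- \<i> * complex_of_real ((\<xi> \<bullet> b) * x)) * complex_of_real (exp (- a * x\<^sup>2))"
  have eq: "wave \<xi> x * cgauss a x = (\<Prod>b\<in>Basis. ?f b (x \<bullet> b))" for x
    unfolding gauss_prod_Basis wave_prod_Basis prod.distrib ..
  show "integrable lborel (\<lambda>x. wave \<xi> x * cgauss a x)"
    unfolding eq by (rule lborel_integral_prod) (rule gauss_real_fourier[OF a])
  have "(LBINT x. wave \<xi> x * cgauss a x) = (\<Prod>b\<in>Basis. LBINT x. ?f b x)"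
    unfolding eq by (rule lborel_integral_prod) (rule gauss_real_fourier[OF a])
  also have "\<dots> = (\<Prod>b\<in>Basis. complex_of_real (sqrt (pi / a)) * complex_of_real (exp (- (1 / (4 * a)) * (\<xi> \<bullet> b)\<^sup>2)))"
    by (intro prod.cong refl, subst gauss_real_fourier(2)[OF a]) (simp add: field_simps)
  also have "\<dots> = complex_of_real (sqrt (pi / a) ^ DIM('a) * gauss (1 / (4 * a)) \<xi>)"
    unfolding prod.distrib gauss_prod_Basis of_real_mult by simp
  finally show "(LBINT x. wave \<xi> x * cgauss a x)
      = complex_of_real (sqrt (pi / a) ^ DIM('a) * gauss (1 / (4 * a)) \<xi>)" .
qed

lemma integrable_gauss: "a > 0 \<Longrightarrow> integrable lborel (gauss a :: 'a::euclidean_space \<Rightarrow> real)"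
  using integrable_Re[OF gauss_fourier(1)[of a 0]] by simp

lemma integral_gauss: "a > 0 \<Longrightarrow> (LBINT x. gauss a (x::'a::euclidean_space)) = sqrt (pi / a) ^ DIM('a)"
  using gauss_fourier(2)[of a 0] by (simp add: gauss_def flip: of_real_power)

text \<open>Through the right inverse \<open>S\<close>, measurability of \<open>f\<close> is
  recovered from that of its composite with \<open>T\<close>. The statements therefore hold for
  every \<open>f\<close>, both integrals being 0 by convention in the non-integrable case.\<close>

lemma integral_lborel_invariant:
  fixes f :: "'a::euclidean_space \<Rightarrow> 'b::{banach, second_countable_topology}"
  assumes T[measurable]: "T \<in> borel_measurable borel" "S \<in> borel_measurable borel"
    and inv: "\<And>x. T (S x) = x" and D: "distr lborel borel T = (lborel :: 'a measure)"
  shows "integrable lborel (\<lambda>x. f (T x)) \<longleftrightarrow> integrable lborel f"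
    and "(LBINT x. f (T x)) = (LBINT x. f x)"
proof -
  have m: "f \<in> borel_measurable borel" if "(\<lambda>x. f (T x)) \<in> borel_measurable borel"
    using measurable_compose[OF T(2) that] by (simp add: inv)
  have A: "integrable lborel f \<longleftrightarrow> integrable lborel (\<lambda>x. f (T x))" if "f \<in> borel_measurable borel"
    using integrable_distr_eq[of T lborel borel f] that by (simp add: D)
  show i: "integrable lborel (\<lambda>x. f (T x)) \<longleftrightarrow> integrable lborel f"
  proof
    assume I: "integrable lborel (\<lambda>x. f (T x))"
    then have "(\<lambda>x. f (T x)) \<in> borel_measurable lborel" by (rule borel_measurable_integrable)
    then show "integrable lborel f" using A[OF m] I by simp
  next
    assume I: "integrable lborel f"
    then have "f \<in> borel_measurable lborel" by (rule borel_measurable_integrable)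
    then show "integrable lborel (\<lambda>x. f (T x))" using A I by simp
  qed
  show "(LBINT x. f (T x)) = (LBINT x. f x)"
  proof (cases "integrable lborel f")
    case True
    then have "f \<in> borel_measurable lborel" by (rule borel_measurable_integrable)
    then show ?thesis using integral_distr[of T lborel borel f] by (simp add: D)
  qed (simp add: i not_integrable_integral_eq)
qed

lemma lborel_distr_uminus_euclidean: "distr lborel borel uminus = (lborel :: 'a::euclidean_space measure)"
  using lborel_affine[of "-1" "0::'a"] by (simp add: density_1)

lemma integral_translate:
  fixes f :: "'a::euclidean_space \<Rightarrow> 'b::{banach, second_countable_topology}"
  shows "integrable lborel (\<lambda>x. f (t + x)) \<longleftrightarrow> integrable lborel f"
    and "(LBINT x. f (t + x)) = (LBINT x. f x)"
  by (rule integral_lborel_invariant[where S="\<lambda>x. - t + x"]; simp add: lborel_distr_plus)+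

lemma integral_reflect:
  fixes f :: "'a::euclidean_space \<Rightarrow> 'b::{banach, second_countable_topology}"
  shows "integrable lborel (\<lambda>x. f (- x)) \<longleftrightarrow> integrable lborel f"
    and "(LBINT x. f (- x)) = (LBINT x. f x)"
  by (rule integral_lborel_invariant[where S=uminus]; simp add: lborel_distr_uminus_euclidean)+

section \<open>The Fourier transform of integrable functions\<close>

lemma integral_scale:
  fixes f :: "'a::euclidean_space \<Rightarrow> 'b::{banach, second_countable_topology}"
  assumes [measurable]: "f \<in> borel_measurable borel" and c: "c \<noteq> 0"
  shows "(LBINT x. f x) = (\<bar>c\<bar> ^ DIM('a)) *\<^sub>R (LBINT x. f (t + c *\<^sub>R x))"
  by (subst lborel_affine[OF c, of t])
     (simp add: integral_density integral_distr)

lemma continuous_fourier_L1: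
  assumes f: "integrable lborel f"
  shows "continuous_on UNIV (fourier_L1 f)"
  unfolding continuous_on_sequentially comp_def
proof (intro ballI allI impI, elim conjE)
  fix X :: "nat \<Rightarrow> 'a" and \<xi> assume X: "X \<longlonglongrightarrow> \<xi>"
  have [measurable]: "f \<in> borel_measurable borel" using f by simp
  show "(\<lambda>n. fourier_L1 f (X n)) \<longlonglongrightarrow> fourier_L1 f \<xi>"
    unfolding fourier_L1_wave
  proof (rule integral_dominated_convergence[where w="\<lambda>x. norm (f x)"])
    show "AE x in lborel. (\<lambda>n. wave (X n) x * f x) \<longlonglongrightarrow> wave \<xi> x * f x"
    proof (rule AE_I2)
      fix x
      have "continuous_on UNIV (\<lambda>\<xi>. wave \<xi> x * f x)" by (intro continuous_intros)
      then show "(\<lambda>n. wave (X n) x * f x) \<longlonglongrightarrow> wave \<xi> x * f x"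
        using X by (auto simp: continuous_on_sequentially comp_def)
    qed
  qed (use f in \<open>auto simp: norm_mult\<close>)
qed

lemma measurable_fourier_L1 [measurable]:
  "integrable lborel f \<Longrightarrow> fourier_L1 f \<in> borel_measurable borel"
  by (intro borel_measurable_continuous_onI continuous_fourier_L1)

lemma integrable_wave:
  assumes "integrable lborel f" shows "integrable lborel (\<lambda>x. wave \<xi> x * f x)"
  by (rule Bochner_Integration.integrable_bound[OF assms]) (use assms in \<open>auto simp: norm_mult\<close>)

lemma norm_fourier_L1_le:
  shows "norm (fourier_L1 f \<xi>) \<le> (LBINT x. norm (f x))"
proof -
  have "norm (fourier_L1 f \<xi>) \<le> (LBINT x. norm (wave \<xi> x * f x))"
    unfolding fourier_L1_wave by (rule integral_norm_bound)
  then show ?thesis by (simp add: norm_mult)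
qed

lemma integrable_prod_bound:
  fixes H :: "'a::euclidean_space \<Rightarrow> 'b::euclidean_space \<Rightarrow> complex"
    and f :: "'a \<Rightarrow> complex" and g :: "'b \<Rightarrow> complex"
  assumes f: "integrable lborel f" and g: "integrable lborel g"
    and H: "(\<lambda>(x, y). H x y) \<in> borel_measurable (borel \<Otimes>\<^sub>M borel)"
    and le: "\<And>x y. norm (H x y) \<le> norm (f x) * norm (g y)"
  shows "integrable (lborel \<Otimes>\<^sub>M lborel) (\<lambda>(x, y). H x y)"
proof -
  have [measurable]: "f \<in> borel_measurable borel" "g \<in> borel_measurable borel" using f g by simp_all
  have "integrable (lborel \<Otimes>\<^sub>M lborel) (\<lambda>(x, y). norm (f x) * norm (g y))"
    by (rule lborel_pair.Fubini_integrable)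
       (use integrable_norm[OF f] integrable_norm[OF g] in \<open>auto simp: split_beta' abs_mult\<close>)
  then show ?thesis
    by (rule Bochner_Integration.integrable_bound) (use H le in \<open>auto simp: split_beta' abs_mult\<close>)
qed

text \<open>Fubini: the kernel \<open>wave\<close> is symmetric and has modulus 1, so the double
  integral is dominated by the product of the two L1 functions.\<close>

lemma fourier_L1_mult:
  fixes f g :: "'a::euclidean_space \<Rightarrow> complex"
  assumes f: "integrable lborel f" and g: "integrable lborel g"
  shows "(LBINT \<xi>. fourier_L1 f \<xi> * g \<xi>) = (LBINT x. f x * fourier_L1 g x)"
proof -
  have [measurable]: "f \<in> borel_measurable borel" "g \<in> borel_measurable borel" using f g by simp_all
  have "integrable (lborel \<Otimes>\<^sub>M lborel) (\<lambda>(x, \<xi>). wave \<xi> x * f x * g \<xi>)"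
    by (rule integrable_prod_bound[OF f g]) (auto simp: norm_mult)
  from lborel_pair.Fubini_integral[OF this]
  have *: "(LBINT \<xi>. LBINT x. wave \<xi> x * f x * g \<xi>) = (LBINT x. LBINT \<xi>. wave \<xi> x * f x * g \<xi>)" .
  have 1: "(LBINT x. wave \<xi> x * f x * g \<xi>) = fourier_L1 f \<xi> * g \<xi>" for \<xi>
    unfolding fourier_L1_wave by simp
  have 2: "(LBINT \<xi>. wave \<xi> x * f x * g \<xi>) = f x * fourier_L1 g x" for x
    unfolding fourier_L1_wave by (subst integral_mult_right_zero[symmetric]) (simp add: wave_commute[of x] mult_ac)
  show ?thesis using * unfolding 1 2 .
qed

lemma integrable_wave_gauss:
  "a > 0 \<Longrightarrow> integrable lborel (\<lambda>x. wave p x * cgauss a x)"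
  by (rule gauss_fourier)

lemma fourier_wave_gauss:
  fixes \<xi> p :: "'a::euclidean_space"
  assumes "a > 0"
  shows "fourier_L1 (\<lambda>x. wave p x * cgauss a x) \<xi>
    = complex_of_real (sqrt (pi / a) ^ DIM('a) * gauss (1 / (4 * a)) (\<xi> + p))"
  unfolding fourier_L1_wave gauss_fourier(2)[OF assms, symmetric] wave_add by (simp add: mult_ac)

text \<open>By the multiplication formula all Gaussian convolutions of \<open>k\<close> vanish; let their width tend to \<open>0\<close>.\<close>

lemma continuous_fourier_test:
  fixes k :: "'a::euclidean_space \<Rightarrow> complex"
  assumes k: "integrable lborel k" and 0: "\<And>\<xi>. fourier_L1 k \<xi> = 0"
    and \<psi>: "continuous_on UNIV \<psi>" and M: "\<And>x. norm (\<psi> x :: complex) \<le> M"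
  shows "(LBINT x. k x * \<psi> x) = 0"
proof -
  have [measurable]: "k \<in> borel_measurable borel" using k by simp
  have [measurable]: "\<psi> \<in> borel_measurable borel" using \<psi> by (rule borel_measurable_continuous_onI)
  have M0: "M \<ge> 0" using M[of 0] norm_ge_zero[of "\<psi> 0"] by linarith
  have gi: "integrable lborel (\<lambda>x. cgauss a (x::'a))" if "a > 0" for a
    by (rule integrable_of_real[OF integrable_gauss[OF that]])
  \<comment> \<open>\<open>b\<close> is chosen so that 1 / (4 b) = a: up to a positive constant, the
    Gaussian centred at \<open>y\<close> is then the transform of \<open>wave (- y)\<close> times
    \<open>gauss b\<close>.\<close>
  have A: "(LBINT x. k x * cgauss a (x - y)) = 0" if a: "a > 0" for a y
  proof -
    define b where "b = 1 / (4 * a)"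
    have b: "b > 0" "1 / (4 * b) = a" using a by (auto simp: b_def)
    have "0 = (LBINT x. k x * fourier_L1 (\<lambda>x. wave (- y) x * cgauss b x) x)"
      by (subst fourier_L1_mult[OF k integrable_wave_gauss[OF b(1)], symmetric]) (simp add: 0)
    also have "\<dots> = complex_of_real (sqrt (pi / b) ^ DIM('a)) * (LBINT x. k x * cgauss a (x - y))"
      unfolding fourier_wave_gauss[OF b(1)] b(2)
      by (subst integral_mult_right_zero[symmetric]) (simp add: mult_ac)
    finally show ?thesis using b by auto
  qed
  have B: "(LBINT x. k x * (LBINT z. \<psi> (x + s *\<^sub>R z) * cgauss 1 z)) = 0" if s: "s > 0" for s
  proof -
    \<comment> \<open>With this parameter the substitution y = x + s z turns the convolution kernel
      into the fixed Gaussian \<open>gauss 1\<close>; shrinking \<open>s\<close> then only moves the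
      argument of \<psi> towards x.\<close>
    define a where "a = 1 / s\<^sup>2"
    have a: "a > 0" using s by (simp add: a_def)
    have ga: "gauss a (s *\<^sub>R z) = gauss 1 z" for z :: 'a
      using s by (simp add: gauss_def a_def power_mult_distrib)
    have gs: "integrable lborel (\<lambda>z. cgauss a ((z::'a) - x))" for x
      using gi[OF a] integral_translate(1)[of "\<lambda>z. cgauss a z" "- x"] by simp
    have 1: "(LBINT y. \<psi> y * cgauss a (y - x))
        = (\<bar>s\<bar> ^ DIM('a)) *\<^sub>R (LBINT z. \<psi> (x + s *\<^sub>R z) * cgauss 1 z)" for x
      by (subst integral_scale[where c=s and t=x]) (use s in \<open>auto simp: ga\<close>)
    have m: "integrable (lborel \<Otimes>\<^sub>M lborel) (\<lambda>(x, y). k x * (\<psi> y * cgauss a (y - x)))"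
    \<comment> \<open>Since \<psi> is merely bounded, \<open>y\<close> is integrated first: the
      inner integral is at most M times the mass of the Gaussian, uniformly in \<open>x\<close>, and
      \<open>k\<close> takes care of the outer one.\<close>
    proof (rule lborel_pair.Fubini_integrable)
      have e: "(LBINT y. norm (k x * (\<psi> y * cgauss a (y - x))))
          = norm (k x) * (LBINT y. norm (\<psi> (x + y)) * gauss a y)" for x
        by (subst integral_translate(2)[symmetric, of _ x]) (simp add: norm_mult)
      have "integrable lborel (\<lambda>x. norm (k x) * (LBINT y. norm (\<psi> (x + y)) * gauss a y))"
      proof (rule Bochner_Integration.integrable_bound)
        show "integrable lborel (\<lambda>x. norm (k x) * (M * (LBINT y. gauss a (y::'a))))"
          using k by simp
        have "(LBINT y. norm (\<psi> (x + y)) * gauss a y) \<le> M * (LBINT y. gauss a (y::'a))" for x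
        proof -
          have "(LBINT y. norm (\<psi> (x + y)) * gauss a y) \<le> (LBINT y. M * gauss a (y::'a))"
            by (rule integral_mono_AE')
               (use integrable_gauss[OF a] M M0 in \<open>auto intro!: mult_right_mono\<close>)
          then show ?thesis by simp
        qed
        moreover have "0 \<le> (LBINT y. norm (\<psi> (x + y)) * gauss a y)" for x
          by (intro Bochner_Integration.integral_nonneg) auto
        ultimately show "AE x in lborel. norm (norm (k x) * (LBINT y. norm (\<psi> (x + y)) * gauss a y))
           \<le> norm (norm (k x) * (M * (LBINT y. gauss a (y::'a))))"
          by (intro AE_I2) (smt (verit, best) mult_left_mono norm_ge_zero real_norm_def zero_le_mult_iff)
      qed measurable
      then show "integrable lborel (\<lambda>x. LBINT y. norm (case (x, y) of (x, y) \<Rightarrow> k x * (\<psi> y * cgauss a (y - x))))"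
        by (simp add: e)
      have "integrable lborel (\<lambda>y. \<psi> y * cgauss a (y - x))" for x
        by (rule Bochner_Integration.integrable_bound[where f="\<lambda>y. M * cgauss a (y - x)"])
           (use gs[of x] M M0 in \<open>auto simp: norm_mult intro!: mult_right_mono\<close>)
      then show "AE x in lborel. integrable lborel (\<lambda>y. case (x, y) of (x, y) \<Rightarrow> k x * (\<psi> y * cgauss a (y - x)))"
        by simp
    qed (auto simp: split_beta')
    have "(LBINT x. k x * (LBINT y. \<psi> y * cgauss a (y - x)))
      = (LBINT x. LBINT y. k x * (\<psi> y * cgauss a (y - x)))" by simp
    also have "\<dots> = (LBINT y. LBINT x. k x * (\<psi> y * cgauss a (y - x)))"
      using lborel_pair.Fubini_integral[OF m] by simp
    also have "\<dots> = (LBINT y. \<psi> y * (LBINT x. k x * cgauss a (x - y)))"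
      by (subst integral_mult_right_zero[symmetric])
         (simp add: gauss_def norm_minus_commute mult_ac)
    also have "\<dots> = 0" by (simp add: A[OF a])
    finally have "(LBINT x. k x * (LBINT y. \<psi> y * cgauss a (y - x))) = 0" .
    then show ?thesis
      unfolding 1 using s by simp
  qed
  define C where "C = (LBINT z. gauss 1 (z::'a))"
  have C: "C > 0" by (simp add: C_def integral_gauss)
  define P where "P n x = (LBINT z. \<psi> (x + (1 / real (Suc n)) *\<^sub>R z) * cgauss 1 z)" for n x
  have P: "(\<lambda>n. P n x) \<longlonglongrightarrow> \<psi> x * complex_of_real C" for x
  proof -
    have "(\<lambda>n. P n x) \<longlonglongrightarrow> (LBINT z. \<psi> x * cgauss 1 (z::'a))"
      unfolding P_def
    proof (rule integral_dominated_convergence[where w="\<lambda>z. M * gauss 1 z"])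
      show "AE z in lborel. (\<lambda>n. \<psi> (x + (1 / real (Suc n)) *\<^sub>R z) * cgauss 1 z)
           \<longlonglongrightarrow> \<psi> x * cgauss 1 z"
      proof (rule AE_I2)
        fix z
        have "(\<lambda>n. x + (1 / real (Suc n)) *\<^sub>R z) \<longlonglongrightarrow> x + 0 *\<^sub>R z"
          by (intro tendsto_intros LIMSEQ_Suc[OF lim_1_over_n])
        then have "(\<lambda>n. \<psi> (x + (1 / real (Suc n)) *\<^sub>R z)) \<longlonglongrightarrow> \<psi> x"
          using \<psi> by (auto simp: continuous_on_sequentially comp_def)
        then show "(\<lambda>n. \<psi> (x + (1 / real (Suc n)) *\<^sub>R z) * cgauss 1 z)
           \<longlonglongrightarrow> \<psi> x * cgauss 1 z" by (intro tendsto_intros)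
      qed
    qed (use integrable_gauss[of 1] M in \<open>auto simp: norm_mult intro!: mult_right_mono\<close>)
    then show ?thesis by (simp add: C_def)
  qed
  have Pb: "norm (P n x) \<le> M * C" for n x
  proof -
    have "norm (P n x) \<le> (LBINT z. norm (\<psi> (x + (1 / real (Suc n)) *\<^sub>R z) * cgauss 1 z))"
      unfolding P_def by (rule integral_norm_bound)
    also have "\<dots> \<le> (LBINT z. M * gauss 1 (z::'a))"
      by (rule integral_mono_AE')
         (use integrable_gauss[of 1] M M0 in \<open>auto simp: norm_mult intro!: mult_right_mono\<close>)
    finally show ?thesis by (simp add: C_def)
  qed
  have "(\<lambda>n. LBINT x. k x * P n x) \<longlonglongrightarrow> (LBINT x. k x * (\<psi> x * complex_of_real C))"
  proof (rule integral_dominated_convergence[where w="\<lambda>x. norm (k x) * (M * C)"])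
    show "(\<lambda>x. k x * P n x) \<in> borel_measurable lborel" for n
      unfolding P_def by measurable
  qed (use k P Pb in \<open>auto simp: norm_mult intro!: mult_left_mono tendsto_mult_left\<close>)
  moreover have "(LBINT x. k x * P n x) = 0" for n
    unfolding P_def by (rule B) simp
  ultimately have "(LBINT x. k x * (\<psi> x * complex_of_real C)) = 0"
    by (simp add: LIMSEQ_const_iff)
  then have "(LBINT x. (k x * \<psi> x) * complex_of_real C) = 0" by (simp add: mult_ac)
  then show ?thesis using C by (simp add: integral_mult_left_zero)
qed

text \<open>Continuous cut-offs approximate the indicators of closed sets, so \<open>k\<close> has
  integral 0 over every closed set. Closed sets form an intersection-stable generator, hence the
  same holds over every Borel set, and \<open>k\<close> vanishes almost everywhere.\<close>

lemma fourier_L1_inj: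
  fixes k :: "'a::euclidean_space \<Rightarrow> complex"
  assumes k: "integrable lborel k" and 0: "\<And>\<xi>. fourier_L1 k \<xi> = 0"
  shows "AE x in lborel. k x = 0"
proof -
  have [measurable]: "k \<in> borel_measurable borel" using k by simp
  have si: "set_integrable lborel A k" if "A \<in> sets borel" for A
    unfolding set_integrable_def using that k by (intro integrable_mult_indicator) auto
  have cl: "set_lebesgue_integral lborel A k = 0" if A: "closed A" for A
  \<comment> \<open>The empty set is separate because \<open>infdist\<close> to it is 0 by
    convention. Otherwise \<open>p n\<close> is 1 on \<open>A\<close>, and off \<open>A\<close> it
    is eventually 0 because a closed set has positive distance from outside points.\<close>
  proof (cases "A = {}")
    case False
    have [measurable]: "A \<in> sets borel" using A by simp
    define p where "p n x = complex_of_real (max 0 (1 - real n * infdist x A))" for n x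
    have pc: "continuous_on UNIV (p n)" for n
      unfolding p_def by (intro continuous_intros continuous_on_infdist)
    have [measurable]: "p n \<in> borel_measurable borel" for n
      by (rule borel_measurable_continuous_onI[OF pc])
    have "(\<lambda>n. LBINT x. k x * p n x) \<longlonglongrightarrow> (LBINT x. indicator A x *\<^sub>R k x)"
    proof (rule integral_dominated_convergence[where w="\<lambda>x. norm (k x)"])
      show "(\<lambda>x. k x * p n x) \<in> borel_measurable lborel" for n
        by measurable
      show "AE x in lborel. (\<lambda>n. k x * p n x) \<longlonglongrightarrow> indicator A x *\<^sub>R k x"
      proof (rule AE_I2)
        fix x
        show "(\<lambda>n. k x * p n x) \<longlonglongrightarrow> indicator A x *\<^sub>R k x"
        proof (cases "x \<in> A")
          case True
          then show ?thesis by (simp add: p_def)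
        next
          case f: False
          have pos: "infdist x A > 0" using in_closed_iff_infdist_zero[OF A False] f infdist_nonneg[of x A] by simp
          obtain N where N: "real N * infdist x A > 1"
            using reals_Archimedean3[OF pos] by blast
          have "p n x = 0" if "n \<ge> N" for n
          proof -
            have "real n * infdist x A \<ge> real N * infdist x A"
              using that pos by (intro mult_right_mono) auto
            then show ?thesis using N by (simp add: p_def)
          qed
          then have "eventually (\<lambda>n. k x * p n x = 0) sequentially"
            using eventually_sequentially by auto
          then show ?thesis using f by (simp add: tendsto_eventually)
        qed
      qed
      show "AE x in lborel. norm (k x * p n x) \<le> norm (k x)" for n
      proof (rule AE_I2)
        fix x
        have "norm (p n x) \<le> 1"
          using infdist_nonneg[of x A] by (auto simp: p_def norm_of_real)
        then show "norm (k x * p n x) \<le> norm (k x)"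
          unfolding norm_mult by (intro mult_left_le) auto
      qed
    qed (use k in auto)
    moreover have "(LBINT x. k x * p n x) = 0" for n
    proof (rule continuous_fourier_test[OF k 0])
      show "continuous_on UNIV (p n)"
        by (rule pc)
      show "norm (p n x) \<le> 1" for x
        using infdist_nonneg[of x A] by (auto simp: p_def norm_of_real)
    qed
    ultimately show ?thesis by (simp add: LIMSEQ_const_iff set_lebesgue_integral_def)
  qed (simp add: set_lebesgue_integral_def)
  have all: "set_lebesgue_integral lborel A k = 0" if "A \<in> sets borel" for A
  proof -
    have sets_eq: "sigma_sets UNIV (Collect closed) = sets (borel :: 'a measure)"
      unfolding borel_eq_closed by (simp add: sets_measure_of)
    have "A \<in> sigma_sets UNIV (Collect closed)"
      using that by (simp add: sets_eq)
    have st: "Int_stable (Collect closed :: 'a set set)" by (auto simp: Int_stable_def)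
    have sub: "Collect closed \<subseteq> Pow (UNIV :: 'a set)" by simp
    from st sub \<open>A \<in> sigma_sets UNIV (Collect closed)\<close> show ?thesis
    proof (induction A rule: sigma_sets_induct_disjoint)
      case (compl A)
      then have A[measurable]: "A \<in> sets borel" by (simp add: sets_eq)
      have "set_lebesgue_integral lborel (A \<union> (UNIV - A)) k
          = set_lebesgue_integral lborel A k + set_lebesgue_integral lborel (UNIV - A) k"
        by (rule set_integral_Un) (use si A in auto)
      then show ?case using compl cl[of UNIV] by simp
    next
      case (union B)
      then have m: "\<And>i. B i \<in> sets borel" by (auto simp: sets_eq)
      then have "set_lebesgue_integral lborel (\<Union>i. B i) k = (\<Sum>i. set_lebesgue_integral lborel (B i) k)"
        using union(1) by (intro lebesgue_integral_countable_add si) (auto simp: disjoint_family_on_def)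
      then show ?case using union by simp
    qed (auto simp: cl)
  qed
  show ?thesis
    by (rule sigma_finite_measure.density_zero[OF sigma_finite_lborel k]) (simp add: all)
qed

section \<open>Square integrable functions, completeness and the Plancherel bound\<close>

definition L2n :: "('a::euclidean_space \<Rightarrow> complex) \<Rightarrow> ennreal" where
  "L2n f = (\<integral>\<^sup>+x. ennreal ((norm (f x))\<^sup>2) \<partial>lborel)"

lemma square_integrable_L2n: "square_integrable f \<longleftrightarrow> f \<in> borel_measurable borel \<and> L2n f < \<infinity>"
  unfolding square_integrable_def L2n_def
  by (auto simp: integrable_iff_bounded)

lemma square_integrableD [measurable_dest]: "square_integrable f \<Longrightarrow> f \<in> borel_measurable borel"
  by (simp add: square_integrable_def)

lemma tendsto_L2_L2n: "tendsto_L2 F f \<longleftrightarrow> (\<lambda>k. L2n (\<lambda>x. F k x - f x)) \<longlonglongrightarrow> 0"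
  by (simp add: tendsto_L2_def L2n_def)

lemma sum_norm_power2_le: "(norm (a + b))\<^sup>2 \<le> 2 * (norm a)\<^sup>2 + 2 * (norm (b::complex))\<^sup>2"
proof -
  have "(norm (a + b))\<^sup>2 \<le> (norm a + norm b)\<^sup>2"
    by (intro power_mono norm_triangle_ineq) auto
  also have "\<dots> \<le> 2 * (norm a)\<^sup>2 + 2 * (norm b)\<^sup>2"
    using sum_squares_bound[of "norm a" "norm b"] by (simp add: power2_sum)
  finally show ?thesis .
qed

text \<open>The squared norm in the extended reals avoids roots and side conditions. The crude
  factor 2 replaces Minkowski's inequality and is good enough wherever only finiteness or
  convergence to 0 matters.\<close>

lemma L2n_add_le:
  assumes [measurable]: "f \<in> borel_measurable borel" "g \<in> borel_measurable borel"
  shows "L2n (\<lambda>x. f x + g x) \<le> 2 * L2n f + 2 * L2n g"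
proof -
  have "L2n (\<lambda>x. f x + g x) \<le> (\<integral>\<^sup>+x. 2 * ennreal ((norm (f x))\<^sup>2) + 2 * ennreal ((norm (g x))\<^sup>2) \<partial>lborel)"
    unfolding L2n_def
  proof (rule nn_integral_mono)
    fix x
    have "ennreal ((norm (f x + g x))\<^sup>2) \<le> ennreal (2 * (norm (f x))\<^sup>2 + 2 * (norm (g x))\<^sup>2)"
      by (intro ennreal_leI sum_norm_power2_le)
    then show "ennreal ((norm (f x + g x))\<^sup>2) \<le> 2 * ennreal ((norm (f x))\<^sup>2) + 2 * ennreal ((norm (g x))\<^sup>2)"
      by (simp add: ennreal_plus ennreal_mult')
  qed
  also have "\<dots> = 2 * L2n f + 2 * L2n g"
    by (simp add: nn_integral_add nn_integral_cmult L2n_def)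
  finally show ?thesis .
qed

lemma L2n_cmult:
  assumes [measurable]: "f \<in> borel_measurable borel"
  shows "L2n (\<lambda>x. c * f x) = ennreal ((norm c)\<^sup>2) * L2n f"
  by (simp add: L2n_def norm_mult power_mult_distrib ennreal_mult' nn_integral_cmult)

lemma L2n_diff_commute: "L2n (\<lambda>x. f x - g x) = L2n (\<lambda>x. g x - f x)"
  by (simp add: L2n_def norm_minus_commute)

lemma L2n_cong_AE: "AE x in lborel. f x = g x \<Longrightarrow> L2n f = L2n g"
  unfolding L2n_def by (rule nn_integral_cong_AE) auto

lemma L2n_eq_0_iff:
  assumes [measurable]: "f \<in> borel_measurable borel"
  shows "L2n f = 0 \<longleftrightarrow> (AE x in lborel. f x = 0)"
  unfolding L2n_def by (subst nn_integral_0_iff_AE) auto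

lemma square_integrable_add:
  "square_integrable f \<Longrightarrow> square_integrable g \<Longrightarrow> square_integrable (\<lambda>x. f x + g x)"
  using L2n_add_le[of f g]
  by (auto simp: square_integrable_L2n ennreal_mult_less_top intro: le_less_trans)

lemma square_integrable_cmult: "square_integrable f \<Longrightarrow> square_integrable (\<lambda>x. c * f x)"
  by (auto simp: square_integrable_L2n L2n_cmult ennreal_mult_less_top)

lemma square_integrable_diff:
  "square_integrable f \<Longrightarrow> square_integrable g \<Longrightarrow> square_integrable (\<lambda>x. f x - g x)"
  using square_integrable_add[of f "\<lambda>x. - 1 * g x"] square_integrable_cmult[of g "-1"] by simp

lemma square_integrable_bound:
  assumes "square_integrable f" "g \<in> borel_measurable borel" "\<And>x. norm (g x) \<le> norm (f x)"
  shows "square_integrable g"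
proof -
  have "L2n g \<le> L2n f"
    unfolding L2n_def by (intro nn_integral_mono ennreal_leI power_mono assms) auto
  then show ?thesis using assms by (auto simp: square_integrable_L2n)
qed

text \<open>Cauchy-Schwarz, kept in squared form in the extended reals, so that finiteness of both
  norms yields integrability of the product.\<close>

lemma L2_integrable_mult:
  assumes f: "square_integrable f" and g: "square_integrable g"
  shows "integrable lborel (\<lambda>x. f x * g x)"
    and "ennreal ((LBINT x. norm (f x * g x))\<^sup>2) \<le> L2n f * L2n g"
proof -
  note [measurable] = square_integrableD[OF f] square_integrableD[OF g]
  have le: "(\<integral>\<^sup>+x. ennreal (norm (f x * g x)) \<partial>lborel)\<^sup>2 \<le> L2n f * L2n g"
    using Cauchy_Schwarz_nn_integral[of "\<lambda>x. ennreal (norm (f x))" lborel "\<lambda>x. ennreal (norm (g x))"]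
    by (simp add: L2n_def norm_mult ennreal_mult' ennreal_power)
  also have "\<dots> < \<infinity>" using f g by (auto simp: square_integrable_L2n ennreal_mult_less_top)
  finally have "(\<integral>\<^sup>+x. ennreal (norm (f x * g x)) \<partial>lborel) < \<infinity>"
    by (simp add: power_less_top_ennreal)
  then show i: "integrable lborel (\<lambda>x. f x * g x)"
    by (intro integrableI_bounded) auto
  show "ennreal ((LBINT x. norm (f x * g x))\<^sup>2) \<le> L2n f * L2n g"
    using le nn_integral_eq_integral[OF integrable_norm[OF i]] by (simp add: ennreal_power)
qed

lemma square_integrable_gauss_wave:
  "a > 0 \<Longrightarrow> square_integrable (\<lambda>x. wave p x * cgauss a x)"
proof -
  assume a: "a > 0"
  have "(norm (wave p x * cgauss a x))\<^sup>2 = gauss (2 * a) x" for x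
    by (simp add: norm_mult gauss_def flip: exp_double)
  then show ?thesis using integrable_gauss[of "2 * a"] a by (simp add: square_integrable_def)
qed

text \<open>Multiplication by a Gaussian turns Cauchy sequences in \<open>L\<^sup>2\<close> into Cauchy sequences in \<open>L\<^sup>1\<close>, which
  yields an almost everywhere convergent subsequence.\<close>

lemma L2_complete:
  fixes F :: "nat \<Rightarrow> 'a::euclidean_space \<Rightarrow> complex"
  assumes F: "\<And>n. square_integrable (F n)"
    and C: "\<And>e. e > 0 \<Longrightarrow> \<exists>M. \<forall>m\<ge>M. \<forall>n\<ge>M. L2n (\<lambda>x. F m x - F n x) < ennreal e"
  obtains f where "square_integrable f" "tendsto_L2 F f"
proof -
  note [measurable] = square_integrableD[OF F]
  let ?g = "\<lambda>x::'a. wave 0 x * cgauss 1 x"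
  have g: "square_integrable ?g" by (rule square_integrable_gauss_wave) simp
  define G where "G = enn2real (L2n ?g)"
  have G: "L2n ?g = ennreal G" "G \<ge> 0"
    using g by (auto simp: G_def square_integrable_L2n)
  define s where "s n x = F n x * ?g x" for n x
  have s: "integrable lborel (s n)" for n
    unfolding s_def by (rule L2_integrable_mult[OF F g])
  have Cs: "\<exists>N. \<forall>i\<ge>N. \<forall>j\<ge>N. (LINT x|lborel. norm (s i x - s j x)) < e" if e: "e > 0" for e
  proof -
    \<comment> \<open>By Cauchy-Schwarz against the Gaussian, the squared L1 distance is at most
      \<open>G\<close> times this bound, which is below e^2. The summand 1 keeps the quotient
      meaningful and the inequality strict.\<close>
    obtain M where M: "\<And>m n. m \<ge> M \<Longrightarrow> n \<ge> M \<Longrightarrow> L2n (\<lambda>x. F m x - F n x) < ennreal (e\<^sup>2 / (G + 1))"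
      using C[of "e\<^sup>2 / (G + 1)"] e G(2) by (auto simp: zero_less_divide_iff)
    have "(LINT x|lborel. norm (s i x - s j x)) < e" if "i \<ge> M" "j \<ge> M" for i j
    proof -
      have "ennreal ((LBINT x. norm ((F i x - F j x) * ?g x))\<^sup>2) \<le> L2n (\<lambda>x. F i x - F j x) * ennreal G"
        using L2_integrable_mult(2)[OF square_integrable_diff[OF F F] g, of i j] G by simp
      also have "\<dots> \<le> ennreal (e\<^sup>2 / (G + 1)) * ennreal G"
        using M[OF that] by (intro mult_right_mono) auto
      also have "\<dots> = ennreal (e\<^sup>2 / (G + 1) * G)"
        by (rule ennreal_mult''[symmetric]) (rule G(2))
      also have "\<dots> < ennreal (e\<^sup>2)"
        using G(2) e by (intro ennreal_lessI) (auto simp: field_simps)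
      finally have "(LBINT x. norm ((F i x - F j x) * ?g x))\<^sup>2 < e\<^sup>2"
        using e by (simp add: ennreal_less_iff)
      then show ?thesis
        using e by (simp add: s_def left_diff_distrib power2_less_imp_less)
    qed
    then show ?thesis by blast
  qed
  obtain r where r: "strict_mono r" "AE x in lborel. Cauchy (\<lambda>i. s (r i) x)"
    using cauchy_L1_AE_cauchy_subseq[OF s Cs] by blast
  define f where "f x = lim (\<lambda>i. F (r i) x)" for x
  have [measurable]: "f \<in> borel_measurable borel"
    unfolding f_def by measurable
  have lim: "AE x in lborel. (\<lambda>i. F (r i) x) \<longlonglongrightarrow> f x"
    using r(2)
  proof eventually_elim
    case (elim x)
    then obtain l where "(\<lambda>i. s (r i) x) \<longlonglongrightarrow> l"
      using Cauchy_convergent convergent_def by blast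
    then have "(\<lambda>i. s (r i) x / ?g x) \<longlonglongrightarrow> l / ?g x"
      by (intro tendsto_divide tendsto_const) auto
    then have "(\<lambda>i. F (r i) x) \<longlonglongrightarrow> l / ?g x" by (simp add: s_def)
    then show ?case unfolding f_def by (simp add: limI)
  qed
  \<comment> \<open>Fatou's lemma along the subsequence passes the Cauchy estimate to the limit in
    its second index. The first index stays arbitrary, so the whole sequence converges and not just
    the subsequence.\<close>
  have bd: "\<exists>M. \<forall>n\<ge>M. L2n (\<lambda>x. F n x - f x) \<le> ennreal e" if e: "e > 0" for e
  proof -
    obtain M where M: "\<And>m n. m \<ge> M \<Longrightarrow> n \<ge> M \<Longrightarrow> L2n (\<lambda>x. F m x - F n x) < ennreal e"
      using C[OF e] by blast
    have "L2n (\<lambda>x. F n x - f x) \<le> ennreal e" if n: "n \<ge> M" for n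
    proof -
      have "L2n (\<lambda>x. F n x - f x) = (\<integral>\<^sup>+x. liminf (\<lambda>i. ennreal ((norm (F n x - F (r i) x))\<^sup>2)) \<partial>lborel)"
        unfolding L2n_def
      proof (rule nn_integral_cong_AE, use lim in eventually_elim)
        case (elim x)
        then have "(\<lambda>i. ennreal ((norm (F n x - F (r i) x))\<^sup>2)) \<longlonglongrightarrow> ennreal ((norm (F n x - f x))\<^sup>2)"
          by (intro tendsto_intros)
        then show ?case using lim_imp_Liminf[of sequentially] by fastforce
      qed
      also have "\<dots> \<le> liminf (\<lambda>i. L2n (\<lambda>x. F n x - F (r i) x))"
        unfolding L2n_def by (rule nn_integral_liminf) measurable
      also have "\<dots> \<le> ennreal e"
      proof (rule Liminf_le)
        show "\<forall>\<^sub>F i in sequentially. L2n (\<lambda>x. F n x - F (r i) x) \<le> ennreal e"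
          using eventually_ge_at_top[of M]
        proof eventually_elim
          case (elim i)
          then have "r i \<ge> M" using seq_suble[OF r(1), of i] by simp
          then show ?case using M[OF n] less_imp_le by blast
        qed
      qed simp
      finally show ?thesis .
    qed
    then show ?thesis by blast
  qed
  obtain M where "L2n (\<lambda>x. F M x - f x) \<le> ennreal 1" using bd[of 1] by auto
  then have "square_integrable (\<lambda>x. F M x - f x)"
    by (auto simp: square_integrable_L2n intro: le_less_trans)
  from square_integrable_diff[OF F this, of M] have "square_integrable f" by simp
  moreover have "tendsto_L2 F f"
    unfolding tendsto_L2_L2n
  proof (rule tendsto_zero_ennreal)
    fix e :: real assume e: "0 < e"
    obtain M where "\<And>n. n \<ge> M \<Longrightarrow> L2n (\<lambda>x. F n x - f x) \<le> ennreal (e / 2)" using bd[of "e / 2"] e by auto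
    moreover have "ennreal (e / 2) < ennreal e" using e by (intro ennreal_lessI) auto
    ultimately show "\<forall>\<^sub>F n in sequentially. L2n (\<lambda>x. F n x - f x) < ennreal e"
      unfolding eventually_sequentially using le_less_trans by blast
  qed
  ultimately show ?thesis by (rule that)
qed

text \<open>With a Gaussian factor inserted, the left-hand side becomes \<open>\<integral>\<integral> f(x) cnj (f(y)) C gauss b (y - x)\<close>, which is
  estimated by \<open>2 |f(x) f(y)| \<le> |f(x)|\<^sup>2 + |f(y)|\<^sup>2\<close>; then the factor tends to \<open>1\<close>.\<close>

lemma L2n_fourier_L1_le:
  fixes f :: "'a::euclidean_space \<Rightarrow> complex"
  assumes f: "integrable lborel f" and f2: "square_integrable f"
  shows "L2n (fourier_L1 f) \<le> ennreal ((2 * pi) ^ DIM('a)) * L2n f"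
proof -
  note [measurable] = square_integrableD[OF f2] measurable_fourier_L1[OF f]
  define N where "N = enn2real (L2n f)"
  have N: "L2n f = ennreal N" "N \<ge> 0" using f2 by (auto simp: N_def square_integrable_L2n)
  have Nint: "(LBINT x. (norm (f x))\<^sup>2) = N"
    using N f2 nn_integral_eq_integral[of lborel "\<lambda>x. (norm (f x))\<^sup>2"]
    by (auto simp: square_integrable_def L2n_def)
  have bd: "(\<integral>\<^sup>+\<xi>. ennreal ((norm (fourier_L1 f \<xi>))\<^sup>2 * gauss a \<xi>) \<partial>lborel) \<le> ennreal ((2 * pi) ^ DIM('a) * N)"
    if a: "a > 0" for a
  proof -
    \<comment> \<open>\<open>b\<close> and \<open>C\<close> are the parameters of the transform of
      \<open>gauss a\<close>. The product of \<open>C\<close> with the mass of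
      \<open>gauss b\<close> is (2 pi)^d whatever \<open>a\<close> is, which makes the final bound
      independent of the damping.\<close>
    define b where "b = 1 / (4 * a)"
    define C where "C = sqrt (pi / a) ^ DIM('a)"
    let ?k = "\<lambda>x y. ennreal (C / 2 * ((norm (f x))\<^sup>2 * gauss b (y - x)))" and ?l = "\<lambda>x y. ennreal (C / 2 * ((norm (f y))\<^sup>2 * gauss b (y - x)))"
    have b: "b > 0" and C: "C > 0" using a by (auto simp: b_def C_def)
    have sq: "sqrt (pi / a) * sqrt (pi / b) = 2 * pi"
      using a by (simp add: b_def real_sqrt_mult[symmetric]) (rule real_sqrt_unique, auto simp: power2_eq_square)
    have CG: "C * (LBINT x. gauss b (x::'a)) = (2 * pi) ^ DIM('a)"
      unfolding integral_gauss[OF b] C_def power_mult_distrib[symmetric] sq ..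
    \<comment> \<open>Pairing the transform of \<open>f\<close> with \<open>g\<close> gives the
      damped squared norm, while the multiplication formula moves the transform onto
      \<open>g\<close>, where \<open>fg\<close> evaluates it as a Gaussian average of
      \<open>f\<close>.\<close>
    define g where "g \<xi> = cnj (fourier_L1 f \<xi>) * cgauss a \<xi>" for \<xi>
    have gi: "integrable lborel g"
    proof (rule Bochner_Integration.integrable_bound)
      show "integrable lborel (\<lambda>\<xi>::'a. (LBINT x. norm (f x)) * gauss a \<xi>)"
        using integrable_gauss[OF a] by (rule integrable_mult_right)
      show "AE \<xi> in lborel. norm (g \<xi>) \<le> norm ((LBINT x. norm (f x)) * gauss a \<xi>)"
        using norm_fourier_L1_le[of f] by (auto simp: g_def norm_mult intro!: mult_right_mono)
      show "g \<in> borel_measurable lborel"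
        unfolding g_def measurable_lborel2
        by (intro borel_measurable_continuous_onI continuous_intros continuous_fourier_L1 f)
    qed
    have fg: "fourier_L1 g x = cnj (LBINT y. f y * complex_of_real (C * gauss b (y - x)))" for x
    proof -
      have "fourier_L1 g x = cnj (LBINT \<xi>. fourier_L1 f \<xi> * (wave (- x) \<xi> * cgauss a \<xi>))"
        unfolding fourier_L1_wave[of g] Bochner_Integration.integral_cnj[symmetric]
        by (simp add: g_def cnj_wave mult_ac)
      also have "(LBINT \<xi>. fourier_L1 f \<xi> * (wave (- x) \<xi> * cgauss a \<xi>))
          = (LBINT y. f y * fourier_L1 (\<lambda>\<xi>. wave (- x) \<xi> * cgauss a \<xi>) y)"
        by (rule fourier_L1_mult[OF f integrable_wave_gauss[OF a]])
      also have "\<dots> = (LBINT y. f y * complex_of_real (C * gauss b (y - x)))"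
        unfolding fourier_wave_gauss[OF a] by (simp add: C_def b_def)
      finally show ?thesis .
    qed
    define D where "D x = (LBINT y. norm (f y) * norm (f x) * gauss b (y - x))" for x
    define I where "I = (LBINT \<xi>. (norm (fourier_L1 f \<xi>))\<^sup>2 * gauss a \<xi>)"
    have Iint: "integrable lborel (\<lambda>\<xi>. (norm (fourier_L1 f \<xi>))\<^sup>2 * gauss a \<xi>)"
    proof (rule Bochner_Integration.integrable_bound)
      show "integrable lborel (\<lambda>\<xi>::'a. (LBINT x. norm (f x))\<^sup>2 * gauss a \<xi>)"
        using integrable_gauss[OF a] by (rule integrable_mult_right)
      show "AE \<xi> in lborel. norm ((norm (fourier_L1 f \<xi>))\<^sup>2 * gauss a \<xi>) \<le> norm ((LBINT x. norm (f x))\<^sup>2 * gauss a \<xi>)"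
        using norm_fourier_L1_le[of f] by (auto simp: abs_mult intro!: mult_right_mono power_mono)
    qed measurable
    have "complex_of_real I = (LBINT \<xi>. fourier_L1 f \<xi> * g \<xi>)"
      unfolding I_def integral_complex_of_real[symmetric]
      by (intro Bochner_Integration.integral_cong) (simp_all add: g_def complex_norm_square[symmetric] flip: mult.assoc)
    also have "\<dots> = (LBINT x. f x * fourier_L1 g x)" by (rule fourier_L1_mult[OF f gi])
    finally have "\<bar>I\<bar> = norm (LBINT x. f x * fourier_L1 g x)"
      by (metis norm_of_real)
    also have "ennreal \<dots> \<le> (\<integral>\<^sup>+x. ennreal (norm (f x * fourier_L1 g x)) \<partial>lborel)"
      by (rule integral_norm_bound_ennreal)
         (rule Bochner_Integration.integrable_bound[where f="\<lambda>x. f x * complex_of_real (LBINT x. norm (g x))"],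
           use f gi norm_fourier_L1_le[of g] in \<open>auto simp: norm_mult intro!: mult_left_mono order.trans[OF norm_fourier_L1_le]\<close>)
    also have "\<dots> \<le> (\<integral>\<^sup>+x. \<integral>\<^sup>+y. ?k x y + ?l x y \<partial>lborel \<partial>lborel)"
    proof (rule nn_integral_mono)
      fix x
      have int: "integrable lborel (\<lambda>y. f y * complex_of_real (C * gauss b (y - x)))"
        by (rule Bochner_Integration.integrable_bound[where f="\<lambda>y. f y * complex_of_real C"])
           (use f C b gauss_le_1[of b] in \<open>auto simp: norm_mult abs_mult intro!: AE_I2 mult_left_mono mult_left_le\<close>)
      have "ennreal (norm (fourier_L1 g x)) \<le> (\<integral>\<^sup>+y. ennreal (norm (f y * complex_of_real (C * gauss b (y - x)))) \<partial>lborel)"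
        unfolding fg complex_mod_cnj by (rule integral_norm_bound_ennreal[OF int])
      then have "ennreal (norm (f x * fourier_L1 g x)) \<le> ennreal (norm (f x)) * (\<integral>\<^sup>+y. ennreal (norm (f y * complex_of_real (C * gauss b (y - x)))) \<partial>lborel)"
        by (simp add: norm_mult ennreal_mult' mult_left_mono)
      also have "\<dots> = (\<integral>\<^sup>+y. ennreal (norm (f x) * (norm (f y) * (C * gauss b (y - x)))) \<partial>lborel)"
        using C by (subst nn_integral_cmult[symmetric]) (auto simp: norm_mult abs_mult ennreal_mult')
      also have "\<dots> \<le> (\<integral>\<^sup>+y. ?k x y + ?l x y \<partial>lborel)"
      proof (rule nn_integral_mono)
        fix y
        have "2 * (norm (f x) * norm (f y)) \<le> (norm (f x))\<^sup>2 + (norm (f y))\<^sup>2"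
          using sum_squares_bound[of "norm (f x)" "norm (f y)"] by simp
        then have "(C / 2 * gauss b (y - x)) * (2 * (norm (f x) * norm (f y))) \<le> (C / 2 * gauss b (y - x)) * ((norm (f x))\<^sup>2 + (norm (f y))\<^sup>2)"
          using C by (intro mult_left_mono) auto
        then have "norm (f x) * (norm (f y) * (C * gauss b (y - x))) \<le> C / 2 * ((norm (f x))\<^sup>2 * gauss b (y - x)) + C / 2 * ((norm (f y))\<^sup>2 * gauss b (y - x))"
          by (simp add: algebra_simps)
        then have "ennreal (norm (f x) * (norm (f y) * (C * gauss b (y - x)))) \<le> ennreal (C / 2 * ((norm (f x))\<^sup>2 * gauss b (y - x)) + C / 2 * ((norm (f y))\<^sup>2 * gauss b (y - x)))"
          by (rule ennreal_leI)
        also have "\<dots> = ?k x y + ?l x y"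
          using C by (intro ennreal_plus) auto
        finally show "ennreal (norm (f x) * (norm (f y) * (C * gauss b (y - x)))) \<le> \<dots>" .
      qed
      finally show "ennreal (norm (f x * fourier_L1 g x)) \<le> \<dots>" .
    qed
    \<comment> \<open>Exchanging the order of integration in the second half and using that
      \<open>gauss\<close> is even shows that both halves agree; each is half of the bound.\<close>
    also have "\<dots> = (\<integral>\<^sup>+x. \<integral>\<^sup>+y. ?k x y \<partial>lborel \<partial>lborel)
        + (\<integral>\<^sup>+x. \<integral>\<^sup>+y. ?l x y \<partial>lborel \<partial>lborel)"
      by (simp add: nn_integral_add)
    also have "(\<integral>\<^sup>+x. \<integral>\<^sup>+y. ?l x y \<partial>lborel \<partial>lborel)
        = (\<integral>\<^sup>+y. \<integral>\<^sup>+x. ?l x y \<partial>lborel \<partial>lborel)"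
      by (rule lborel_pair.Fubini') measurable
    also have "\<dots> = (\<integral>\<^sup>+x. \<integral>\<^sup>+y. ?k x y \<partial>lborel \<partial>lborel)"
      by (simp add: gauss_def norm_minus_commute)
    also have "(\<integral>\<^sup>+x. \<integral>\<^sup>+y. ?k x y \<partial>lborel \<partial>lborel) = ennreal (C / 2 * (LBINT x. gauss b (x::'a)) * N)"
    proof -
      have "(\<integral>\<^sup>+y. ?k x y \<partial>lborel) = ennreal ((norm (f x))\<^sup>2) * ennreal (C / 2 * (LBINT y. gauss b (y::'a)))" for x
      proof -
        have "(\<integral>\<^sup>+y. ?k x y \<partial>lborel) = ennreal (LBINT y. C / 2 * ((norm (f x))\<^sup>2 * gauss b (y - x)))"
          using C integrable_gauss[OF b] integral_translate(1)[of "gauss b" "- x"] by (intro nn_integral_eq_integral) auto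
        also have "(LBINT y. C / 2 * ((norm (f x))\<^sup>2 * gauss b (y - x))) = (norm (f x))\<^sup>2 * (C / 2 * (LBINT y. gauss b (y::'a)))"
          using integral_translate(2)[of "gauss b" "- x"] by simp
        also have "ennreal \<dots> = ennreal ((norm (f x))\<^sup>2) * ennreal (C / 2 * (LBINT y. gauss b (y::'a)))"
          by (rule ennreal_mult') simp
        finally show ?thesis .
      qed
      then have "(\<integral>\<^sup>+x. \<integral>\<^sup>+y. ?k x y \<partial>lborel \<partial>lborel)
          = L2n f * ennreal (C / 2 * (LBINT y. gauss b (y::'a)))"
        unfolding L2n_def by (subst nn_integral_multc[symmetric]) auto
      also have "\<dots> = ennreal (N * (C / 2 * (LBINT y. gauss b (y::'a))))"
        unfolding N by (rule ennreal_mult'[symmetric]) (rule N)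
      finally show ?thesis by (simp only: mult_ac)
    qed
    also have "ennreal (C / 2 * (LBINT x. gauss b (x::'a)) * N) + ennreal (C / 2 * (LBINT x. gauss b (x::'a)) * N) = ennreal ((2 * pi) ^ DIM('a) * N)"
    proof -
      define J where "J = (LBINT x. gauss b (x::'a))"
      have J: "J \<ge> 0" unfolding J_def by (intro Bochner_Integration.integral_nonneg) auto
      have "ennreal (C / 2 * J * N) + ennreal (C / 2 * J * N) = ennreal (C / 2 * J * N + C / 2 * J * N)"
        using J C N by (intro ennreal_plus[symmetric]) auto
      also have "C / 2 * J * N + C / 2 * J * N = C * J * N" by simp
      also have "\<dots> = (2 * pi) ^ DIM('a) * N" using CG by (simp only: J_def)
      finally show ?thesis by (simp only: J_def)
    qed
    finally have "ennreal \<bar>I\<bar> \<le> ennreal ((2 * pi) ^ DIM('a) * N)" .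
    moreover have "(\<integral>\<^sup>+\<xi>. ennreal ((norm (fourier_L1 f \<xi>))\<^sup>2 * gauss a \<xi>) \<partial>lborel) = ennreal I"
      unfolding I_def by (rule nn_integral_eq_integral[OF Iint]) simp
    ultimately show ?thesis by (metis abs_ge_self ennreal_leI order_trans)
  qed
  \<comment> \<open>The damping 1 / (n + 1) tends to 0 and Fatou's lemma removes it.\<close>
  have "L2n (fourier_L1 f) = (\<integral>\<^sup>+\<xi>. liminf (\<lambda>n. ennreal ((norm (fourier_L1 f \<xi>))\<^sup>2 * gauss (1 / real (Suc n)) \<xi>)) \<partial>lborel)"
    unfolding L2n_def
  proof (rule nn_integral_cong)
    fix \<xi> :: 'a
    have "(\<lambda>n. ennreal ((norm (fourier_L1 f \<xi>))\<^sup>2 * gauss (1 / real (Suc n)) \<xi>)) \<longlonglongrightarrow> ennreal ((norm (fourier_L1 f \<xi>))\<^sup>2 * gauss 0 \<xi>)"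
      unfolding gauss_def by (intro tendsto_intros LIMSEQ_Suc[OF lim_1_over_n])
    then show "ennreal ((norm (fourier_L1 f \<xi>))\<^sup>2) = liminf (\<lambda>n. ennreal ((norm (fourier_L1 f \<xi>))\<^sup>2 * gauss (1 / real (Suc n)) \<xi>))"
      using lim_imp_Liminf[of sequentially] by (fastforce simp: gauss_def)
  qed
  also have "\<dots> \<le> liminf (\<lambda>n. \<integral>\<^sup>+\<xi>. ennreal ((norm (fourier_L1 f \<xi>))\<^sup>2 * gauss (1 / real (Suc n)) \<xi>) \<partial>lborel)"
    by (rule nn_integral_liminf) measurable
  also have "\<dots> \<le> ennreal ((2 * pi) ^ DIM('a) * N)"
    by (intro Liminf_le always_eventually allI bd) simp_all
  also have "\<dots> = ennreal ((2 * pi) ^ DIM('a)) * L2n f"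
    using N by (simp add: ennreal_mult'')
  finally show ?thesis .
qed

section \<open>The Fourier transform of square integrable functions\<close>

lemma fourier_L1_add:
  assumes "integrable lborel f" "integrable lborel g"
  shows "fourier_L1 (\<lambda>x. f x + g x) \<xi> = fourier_L1 f \<xi> + fourier_L1 g \<xi>"
  using integrable_wave[OF assms(1)] integrable_wave[OF assms(2)]
  by (simp add: fourier_L1_wave distrib_left)

lemma fourier_L1_cmult: "fourier_L1 (\<lambda>x. c * f x) \<xi> = c * fourier_L1 f \<xi>"
  unfolding fourier_L1_wave by (subst integral_mult_right_zero[symmetric]) (simp add: mult_ac)

lemma fourier_L1_diff:
  assumes "integrable lborel f" "integrable lborel g"
  shows "fourier_L1 (\<lambda>x. f x - g x) \<xi> = fourier_L1 f \<xi> - fourier_L1 g \<xi>"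
  using integrable_wave[OF assms(1)] integrable_wave[OF assms(2)]
  by (simp add: fourier_L1_wave right_diff_distrib)

lemma square_integrable_fourier_L1:
  assumes "integrable lborel f" "square_integrable f"
  shows "square_integrable (fourier_L1 f)"
  using L2n_fourier_L1_le[OF assms] assms
  by (auto simp: square_integrable_L2n ennreal_mult_less_top intro: le_less_trans)

lemma ennreal_tendsto_cmult_0:
  assumes "(f \<longlongrightarrow> (0::ennreal)) F" "c < \<infinity>"
  shows "((\<lambda>x. c * f x) \<longlongrightarrow> 0) F"
  using tendsto_mult_ennreal[OF tendsto_const assms(1), of c] assms(2) by (auto simp: less_top)

lemma tendsto_L2_add:
  assumes [measurable]: "\<And>k. F k \<in> borel_measurable borel" "\<And>k. G k \<in> borel_measurable borel"
      "f \<in> borel_measurable borel" "g \<in> borel_measurable borel"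
    and "tendsto_L2 F f" "tendsto_L2 G g"
  shows "tendsto_L2 (\<lambda>k x. F k x + G k x) (\<lambda>x. f x + g x)"
  unfolding tendsto_L2_L2n
proof (rule tendsto_sandwich[OF _ _ tendsto_const])
  have "(\<lambda>k. 2 * L2n (\<lambda>x. F k x - f x) + 2 * L2n (\<lambda>x. G k x - g x)) \<longlonglongrightarrow> 0 + 0"
    using assms by (intro tendsto_add ennreal_tendsto_cmult_0) (auto simp: tendsto_L2_L2n)
  then show "(\<lambda>k. 2 * L2n (\<lambda>x. F k x - f x) + 2 * L2n (\<lambda>x. G k x - g x)) \<longlonglongrightarrow> 0" by simp
  show "\<forall>\<^sub>F k in sequentially. L2n (\<lambda>x. F k x + G k x - (f x + g x))
      \<le> 2 * L2n (\<lambda>x. F k x - f x) + 2 * L2n (\<lambda>x. G k x - g x)"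
    using L2n_add_le[of "\<lambda>x. F k x - f x" "\<lambda>x. G k x - g x" for k]
    by (intro always_eventually allI) (simp add: algebra_simps)
qed simp

lemma tendsto_L2_cmult:
  assumes [measurable]: "\<And>k. F k \<in> borel_measurable borel" "f \<in> borel_measurable borel"
    and "tendsto_L2 F f"
  shows "tendsto_L2 (\<lambda>k x. c * F k x) (\<lambda>x. c * f x)"
proof -
  have "(\<lambda>k. ennreal ((norm c)\<^sup>2) * L2n (\<lambda>x. F k x - f x)) \<longlonglongrightarrow> 0"
    using assms by (intro ennreal_tendsto_cmult_0) (auto simp: tendsto_L2_L2n)
  then show ?thesis
    by (simp add: tendsto_L2_L2n right_diff_distrib[symmetric] L2n_cmult)
qed

lemma is_fourier_L2_add:
  assumes "is_fourier_L2 u g" "is_fourier_L2 v h"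
  shows "is_fourier_L2 (\<lambda>x. u x + v x) (\<lambda>x. g x + h x)"
proof -
  obtain F where F: "\<And>k. integrable lborel (F k)" "\<And>k. square_integrable (F k)"
      "tendsto_L2 F u" "tendsto_L2 (\<lambda>k. fourier_L1 (F k)) g"
    using assms(1) unfolding is_fourier_L2_def by blast
  obtain G where G: "\<And>k. integrable lborel (G k)" "\<And>k. square_integrable (G k)"
      "tendsto_L2 G v" "tendsto_L2 (\<lambda>k. fourier_L1 (G k)) h"
    using assms(2) unfolding is_fourier_L2_def by blast
  have s: "square_integrable u" "square_integrable g" "square_integrable v" "square_integrable h"
    using assms by (auto simp: is_fourier_L2_def)
  note m = square_integrableD[OF s(1)] square_integrableD[OF s(2)] square_integrableD[OF s(3)]
    square_integrableD[OF s(4)] measurable_fourier_L1[OF F(1)] measurable_fourier_L1[OF G(1)]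
    square_integrableD[OF F(2)] square_integrableD[OF G(2)]
  have "tendsto_L2 (\<lambda>k x. F k x + G k x) (\<lambda>x. u x + v x)"
    by (rule tendsto_L2_add) (use m F G in auto)
  moreover have "tendsto_L2 (\<lambda>k. fourier_L1 (\<lambda>x. F k x + G k x)) (\<lambda>x. g x + h x)"
    unfolding fourier_L1_add[OF F(1) G(1), abs_def]
    by (rule tendsto_L2_add) (use m F G in auto)
  moreover have "\<forall>k. integrable lborel (\<lambda>x. F k x + G k x) \<and> square_integrable (\<lambda>x. F k x + G k x)"
    using F G by (auto intro: square_integrable_add)
  ultimately show ?thesis unfolding is_fourier_L2_def
    using s by (intro conjI exI[of _ "\<lambda>k x. F k x + G k x"]) (auto intro: square_integrable_add)
qed

lemma is_fourier_L2_cmult: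
  assumes "is_fourier_L2 u g"
  shows "is_fourier_L2 (\<lambda>x. c * u x) (\<lambda>x. c * g x)"
proof -
  obtain F where F: "\<And>k. integrable lborel (F k)" "\<And>k. square_integrable (F k)"
      "tendsto_L2 F u" "tendsto_L2 (\<lambda>k. fourier_L1 (F k)) g"
    using assms(1) unfolding is_fourier_L2_def by blast
  have s: "square_integrable u" "square_integrable g"
    using assms by (auto simp: is_fourier_L2_def)
  note m = square_integrableD[OF s(1)] square_integrableD[OF s(2)] measurable_fourier_L1[OF F(1)]
    square_integrableD[OF F(2)]
  have "tendsto_L2 (\<lambda>k x. c * F k x) (\<lambda>x. c * u x)"
    by (rule tendsto_L2_cmult) (use m F in auto)
  moreover have "tendsto_L2 (\<lambda>k. fourier_L1 (\<lambda>x. c * F k x)) (\<lambda>x. c * g x)"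
    unfolding fourier_L1_cmult[abs_def]
    by (rule tendsto_L2_cmult) (use m F in auto)
  moreover have "\<forall>k. integrable lborel (\<lambda>x. c * F k x) \<and> square_integrable (\<lambda>x. c * F k x)"
    using F by (auto intro: square_integrable_cmult)
  ultimately show ?thesis unfolding is_fourier_L2_def
    using s by (intro conjI exI[of _ "\<lambda>k x. c * F k x"]) (auto intro: square_integrable_cmult)
qed

text \<open>The Plancherel bound for the approximating functions passes to the limit. The 4 comes
  from splitting off an error twice at the price of a factor 2; it is harmless, as the bound only
  serves to show that a null function has a null transform.\<close>

lemma is_fourier_L2_bound:
  fixes u :: "'a::euclidean_space \<Rightarrow> complex"
  assumes "is_fourier_L2 u g"
  shows "L2n g \<le> 4 * ennreal ((2 * pi) ^ DIM('a)) * L2n u"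
proof -
  let ?K = "ennreal ((2 * pi) ^ DIM('a))"
  obtain F where F: "\<And>k. integrable lborel (F k)" "\<And>k. square_integrable (F k)"
      "tendsto_L2 F u" "tendsto_L2 (\<lambda>k. fourier_L1 (F k)) g"
    using assms(1) unfolding is_fourier_L2_def by blast
  have s: "square_integrable u" "square_integrable g"
    using assms by (auto simp: is_fourier_L2_def)
  note [measurable] = square_integrableD[OF s(1)] square_integrableD[OF s(2)] measurable_fourier_L1[OF F(1)]
    square_integrableD[OF F(2)]
  have "(\<lambda>k. (2 * L2n (\<lambda>x. fourier_L1 (F k) x - g x) + (4 * ?K) * L2n (\<lambda>x. F k x - u x)) + 4 * ?K * L2n u)
      \<longlonglongrightarrow> (0 + 0) + 4 * ?K * L2n u"
    using F by (intro tendsto_add tendsto_const ennreal_tendsto_cmult_0)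
      (auto simp: tendsto_L2_L2n ennreal_mult_less_top)
  moreover have "L2n g \<le> (2 * L2n (\<lambda>x. fourier_L1 (F k) x - g x) + (4 * ?K) * L2n (\<lambda>x. F k x - u x)) + 4 * ?K * L2n u" for k
  proof -
    have "L2n g = L2n (\<lambda>x. (g x - fourier_L1 (F k) x) + fourier_L1 (F k) x)" by simp
    also have "\<dots> \<le> 2 * L2n (\<lambda>x. g x - fourier_L1 (F k) x) + 2 * L2n (fourier_L1 (F k))"
      by (rule L2n_add_le) measurable
    also have "L2n (fourier_L1 (F k)) \<le> ?K * L2n (F k)" by (rule L2n_fourier_L1_le[OF F(1,2)])
    also have "L2n (F k) = L2n (\<lambda>x. (F k x - u x) + u x)" by simp
    also have "\<dots> \<le> 2 * L2n (\<lambda>x. F k x - u x) + 2 * L2n u"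
      by (rule L2n_add_le) measurable
    finally show ?thesis
      by (simp add: L2n_diff_commute[of g] distrib_left mult_left_mono add_left_mono mult.assoc mult.left_commute[of 2] mult.left_commute[of 4] add.assoc)
  qed
  ultimately show ?thesis
    by (intro tendsto_lowerbound[where F=sequentially]) (auto intro: always_eventually)
qed

lemma is_fourier_L2_diff:
  assumes "is_fourier_L2 u g" "is_fourier_L2 v h"
  shows "is_fourier_L2 (\<lambda>x. u x - v x) (\<lambda>x. g x - h x)"
  using is_fourier_L2_add[OF assms(1) is_fourier_L2_cmult[OF assms(2), of "-1"]] by simp

lemma is_fourier_L2_AE_unique:
  fixes u :: "'a::euclidean_space \<Rightarrow> complex"
  assumes "is_fourier_L2 u g" "is_fourier_L2 v h" "AE x in lborel. u x = v x"
  shows "AE x in lborel. g x = h x"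
proof -
  have d: "is_fourier_L2 (\<lambda>x. u x - v x) (\<lambda>x. g x - h x)"
    by (rule is_fourier_L2_diff[OF assms(1,2)])
  then have m[measurable]: "(\<lambda>x. u x - v x) \<in> borel_measurable borel" "(\<lambda>x. g x - h x) \<in> borel_measurable borel"
    by (auto simp: is_fourier_L2_def square_integrable_def)
  have "L2n (\<lambda>x. u x - v x) = 0"
    using assms(3) by (subst L2n_eq_0_iff) auto
  then have "L2n (\<lambda>x. g x - h x) = 0"
    using is_fourier_L2_bound[OF d] by simp
  then show ?thesis by (subst (asm) L2n_eq_0_iff) auto
qed

lemma is_fourier_L2_L1:
  assumes "integrable lborel f" "square_integrable f"
  shows "is_fourier_L2 f (fourier_L1 f)"
  unfolding is_fourier_L2_def
  using assms square_integrable_fourier_L1[OF assms]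
  by (auto simp: tendsto_L2_def intro!: exI[of _ "\<lambda>_. f"])

text \<open>Cut-offs to balls lie in L1 as products of two L2 functions and tend to
  \<open>u\<close>. The Plancherel bound makes their transforms a Cauchy sequence, and completeness
  supplies the limit.\<close>

lemma is_fourier_L2_exists:
  fixes u :: "'a::euclidean_space \<Rightarrow> complex"
  assumes u: "square_integrable u"
  shows "\<exists>g. is_fourier_L2 u g"
proof -
  let ?K = "ennreal ((2 * pi) ^ DIM('a))"
  note [measurable] = square_integrableD[OF u]
  define F where "F k x = indicator (cball 0 (real k)) x * u x" for k x
  have [measurable]: "F k \<in> borel_measurable borel" for k
  proof -
    have [measurable]: "cball 0 (real k) \<in> sets (borel :: 'a measure)" by (intro borel_closed closed_cball)
    show ?thesis unfolding F_def by measurable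
  qed
  have F2: "square_integrable (F k)" for k
    by (rule square_integrable_bound[OF u]) (auto simp: F_def indicator_def norm_mult)
  have F1: "integrable lborel (F k)" for k
  proof -
    have "integrable lborel (\<lambda>x. (norm (indicator (cball 0 (real k)) (x::'a) :: complex))\<^sup>2)"
    proof -
      have "(\<lambda>x. (norm (indicator (cball 0 (real k)) (x::'a) :: complex))\<^sup>2) = indicator (cball 0 (real k))"
        by (auto simp: indicator_def fun_eq_iff)
      then show ?thesis
        using emeasure_lborel_cball_finite[of "0::'a" "real k"] by (auto intro!: integrable_real_indicator)
    qed
    then have "square_integrable (indicator (cball 0 (real k)) :: 'a \<Rightarrow> complex)"
      by (auto simp: square_integrable_def intro!: borel_measurable_indicator borel_closed)
    from L2_integrable_mult(1)[OF this u] show ?thesis by (simp add: F_def[abs_def])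
  qed
  have FL: "tendsto_L2 F u"
  proof -
    have "(\<lambda>k. LBINT x. (norm (F k x - u x))\<^sup>2) \<longlonglongrightarrow> (LBINT x::'a. (0::real))"
    proof (rule integral_dominated_convergence[where w="\<lambda>x. (norm (u x))\<^sup>2"])
      show "AE x in lborel. (\<lambda>k. (norm (F k x - u x))\<^sup>2) \<longlonglongrightarrow> 0"
      proof (rule AE_I2)
        fix x :: 'a
        obtain N where N: "norm x \<le> real N" using real_arch_simple by blast
        have "(norm (F k x - u x))\<^sup>2 = 0" if "k \<ge> N" for k
          using N that by (auto simp: F_def indicator_def)
        then show "(\<lambda>k. (norm (F k x - u x))\<^sup>2) \<longlonglongrightarrow> 0"
          by (intro tendsto_eventually) (auto simp: eventually_sequentially)
      qed
      show "AE x in lborel. norm ((norm (F k x - u x))\<^sup>2) \<le> (norm (u x))\<^sup>2" for k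
        by (auto simp: F_def indicator_def)
    qed (use u in \<open>auto simp: square_integrable_def\<close>)
    then have "(\<lambda>k. ennreal (LBINT x. (norm (F k x - u x))\<^sup>2)) \<longlonglongrightarrow> 0"
      using tendsto_ennrealI by fastforce
    moreover have "ennreal (LBINT x. (norm (F k x - u x))\<^sup>2) = L2n (\<lambda>x. F k x - u x)" for k
      unfolding L2n_def using square_integrable_diff[OF F2 u, of k]
      by (intro nn_integral_eq_integral[symmetric]) (auto simp: square_integrable_def)
    ultimately show ?thesis by (simp add: tendsto_L2_L2n)
  qed
  have "\<exists>g. square_integrable g \<and> tendsto_L2 (\<lambda>k. fourier_L1 (F k)) g"
  proof -
    have "\<exists>M. \<forall>m\<ge>M. \<forall>n\<ge>M. L2n (\<lambda>x. fourier_L1 (F m) x - fourier_L1 (F n) x) < ennreal e" if e: "e > 0" for e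
    proof -
      have "(\<lambda>k. (2 * ?K) * L2n (\<lambda>x. F k x - u x)) \<longlonglongrightarrow> 0"
        using FL by (intro ennreal_tendsto_cmult_0) (auto simp: tendsto_L2_L2n ennreal_mult_less_top)
      then have "\<forall>\<^sub>F k in sequentially. (2 * ?K) * L2n (\<lambda>x. F k x - u x) < ennreal (e / 2)"
        using e by (intro order_tendstoD) auto
      then obtain M where M: "\<And>k. k \<ge> M \<Longrightarrow> (2 * ?K) * L2n (\<lambda>x. F k x - u x) < ennreal (e / 2)"
        by (auto simp: eventually_sequentially)
      have "L2n (\<lambda>x. fourier_L1 (F m) x - fourier_L1 (F n) x) < ennreal e" if mn: "m \<ge> M" "n \<ge> M" for m n
      proof -
        have "L2n (\<lambda>x. fourier_L1 (F m) x - fourier_L1 (F n) x) = L2n (fourier_L1 (\<lambda>x. F m x - F n x))"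
          by (simp add: fourier_L1_diff[OF F1 F1, abs_def])
        also have "\<dots> \<le> ?K * L2n (\<lambda>x. F m x - F n x)"
          by (intro L2n_fourier_L1_le) (use F1 F2 in \<open>auto intro: square_integrable_diff\<close>)
        also have "L2n (\<lambda>x. F m x - F n x) = L2n (\<lambda>x. (F m x - u x) + (u x - F n x))" by simp
        also have "\<dots> \<le> 2 * L2n (\<lambda>x. F m x - u x) + 2 * L2n (\<lambda>x. u x - F n x)"
          by (rule L2n_add_le) measurable
        finally have "L2n (\<lambda>x. fourier_L1 (F m) x - fourier_L1 (F n) x)
            \<le> (2 * ?K) * L2n (\<lambda>x. F m x - u x) + (2 * ?K) * L2n (\<lambda>x. F n x - u x)"
          by (simp add: L2n_diff_commute[of u] distrib_left mult_left_mono mult.assoc mult.left_commute[of 2])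
        also have "\<dots> < ennreal (e / 2) + ennreal (e / 2)"
          using M[OF mn(1)] M[OF mn(2)] by (rule add_strict_mono)
        also have "\<dots> = ennreal e" using e by (simp add: ennreal_plus[symmetric] del: ennreal_plus)
        finally show ?thesis .
      qed
      then show ?thesis by blast
    qed
    then show ?thesis
      using L2_complete[of "\<lambda>k. fourier_L1 (F k)"] square_integrable_fourier_L1[OF F1 F2] by metis
  qed
  then show ?thesis unfolding is_fourier_L2_def using u F1 F2 FL by blast
qed

lemma is_fourier_L2_fourier:
  assumes "square_integrable u"
  shows "is_fourier_L2 u (fourier u)"
proof (cases "integrable lborel u")
  case True
  then show ?thesis using is_fourier_L2_L1[OF True assms] by (simp add: fourier_def)
next
  case False
  then show ?thesis using someI_ex[OF is_fourier_L2_exists[OF assms]] by (simp add: fourier_def)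
qed

lemma square_integrable_fourier: "square_integrable u \<Longrightarrow> square_integrable (fourier u)"
  using is_fourier_L2_fourier unfolding is_fourier_L2_def by blast

lemma fourier_AE_eq:
  assumes "is_fourier_L2 u g" shows "AE \<xi> in lborel. fourier u \<xi> = g \<xi>"
  using is_fourier_L2_AE_unique[OF is_fourier_L2_fourier assms] assms by (auto simp: is_fourier_L2_def)

section \<open>Duality, uniqueness and inversion for the transform on L2\<close>

lemma tendsto_L2_integral:
  assumes F: "\<And>k. square_integrable (F k)" and f: "square_integrable f" and G: "square_integrable G"
    and FL: "tendsto_L2 F f"
  shows "(\<lambda>k. LBINT x. F k x * G x) \<longlonglongrightarrow> (LBINT x. f x * G x)"
proof -
  let ?D = "\<lambda>k. (LBINT x. F k x * G x) - (LBINT x. f x * G x)"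
  have le: "ennreal ((norm (?D k))\<^sup>2) \<le> L2n G * L2n (\<lambda>x. F k x - f x)" for k
  proof -
    have "(LBINT x. F k x * G x) - (LBINT x. f x * G x) = (LBINT x. (F k x - f x) * G x)"
      using L2_integrable_mult(1)[OF F G] L2_integrable_mult(1)[OF f G] by (simp add: left_diff_distrib)
    then have "norm (?D k) \<le> (LBINT x. norm ((F k x - f x) * G x))"
      using integral_norm_bound by metis
    then have "ennreal ((norm (?D k))\<^sup>2) \<le> ennreal ((LBINT x. norm ((F k x - f x) * G x))\<^sup>2)"
      by (intro ennreal_leI power_mono) auto
    also have "\<dots> \<le> L2n (\<lambda>x. F k x - f x) * L2n G"
      by (rule L2_integrable_mult(2)[OF square_integrable_diff[OF F f] G])
    finally show ?thesis by (simp add: mult.commute)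
  qed
  have "(\<lambda>k. ennreal ((norm (?D k))\<^sup>2)) \<longlonglongrightarrow> 0"
  proof (rule tendsto_sandwich[OF _ _ tendsto_const])
    show "(\<lambda>k. L2n G * L2n (\<lambda>x. F k x - f x)) \<longlonglongrightarrow> 0"
      using FL G by (intro ennreal_tendsto_cmult_0) (auto simp: tendsto_L2_L2n square_integrable_L2n)
  qed (use le in auto)
  then have "(\<lambda>k. (norm (?D k))\<^sup>2) \<longlonglongrightarrow> 0"
    using tendsto_ennreal_iff[of "\<lambda>k. (norm (?D k))\<^sup>2" sequentially 0] by simp
  then have "(\<lambda>k. sqrt ((norm (?D k))\<^sup>2)) \<longlonglongrightarrow> sqrt 0"
    by (rule tendsto_real_sqrt)
  then show ?thesis by (simp add: LIM_zero_iff tendsto_norm_zero_iff)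
qed

lemma fourier_L2_mult:
  assumes ug: "is_fourier_L2 u g" and G: "integrable lborel G" "square_integrable G"
  shows "(LBINT \<xi>. g \<xi> * G \<xi>) = (LBINT x. u x * fourier_L1 G x)"
proof -
  obtain F where F: "\<And>k. integrable lborel (F k)" "\<And>k. square_integrable (F k)"
      "tendsto_L2 F u" "tendsto_L2 (\<lambda>k. fourier_L1 (F k)) g"
    using ug unfolding is_fourier_L2_def by blast
  have s: "square_integrable u" "square_integrable g" using ug by (auto simp: is_fourier_L2_def)
  have "(\<lambda>k. LBINT \<xi>. fourier_L1 (F k) \<xi> * G \<xi>) \<longlonglongrightarrow> (LBINT \<xi>. g \<xi> * G \<xi>)"
    by (rule tendsto_L2_integral[OF square_integrable_fourier_L1[OF F(1,2)] s(2) G(2) F(4)])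
  moreover have "(\<lambda>k. LBINT x. F k x * fourier_L1 G x) \<longlonglongrightarrow> (LBINT x. u x * fourier_L1 G x)"
    by (rule tendsto_L2_integral[OF F(2) s(1) square_integrable_fourier_L1[OF G] F(3)])
  ultimately show ?thesis
    unfolding fourier_L1_mult[OF F(1) G(1)] by (rule LIMSEQ_unique)
qed

text \<open>Gaussians times characters are total in L2: the hypothesis says that the L1 function h
  times Gaussian has transform 0, so injectivity on L1 applies, and the Gaussian has no zeros to
  divide by.\<close>

lemma AE_zero_if_gauss_waves:
  fixes h :: "'a::euclidean_space \<Rightarrow> complex"
  assumes h: "square_integrable h"
    and 0: "\<And>p. (LBINT x. h x * (wave p x * cgauss a x)) = 0" and a: "a > 0"
  shows "AE x in lborel. h x = 0"
proof -
  have "AE x in lborel. h x * cgauss a x = 0"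
  proof (rule fourier_L1_inj)
    show "integrable lborel (\<lambda>x. h x * cgauss a x)"
      using L2_integrable_mult(1)[OF h square_integrable_gauss_wave[OF a, of 0]] by simp
    show "fourier_L1 (\<lambda>x. h x * cgauss a x) \<xi> = 0" for \<xi>
      using 0[of \<xi>] by (simp add: fourier_L1_wave mult_ac)
  qed
  then show ?thesis by simp
qed

lemma integrable_gauss_shift:
  "a > 0 \<Longrightarrow> integrable lborel (\<lambda>x. cgauss a (x - q))"
  using integrable_of_real[OF integrable_gauss[of a]] integral_translate(1)[of "\<lambda>x. cgauss a x" "- q"]
  by simp

lemma square_integrable_gauss_shift:
  assumes "a > 0" shows "square_integrable (\<lambda>x. cgauss a (x - q))"
proof -
  have "(norm (cgauss a (x - q)))\<^sup>2 = gauss (2 * a) (- q + x)" for x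
    by (simp add: gauss_def flip: exp_double)
  moreover have "integrable lborel (\<lambda>x. gauss (2 * a) (- q + x))"
    using integrable_gauss[of "2 * a"] assms by (subst integral_translate(1)) auto
  ultimately show ?thesis by (simp add: square_integrable_def)
qed

lemma fourier_L1_gauss_shift:
  fixes q \<xi> :: "'a::euclidean_space"
  assumes a: "a > 0"
  shows "fourier_L1 (\<lambda>x. cgauss a (x - q)) \<xi>
    = complex_of_real (sqrt (pi / a) ^ DIM('a)) * (wave \<xi> q * cgauss (1 / (4 * a)) \<xi>)"
proof -
  have "fourier_L1 (\<lambda>x. cgauss a (x - q)) \<xi> = (LBINT x. wave \<xi> (q + x) * cgauss a (q + x - q))"
    unfolding fourier_L1_wave by (rule integral_translate(2)[symmetric])
  also have "\<dots> = (LBINT x. wave \<xi> q * (wave \<xi> x * cgauss a x))"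
    by (simp add: wave_add_right mult.assoc)
  also have "\<dots> = wave \<xi> q * (LBINT x. wave \<xi> x * cgauss a x)"
    by (rule integral_mult_right_zero)
  finally show ?thesis unfolding gauss_fourier(2)[OF a] by (simp add: mult_ac)
qed

text \<open>Inversion by duality: the multiplication formula is applied twice to pair
  \<open>fourier u\<close> with a Gaussian wave, whose double transform is explicit. So
  \<open>fourier u - g\<close> annihilates all Gaussian waves.\<close>

lemma fourier_inverse:
  fixes g :: "'a::euclidean_space \<Rightarrow> complex"
  assumes g: "integrable lborel g" "square_integrable g"
  defines "u \<equiv> \<lambda>x. fourier_L1 g (- x) / complex_of_real ((2 * pi) ^ DIM('a))"
  shows "square_integrable u" "continuous_on UNIV u" "is_fourier_L2 u g"
proof -
  show c: "continuous_on UNIV u"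
    unfolding u_def by (intro continuous_intros continuous_on_compose2[OF continuous_fourier_L1[OF g(1)]]) auto
  have r: "square_integrable (\<lambda>x. fourier_L1 g (- x))"
  proof -
    have "integrable lborel (\<lambda>x. (norm (fourier_L1 g (- x)))\<^sup>2)"
      using square_integrable_fourier_L1[OF g] integral_reflect(1)[of "\<lambda>x. (norm (fourier_L1 g x))\<^sup>2"]
      by (simp add: square_integrable_def)
    moreover have "(\<lambda>x. fourier_L1 g (- x)) \<in> borel_measurable borel"
      by (intro borel_measurable_continuous_onI continuous_on_compose2[OF continuous_fourier_L1[OF g(1)]] continuous_intros) auto
    ultimately show ?thesis by (simp add: square_integrable_def)
  qed
  show u: "square_integrable u"
    using square_integrable_cmult[OF r, of "1 / complex_of_real ((2 * pi) ^ DIM('a))"] by (simp add: u_def)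
  \<comment> \<open>The parameter 1/2 is self-dual, 1 / (4 * (1/2)) = 1/2, so the transform of such
    a wave is a shifted Gaussian of the same width with factor sqrt (2 pi)^d.\<close>
  let ?G = "\<lambda>p \<xi>. wave p \<xi> * cgauss (1/2) \<xi>"
  have G: "integrable lborel (?G p)" "square_integrable (?G p)" for p :: 'a
    by (auto intro: integrable_wave_gauss square_integrable_gauss_wave)
  have inv: "fourier_L1 (\<lambda>x. fourier_L1 (?G p) (- x)) \<xi> = complex_of_real ((2 * pi) ^ DIM('a)) * ?G p \<xi>" for p \<xi> :: 'a
  proof -
    let ?s = "complex_of_real (sqrt (2 * pi) ^ DIM('a))"
    have "fourier_L1 (?G p) (- x) = ?s * cgauss (1/2) (x - p)" for x
      using fourier_wave_gauss[of "1/2" p "- x"] by (simp add: gauss_def norm_minus_commute mult.commute)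
    then have "fourier_L1 (\<lambda>x. fourier_L1 (?G p) (- x)) \<xi> = ?s * (?s * (wave \<xi> p * cgauss (1/2) \<xi>))"
      using fourier_L1_gauss_shift[of "1/2" p \<xi>] by (simp only: fourier_L1_cmult) (simp add: mult.commute)
    also have "\<dots> = (?s * ?s) * ?G p \<xi>"
      by (simp add: wave_commute[of \<xi>] mult_ac)
    also have "?s * ?s = complex_of_real ((2 * pi) ^ DIM('a))"
      by (simp only: of_real_mult[symmetric] power_mult_distrib[symmetric]) simp
    finally show ?thesis .
  qed
  define h where "h \<xi> = fourier u \<xi> - g \<xi>" for \<xi>
  have h: "square_integrable h"
    unfolding h_def[abs_def] by (intro square_integrable_diff square_integrable_fourier u g)
  have "AE x in lborel. h x = 0"
  proof (rule AE_zero_if_gauss_waves[OF h, of "1/2"])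
    fix p :: 'a
    have "(LBINT x. fourier u x * ?G p x) = (LBINT x. u x * fourier_L1 (?G p) x)"
      by (rule fourier_L2_mult[OF is_fourier_L2_fourier[OF u] G])
    also have "\<dots> = (LBINT x. u (- x) * fourier_L1 (?G p) (- x))"
      by (rule integral_reflect(2)[symmetric])
    also have "\<dots> = (LBINT x. fourier_L1 g x * fourier_L1 (?G p) (- x)) / complex_of_real ((2 * pi) ^ DIM('a))"
      by (simp add: u_def)
    also have "(LBINT x. fourier_L1 g x * fourier_L1 (?G p) (- x)) = (LBINT x. g x * fourier_L1 (\<lambda>x. fourier_L1 (?G p) (- x)) x)"
    proof (rule fourier_L1_mult[OF g(1)])
      have "fourier_L1 (?G p) (- x) = complex_of_real (sqrt (2 * pi) ^ DIM('a)) * cgauss (1/2) (x - p)" for x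
        using fourier_wave_gauss[of "1/2" p "- x"] by (simp add: gauss_def norm_minus_commute mult.commute)
      then show "integrable lborel (\<lambda>x. fourier_L1 (?G p) (- x))"
        using integrable_gauss_shift[of "1/2" p] by simp
    qed
    also have "\<dots> / complex_of_real ((2 * pi) ^ DIM('a)) = (LBINT x. g x * ?G p x)"
      unfolding inv by (subst integral_divide_zero[symmetric]) (simp add: field_simps)
    finally show "(LBINT x. h x * ?G p x) = 0"
      using L2_integrable_mult(1)[OF square_integrable_fourier[OF u] G(2)[of p]] L2_integrable_mult(1)[OF g(2) G(2)[of p]]
      by (simp add: h_def left_diff_distrib)
  qed simp
  then have ae: "AE x in lborel. fourier u x = g x" by (simp add: h_def)
  \<comment> \<open>Equality almost everywhere with \<open>fourier u\<close> is not yet the claim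
    about \<open>g\<close>. The approximating sequence for \<open>fourier u\<close> also serves
    \<open>g\<close>, since L2 limits ignore null sets.\<close>
  obtain F where F: "\<And>k. integrable lborel (F k)" "\<And>k. square_integrable (F k)"
      "tendsto_L2 F u" "tendsto_L2 (\<lambda>k. fourier_L1 (F k)) (fourier u)"
    using is_fourier_L2_fourier[OF u] unfolding is_fourier_L2_def by blast
  have "L2n (\<lambda>x. fourier_L1 (F k) x - fourier u x) = L2n (\<lambda>x. fourier_L1 (F k) x - g x)" for k
    using ae by (intro L2n_cong_AE) auto
  then have "tendsto_L2 (\<lambda>k. fourier_L1 (F k)) g" using F(4) by (simp add: tendsto_L2_L2n)
  then show "is_fourier_L2 u g" unfolding is_fourier_L2_def using u g F by blast
qed

text \<open>The transform of a shifted Gaussian is a Gaussian wave. The multiplication formula thus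
  turns the pairing of \<open>w\<close> with Gaussian waves into the pairing of \<open>h\<close>
  with shifted Gaussians, which is 0.\<close>

lemma fourier_L2_inj:
  fixes w :: "'a::euclidean_space \<Rightarrow> complex"
  assumes wh: "is_fourier_L2 w h" and h: "AE x in lborel. h x = 0"
  shows "AE x in lborel. w x = 0"
proof (rule AE_zero_if_gauss_waves[of _ "1/2"])
  show "square_integrable w" using wh by (simp add: is_fourier_L2_def)
  fix p :: 'a
  let ?s = "complex_of_real (sqrt (2 * pi) ^ DIM('a))"
  let ?G = "\<lambda>x. cgauss (1/2) (x - p)"
  have ae: "AE x in lborel. h x * ?G x = 0" using h by auto
  have "(LBINT x. w x * fourier_L1 ?G x) = (LBINT x. h x * ?G x)"
    by (rule fourier_L2_mult[OF wh integrable_gauss_shift square_integrable_gauss_shift, symmetric]) simp_all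
  also have "\<dots> = 0"
    using ae by (rule integral_eq_zero_AE)
  finally have "(LBINT x. w x * fourier_L1 ?G x) = 0" .
  moreover have "fourier_L1 ?G x = ?s * (wave p x * cgauss (1/2) x)" for x
    using fourier_L1_gauss_shift[of "1/2" p x] by (simp add: wave_commute[of p] mult.commute)
  ultimately have "(LBINT x. ?s * (w x * (wave p x * cgauss (1/2) x))) = 0"
    by (simp add: mult_ac)
  then show "(LBINT x. w x * (wave p x * cgauss (1/2) x)) = 0"
    by (subst (asm) integral_mult_right_zero) simp
qed simp

text \<open>The set where the functions agree is closed and its complement is null; a closed set
  with null complement is the whole space.\<close>

lemma continuous_AE_eq:
  fixes u v :: "'a::euclidean_space \<Rightarrow> 'b::t2_space"
  assumes "continuous_on UNIV u" "continuous_on UNIV v" "AE x in lborel. u x = v x"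
  shows "u = v"
proof
  fix x
  have "closed {x. u x = v x}"
    using assms by (intro closed_Collect_eq)
  then show "u x = v x"
    using mem_closed_if_AE_lebesgue[of "{x. u x = v x}" x] assms(3) AE_completion by auto
qed

text \<open>By \<open>fourier_inverse\<close> the right-hand side is a continuous function with
  transform \<open>fourier u\<close>. Injectivity makes it equal to \<open>u\<close> almost
  everywhere, continuity everywhere.\<close>

lemma fourier_inversion:
  fixes u :: "'a::euclidean_space \<Rightarrow> complex"
  assumes u: "square_integrable u" "continuous_on UNIV u" and i: "integrable lborel (fourier u)"
  shows "u x = fourier_L1 (fourier u) (- x) / complex_of_real ((2 * pi) ^ DIM('a))"
proof -
  let ?v = "\<lambda>x. fourier_L1 (fourier u) (- x) / complex_of_real ((2 * pi) ^ DIM('a))"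
  note v = fourier_inverse[OF i square_integrable_fourier[OF u(1)]]
  have "AE x in lborel. u x - ?v x = 0"
    using is_fourier_L2_diff[OF is_fourier_L2_fourier[OF u(1)] v(3)] by (rule fourier_L2_inj) simp
  then have "u = ?v" by (intro continuous_AE_eq u v) simp
  then show ?thesis by (rule fun_cong)
qed

section \<open>Radial integrals\<close>

lemma measure_eqI_atMost:
  fixes M N :: "real measure"
  assumes "sets M = sets borel" "sets N = sets borel"
    and eq: "\<And>a. emeasure M {..a} = emeasure N {..a}" and fin: "\<And>a. emeasure M {..a} < \<infinity>"
  shows "M = N"
proof (rule measure_eqI_generator_eq[where E="range atMost" and \<Omega>=UNIV and A="\<lambda>i. {..real i}"])
  show "Int_stable (range atMost :: real set set)"
    by (auto simp: Int_stable_def)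
  have "sets (borel :: real measure) = sigma_sets UNIV (range atMost)"
    unfolding borel_eq_atMost by (simp add: sets_measure_of)
  then show "sets M = sigma_sets UNIV (range atMost)" "sets N = sigma_sets UNIV (range atMost)"
    using assms by auto
  show "(\<Union>i. {..real i}) = UNIV" using real_arch_simple by auto
  show "emeasure M {..real i} \<noteq> \<infinity>" for i using fin[of "real i"] by auto
qed (use eq in auto)

text \<open>The substitution t = r^2 as an equality of measures: both assign mass
  \<open>max a 0\<close> to every half-line up to \<open>a\<close>. This covers integrands with
  singularities, such as those of the Beta integral.\<close>

lemma nn_integral_square_subst:
  fixes f :: "real \<Rightarrow> ennreal"
  assumes [measurable]: "f \<in> borel_measurable borel"
  shows "(\<integral>\<^sup>+t. f t * indicator {0..} t \<partial>lborel) = (\<integral>\<^sup>+r. f (r\<^sup>2) * ennreal (2 * r) * indicator {0..} r \<partial>lborel)"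
proof -
  let ?D = "density lborel (\<lambda>r::real. ennreal (2 * r) * indicator {0..} r)"
  let ?M = "distr ?D borel (\<lambda>r. r\<^sup>2)"
  let ?N = "density lborel (indicator {0..} :: real \<Rightarrow> ennreal)"
  have N: "emeasure ?N {..a} = ennreal (max a 0)" for a :: real
  proof -
    have "(indicator {0..} x :: ennreal) * indicator {..a} x = indicator {0..a} x" for x :: real
      by (auto simp: indicator_def)
    then have "emeasure ?N {..a} = emeasure lborel {0..a}"
      by (simp add: emeasure_density)
    then show ?thesis by (cases "a \<ge> 0") (auto simp: max_def)
  qed
  have M: "emeasure ?M {..a} = ennreal (max a 0)" for a :: real
  proof -
    have "emeasure ?M {..a} = (\<integral>\<^sup>+r. ennreal (2 * r) * indicator {0..} r * indicator {..a} (r\<^sup>2) \<partial>lborel)"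
    proof -
      have "emeasure ?M {..a} = (\<integral>\<^sup>+x. indicator {..a} x \<partial>?M)"
        by (rule nn_integral_indicator[symmetric]) simp
      also have "\<dots> = (\<integral>\<^sup>+r. ennreal (2 * r) * indicator {0..} r * indicator {..a} (r\<^sup>2) \<partial>lborel)"
        by (subst nn_integral_distr) (simp_all add: nn_integral_density)
      finally show ?thesis .
    qed
    also have "\<dots> = ennreal (max a 0)"
    proof (cases "a \<ge> 0")
      case True
      have e: "ennreal (2 * r) * indicator {0..} r * indicator {..a} (r\<^sup>2) = ennreal (2 * r) * indicator {0..sqrt a} r" for r
        using real_le_rsqrt[of r a] True real_sqrt_le_iff[of "r\<^sup>2" a]
        by (auto simp: indicator_def)
      have "(\<integral>\<^sup>+r. ennreal (2 * r) * indicator {0..sqrt a} r \<partial>lborel) = ennreal ((sqrt a)\<^sup>2 - 0\<^sup>2)"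
        by (rule nn_integral_FTC_Icc) (use True in \<open>auto intro!: derivative_eq_intros\<close>)
      then show ?thesis unfolding e using True by simp
    next
      case False
      then have e: "ennreal (2 * r) * indicator {0..} r * indicator {..a} (r\<^sup>2) = 0" for r
        using order.trans[OF zero_le_power2[of r], of a] by (auto simp: indicator_def)
      show ?thesis unfolding e using False by simp
    qed
    finally show ?thesis .
  qed
  have "?M = ?N" by (rule measure_eqI_atMost) (simp_all add: M N)
  then have "integral\<^sup>N ?N f = integral\<^sup>N ?M f" by simp
  then show ?thesis
    by (simp add: nn_integral_density nn_integral_distr mult_ac)
qed

lemma square_powr_mult:
  assumes "r \<ge> (0::real)" shows "(r\<^sup>2) powr (a - 1) * r = r powr (2 * a - 1)"
proof (cases "r = 0")
  case False
  with assms have r: "r > 0" by simp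
  have "r\<^sup>2 = r powr 2" using r by (simp add: powr_numeral)
  then have "(r\<^sup>2) powr (a - 1) = r powr (2 * (a - 1))" by (simp only: powr_powr)
  then have "(r\<^sup>2) powr (a - 1) * r = r powr (2 * (a - 1)) * r powr 1"
    using r by simp
  also have "\<dots> = r powr (2 * (a - 1) + 1)" by (rule powr_add[symmetric])
  finally show ?thesis by simp
qed simp

lemma ennreal_half_eq: "ennreal x = 2 * y \<Longrightarrow> y = ennreal (x / 2)"
proof -
  assume e: "ennreal x = 2 * y"
  have "ennreal (1 / 2) * ennreal 2 = ennreal 1" by (subst ennreal_mult'[symmetric]) auto
  then have h: "ennreal (1 / 2) * 2 = 1" by (simp only: ennreal_numeral ennreal_1)
  have "ennreal (x / 2) = ennreal (1 / 2) * ennreal x"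
    by (subst ennreal_mult'[symmetric]) auto
  also have "\<dots> = y" unfolding e mult.assoc[symmetric] h by simp
  finally show ?thesis by simp
qed

lemma Gamma_nn_integral_square:
  assumes s: "s > (0::real)"
  shows "(\<integral>\<^sup>+r. ennreal (exp (- r\<^sup>2) * r powr (2 * s - 1)) * indicator {0..} r \<partial>lborel) = ennreal (Gamma s / 2)"
proof -
  have "ennreal (Gamma s) = (\<integral>\<^sup>+t. ennreal (t powr (s - 1) * exp (- t)) * indicator {0..} t \<partial>lborel)"
    unfolding Gamma_conv_nn_integral_real[OF s]
    by (intro nn_integral_cong) (auto simp: indicator_def exp_minus field_simps)
  also have "\<dots> = (\<integral>\<^sup>+r. ennreal ((r\<^sup>2) powr (s - 1) * exp (- (r\<^sup>2))) * ennreal (2 * r) * indicator {0..} r \<partial>lborel)"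
    by (rule nn_integral_square_subst) measurable
  also have "\<dots> = (\<integral>\<^sup>+r. 2 * (ennreal (exp (- r\<^sup>2) * r powr (2 * s - 1)) * indicator {0..} r) \<partial>lborel)"
  proof (intro nn_integral_cong)
    fix r :: real
    have "(r\<^sup>2) powr (s - 1) * r = r powr (2 * s - 1)" if "r \<ge> 0"
      by (rule square_powr_mult[OF that])
    then show "ennreal ((r\<^sup>2) powr (s - 1) * exp (- (r\<^sup>2))) * ennreal (2 * r) * indicator {0..} r
      = 2 * (ennreal (exp (- r\<^sup>2) * r powr (2 * s - 1)) * indicator {0..} r)"
      by (auto simp: indicator_def ennreal_mult'[symmetric] mult_ac simp flip: ennreal_numeral)
  qed
  also have "\<dots> = 2 * (\<integral>\<^sup>+r. ennreal (exp (- r\<^sup>2) * r powr (2 * s - 1)) * indicator {0..} r \<partial>lborel)"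
    by (rule nn_integral_cmult) measurable
  finally have e: "ennreal (Gamma s) = 2 * (\<integral>\<^sup>+r. ennreal (exp (- r\<^sup>2) * r powr (2 * s - 1)) * indicator {0..} r \<partial>lborel)" .
  then show ?thesis by (rule ennreal_half_eq)
qed

lemma Beta_nn_integral:
  assumes "a > (0::real)" "b > 0"
  shows "(\<integral>\<^sup>+t. ennreal (t powr (a - 1) * (1 - t) powr (b - 1)) * indicator {0..1} t \<partial>lborel) = ennreal (Beta a b)"
  using nn_integral_has_integral_lebesgue[OF _ has_integral_Beta_real[OF assms]]
  by (simp add: mult.commute indicator_mult_ennreal)

lemma Beta_nn_integral_square:
  assumes ab: "a > (0::real)" "b > 0"
  shows "(\<integral>\<^sup>+r. ennreal (r powr (2 * a - 1) * (1 - r\<^sup>2) powr (b - 1)) * indicator {0..1} r \<partial>lborel) = ennreal (Beta a b / 2)"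
proof -
  have "ennreal (Beta a b) = (\<integral>\<^sup>+t. (ennreal (t powr (a - 1) * (1 - t) powr (b - 1)) * indicator {0..1} t) * indicator {0..} t \<partial>lborel)"
    unfolding Beta_nn_integral[OF ab, symmetric]
    by (intro nn_integral_cong) (auto simp: indicator_def)
  also have "\<dots> = (\<integral>\<^sup>+r. (ennreal ((r\<^sup>2) powr (a - 1) * (1 - r\<^sup>2) powr (b - 1)) * indicator {0..1} (r\<^sup>2)) * ennreal (2 * r) * indicator {0..} r \<partial>lborel)"
    by (rule nn_integral_square_subst) measurable
  also have "\<dots> = (\<integral>\<^sup>+r. 2 * (ennreal (r powr (2 * a - 1) * (1 - r\<^sup>2) powr (b - 1)) * indicator {0..1} r) \<partial>lborel)"
  proof (intro nn_integral_cong)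
    fix r :: real
    have 1: "(r\<^sup>2) powr (a - 1) * r = r powr (2 * a - 1)" if "r \<ge> 0"
      by (rule square_powr_mult[OF that])
    have 2: "r\<^sup>2 \<le> 1 \<longleftrightarrow> r \<le> 1" if "r \<ge> 0"
      using that by (simp add: abs_square_le_1)
    show "(ennreal ((r\<^sup>2) powr (a - 1) * (1 - r\<^sup>2) powr (b - 1)) * indicator {0..1} (r\<^sup>2)) * ennreal (2 * r) * indicator {0..} r
      = 2 * (ennreal (r powr (2 * a - 1) * (1 - r\<^sup>2) powr (b - 1)) * indicator {0..1} r)"
    proof (cases "r \<ge> 0")
      case True
      then show ?thesis using 1[OF True, symmetric] 2[OF True]
        by (auto simp: indicator_def ennreal_mult'[symmetric] mult_ac simp flip: ennreal_numeral)
    qed simp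
  qed
  also have "\<dots> = 2 * (\<integral>\<^sup>+r. ennreal (r powr (2 * a - 1) * (1 - r\<^sup>2) powr (b - 1)) * indicator {0..1} r \<partial>lborel)" (is "_ = 2 * ?I")
    by (rule nn_integral_cmult) measurable
  finally have e: "ennreal (Beta a b) = 2 * ?I" .
  then show ?thesis by (rule ennreal_half_eq)
qed

lemma nn_integral_scale:
  fixes f :: "'a::euclidean_space \<Rightarrow> ennreal"
  assumes [measurable]: "f \<in> borel_measurable borel" and c: "c > 0"
  shows "(\<integral>\<^sup>+x. f x \<partial>lborel) = ennreal (c ^ DIM('a)) * (\<integral>\<^sup>+x. f (c *\<^sub>R x) \<partial>lborel)"
  using c by (subst lborel_affine[of c 0])
     (simp_all add: nn_integral_density nn_integral_distr nn_integral_cmult ennreal_power)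

text \<open>The image of the measure \<open>p(x) dx\<close> under the norm gives mass \<open>A r\<^sup>m\<^sup>+\<^sup>d\<close> to \<open>[0, r]\<close>, by scaling.\<close>

lemma nn_integral_radial:
  fixes p :: "'a::euclidean_space \<Rightarrow> real" and f :: "real \<Rightarrow> ennreal"
  assumes [measurable]: "p \<in> borel_measurable borel" "f \<in> borel_measurable borel"
    and p0: "\<And>x. p x \<ge> 0" and hom: "\<And>c x. c > 0 \<Longrightarrow> p (c *\<^sub>R x) = c ^ m * p x"
    and A: "(\<integral>\<^sup>+x. ennreal (p x) * indicator (cball 0 1) x \<partial>lborel) = ennreal A" "A \<ge> 0"
  shows "(\<integral>\<^sup>+x. ennreal (p x) * f (norm x) \<partial>lborel)
    = ennreal (A * real (m + DIM('a))) * (\<integral>\<^sup>+r. ennreal (r ^ (m + DIM('a) - 1)) * f r * indicator {0..} r \<partial>lborel)"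
proof -
  define n where "n = m + DIM('a)"
  have n: "n > 0" by (simp add: n_def)
  let ?g = "\<lambda>r::real. ennreal (A * real n * r ^ (n - 1)) * indicator {0..} r"
  let ?M = "distr (density lborel (\<lambda>x. ennreal (p x))) borel norm"
  let ?N = "density lborel ?g"
  have N: "emeasure ?N {..a} = (if a \<ge> 0 then ennreal (A * a ^ n) else 0)" for a
  proof (cases "a \<ge> 0")
    case True
    have "emeasure ?N {..a} = (\<integral>\<^sup>+r. ennreal (A * real n * r ^ (n - 1)) * indicator {0..a} r \<partial>lborel)"
      by (subst emeasure_density) (auto split: split_indicator intro!: nn_integral_cong)
    also have "\<dots> = ennreal (A * a ^ n - A * 0 ^ n)"
      by (rule nn_integral_FTC_Icc) (use True A in \<open>auto intro!: derivative_eq_intros\<close>)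
    finally show ?thesis using True n by (simp add: power_0_left)
  next
    case False
    then have "emeasure ?N {..a} = (\<integral>\<^sup>+(r::real). 0 \<partial>lborel)"
      by (subst emeasure_density, simp, simp, intro nn_integral_cong) (auto split: split_indicator)
    then show ?thesis using False by simp
  qed
  have M: "emeasure ?M {..a} = (if a \<ge> 0 then ennreal (A * a ^ n) else 0)" for a
  proof -
    have 1: "emeasure ?M {..a} = (\<integral>\<^sup>+x. ennreal (p x) * indicator (cball 0 a) x \<partial>lborel)"
    proof -
      have "emeasure ?M {..a} = (\<integral>\<^sup>+x. indicator {..a} x \<partial>?M)"
        by (rule nn_integral_indicator[symmetric]) simp
      also have "\<dots> = (\<integral>\<^sup>+x. ennreal (p x) * indicator {..a} (norm x) \<partial>lborel)"
        by (subst nn_integral_distr) (simp_all add: nn_integral_density)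
      also have "\<dots> = (\<integral>\<^sup>+x. ennreal (p x) * indicator (cball 0 a) x \<partial>lborel)"
        by (intro nn_integral_cong) (auto split: split_indicator)
      finally show ?thesis .
    qed
    consider "a > 0" | "a \<le> 0" by linarith
    then show ?thesis
    proof cases
      case 1
      have [measurable]: "cball 0 r \<in> sets (borel :: 'a measure)" for r by (intro borel_closed closed_cball)
      have "(\<integral>\<^sup>+x. ennreal (p x) * indicator (cball 0 a) x \<partial>lborel)
        = ennreal (a ^ DIM('a)) * (\<integral>\<^sup>+x. ennreal (p (a *\<^sub>R x)) * indicator (cball 0 a) (a *\<^sub>R x) \<partial>lborel)"
        by (rule nn_integral_scale) (use 1 in measurable)
      also have "(\<integral>\<^sup>+x. ennreal (p (a *\<^sub>R x)) * indicator (cball 0 a) (a *\<^sub>R x) \<partial>lborel)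
        = (\<integral>\<^sup>+x. ennreal (a ^ m) * (ennreal (p x) * indicator (cball 0 1) x) \<partial>lborel)"
        using 1 p0 by (intro nn_integral_cong) (auto simp: hom indicator_def ennreal_mult')
      also have "\<dots> = ennreal (a ^ m) * (\<integral>\<^sup>+x. ennreal (p x) * indicator (cball 0 1) x \<partial>lborel)"
        by (rule nn_integral_cmult) measurable
      also have "ennreal (a ^ DIM('a)) * \<dots> = ennreal (A * a ^ n)"
        unfolding A using 1 A(2) by (simp add: ennreal_mult'[symmetric] n_def power_add mult_ac)
      finally show ?thesis using 1 \<open>emeasure ?M {..a} = _\<close> by simp
    next
      case 2
      \<comment> \<open>For a <= 0 the ball contains at most the origin, a null set. At a = 0 the
        formula also gives 0, because n > 0.\<close>
      have "AE x in lborel. x \<noteq> (0::'a)" by (rule AE_lborel_singleton)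
      then have "AE x in lborel. ennreal (p x) * indicator (cball 0 a) x = 0"
      proof eventually_elim
        case (elim x)
        then have "\<not> norm x \<le> a" using 2 by (metis norm_le_zero_iff order_trans)
        then show ?case by (simp add: indicator_def)
      qed
      then have "(\<integral>\<^sup>+x. ennreal (p x) * indicator (cball 0 a) x \<partial>lborel) = (\<integral>\<^sup>+(x::'a). 0 \<partial>lborel)"
        by (rule nn_integral_cong_AE)
      then show ?thesis using 2 n 1 by (auto simp: power_0_left)
    qed
  qed
  have "?M = ?N"
  proof (rule measure_eqI_atMost)
    show "emeasure ?M {..a} = emeasure ?N {..a}" for a unfolding M N ..
    show "emeasure ?M {..a} < \<infinity>" for a unfolding M by simp
  qed simp_all
  then have "integral\<^sup>N ?M f = integral\<^sup>N ?N f" by simp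
  also have "\<dots> = (\<integral>\<^sup>+r. ennreal (A * real n) * (ennreal (r ^ (n - 1)) * f r * indicator {0..} r) \<partial>lborel)"
    using A(2) by (subst nn_integral_density) (auto intro!: nn_integral_cong simp: indicator_def ennreal_mult' mult_ac)
  also have "\<dots> = ennreal (A * real n) * (\<integral>\<^sup>+r. ennreal (r ^ (n - 1)) * f r * indicator {0..} r \<partial>lborel)"
    by (rule nn_integral_cmult) measurable
  finally show ?thesis by (simp add: nn_integral_distr nn_integral_density n_def)
qed

text \<open>Strong induction: once the coefficients below \<open>m\<close> are 0, division by s^(2m)
  leaves a power series that is 0 for s different from 0, and its limit at 0 is the coefficient of
  index \<open>m\<close>.\<close>

lemma even_powser_unique:
  fixes c :: "nat \<Rightarrow> real"
  assumes s: "\<And>s. (\<lambda>k. c k * s ^ (2 * k)) sums 0"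
  shows "c k = 0"
proof (induction k rule: less_induct)
  case (less m)
  \<comment> \<open>An ordinary power series with zero odd coefficients, the form required by the
    theorem on limits of power series.\<close>
  define e where "e n = (if even n then c (n div 2 + m) else 0)" for n
  have "(\<lambda>n. e n * s ^ n) sums 0" if s0: "s \<noteq> 0" for s :: real
  proof -
    have "(\<lambda>k. c (k + m) * s ^ (2 * (k + m))) sums (0 - (\<Sum>k<m. c k * s ^ (2 * k)))"
      using sums_split_initial_segment[OF s[of s], of m] by simp
    then have "(\<lambda>k. c (k + m) * s ^ (2 * (k + m))) sums 0" using less by simp
    then have "(\<lambda>k. c (k + m) * s ^ (2 * (k + m)) / s ^ (2 * m)) sums (0 / s ^ (2 * m))"
      by (rule sums_divide)
    moreover have "c (k + m) * s ^ (2 * (k + m)) / s ^ (2 * m) = e (2 * k) * s ^ (2 * k)" for k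
      using s0 by (simp add: e_def power_add distrib_left)
    ultimately have "(\<lambda>k. e (2 * k) * s ^ (2 * k)) sums 0" by simp
    moreover have "strict_mono (\<lambda>k::nat. 2 * k)" by (auto simp: strict_mono_def)
    moreover have "e n * s ^ n = 0" if "n \<notin> range (\<lambda>k. 2 * k)" for n
    proof -
      have "odd n" using that by (auto elim!: evenE)
      then show ?thesis by (simp add: e_def)
    qed
    ultimately show ?thesis
      using sums_mono_reindex[of "\<lambda>k. 2 * k" "\<lambda>n. e n * s ^ n" 0] by blast
  qed
  then have "((\<lambda>_. 0) \<longlongrightarrow> e 0) (at (0::real))"
    by (intro powser_limit_0_strong[of 1 e "\<lambda>_. 0"]) auto
  then have "e 0 = 0" by (simp add: LIM_const_eq tendsto_const_iff)
  then show ?case by (simp add: e_def)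
qed

text \<open>The exponential series is integrated term by term; exp |\<xi> . x| |g(x)| dominates the
  sums of the absolute values. The odd terms vanish by reflection because \<open>g\<close> is
  even.\<close>

lemma fourier_even_series:
  fixes g :: "'a::euclidean_space \<Rightarrow> real"
  assumes g[measurable]: "g \<in> borel_measurable borel" and even: "\<And>x. g (- x) = g x"
    and int: "integrable lborel (\<lambda>x. exp \<bar>\<xi> \<bullet> x\<bar> * g x)"
  shows "integrable lborel (\<lambda>x. (\<xi> \<bullet> x) ^ n * g x)"
    and "(\<lambda>k. complex_of_real ((-1) ^ k / fact (2 * k) * (LBINT x. (\<xi> \<bullet> x) ^ (2 * k) * g x)))
      sums fourier_L1 (\<lambda>x. complex_of_real (g x)) \<xi>"
proof -
  define f where "f n x = ((- \<i> * complex_of_real (\<xi> \<bullet> x)) ^ n /\<^sub>R fact n) * complex_of_real (g x)" for n x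
  have fn: "norm (f n x) = \<bar>\<xi> \<bullet> x\<bar> ^ n /\<^sub>R fact n * \<bar>g x\<bar>" for n x
    by (simp add: f_def norm_mult norm_power power_abs)
  have es: "(\<lambda>n. \<bar>\<xi> \<bullet> x\<bar> ^ n /\<^sub>R fact n * \<bar>g x\<bar>) sums (exp \<bar>\<xi> \<bullet> x\<bar> * \<bar>g x\<bar>)" for x
    by (intro sums_mult2 exp_converges)
  have part: "(\<Sum>i\<in>I. \<bar>\<xi> \<bullet> x\<bar> ^ i /\<^sub>R fact i * \<bar>g x\<bar>) \<le> exp \<bar>\<xi> \<bullet> x\<bar> * \<bar>g x\<bar>" if "finite I" for x I
    using sum_le_suminf[OF sums_summable[OF es[of x]] that] sums_unique[OF es[of x]] by simp
  have int': "integrable lborel (\<lambda>x. exp \<bar>\<xi> \<bullet> x\<bar> * \<bar>g x\<bar>)"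
    using integrable_norm[OF int] by (simp add: abs_mult)
  have fm[measurable]: "f n \<in> borel_measurable borel" for n unfolding f_def by measurable
  have fi: "integrable lborel (f n)" for n
  proof (rule Bochner_Integration.integrable_bound[OF int'])
    show "AE x in lborel. norm (f n x) \<le> norm (exp \<bar>\<xi> \<bullet> x\<bar> * \<bar>g x\<bar>)"
      using part[of "{n}"] by (auto simp: fn)
  qed simp
  show "integrable lborel (\<lambda>x. (\<xi> \<bullet> x) ^ n * g x)"
  proof (rule Bochner_Integration.integrable_bound[where f="\<lambda>x. fact n *\<^sub>R f n x"])
    show "AE x in lborel. norm ((\<xi> \<bullet> x) ^ n * g x) \<le> norm (fact n *\<^sub>R f n x)"
      by (simp add: fn power_abs abs_mult mult.assoc[symmetric])
  qed (use fi[of n] in auto)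
  have summ: "summable (\<lambda>n. LBINT x. norm (f n x))"
  proof (rule bounded_imp_summable)
    show "(\<Sum>k\<le>n. LBINT x. norm (f k x)) \<le> (LBINT x. exp \<bar>\<xi> \<bullet> x\<bar> * \<bar>g x\<bar>)" for n
    proof -
      have "(\<Sum>k\<le>n. LBINT x. norm (f k x)) = (LBINT x. (\<Sum>k\<le>n. norm (f k x)))"
        using fi by (intro Bochner_Integration.integral_sum[symmetric] integrable_norm)
      also have "\<dots> \<le> (LBINT x. exp \<bar>\<xi> \<bullet> x\<bar> * \<bar>g x\<bar>)"
      proof (rule integral_mono_AE)
        show "AE x in lborel. (\<Sum>k\<le>n. norm (f k x)) \<le> exp \<bar>\<xi> \<bullet> x\<bar> * \<bar>g x\<bar>"
          unfolding fn using part by auto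
      qed (use fi int' in auto)
      finally show ?thesis .
    qed
  qed simp
  have "(\<lambda>n. LBINT x. f n x) sums (LBINT x. (\<Sum>n. f n x))"
  proof (rule sums_integral[OF fi _ summ])
    show "AE x in lborel. summable (\<lambda>n. norm (f n x))"
      using sums_summable[OF es] by (simp add: fn)
  qed
  also have "(\<lambda>x. \<Sum>n. f n x) = (\<lambda>x. wave \<xi> x * complex_of_real (g x))"
  proof
    fix x
    have "(\<lambda>n. f n x) sums (wave \<xi> x * complex_of_real (g x))"
      unfolding f_def wave_def by (intro sums_mult2 exp_converges)
    then show "(\<Sum>n. f n x) = wave \<xi> x * complex_of_real (g x)" by (rule sums_unique[symmetric])
  qed
  finally have S: "(\<lambda>n. LBINT x. f n x) sums fourier_L1 (\<lambda>x. complex_of_real (g x)) \<xi>"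
    by (simp add: fourier_L1_wave)
  have odd: "(LBINT x. f n x) = 0" if "odd n" for n
  proof -
    have "(LBINT x. f n x) = (LBINT x. f n (- x))" by (rule integral_reflect(2)[symmetric])
    also have "\<dots> = (LBINT x. - f n x)"
      using that by (intro Bochner_Integration.integral_cong) (auto simp: f_def even)
    finally have "(LBINT x. f n x) = - (LBINT x. f n x)" by simp
    then have "2 * (LBINT x. f n x) = 0" by (simp only: mult_2 eq_neg_iff_add_eq_0)
    then show ?thesis by simp
  qed
  have ev: "(LBINT x. f (2 * k) x) = complex_of_real ((-1) ^ k / fact (2 * k) * (LBINT x. (\<xi> \<bullet> x) ^ (2 * k) * g x))" for k
  proof -
    have "f (2 * k) x = complex_of_real ((-1) ^ k / fact (2 * k) * ((\<xi> \<bullet> x) ^ (2 * k) * g x))" for x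
    proof -
      have sq: "(- \<i> * complex_of_real (\<xi> \<bullet> x))\<^sup>2 = - 1 * (complex_of_real (\<xi> \<bullet> x))\<^sup>2"
        by (simp add: power_mult_distrib)
      have "(- \<i> * complex_of_real (\<xi> \<bullet> x)) ^ (2 * k) = (- 1) ^ k * (complex_of_real (\<xi> \<bullet> x)) ^ (2 * k)"
        unfolding power_mult sq by (rule power_mult_distrib)
      then show ?thesis
        unfolding f_def by (simp add: scaleR_conv_of_real divide_inverse mult_ac)
    qed
    then have "(LBINT x. f (2 * k) x) = complex_of_real (LBINT x. (-1) ^ k / fact (2 * k) * ((\<xi> \<bullet> x) ^ (2 * k) * g x))"
      by (simp only: integral_complex_of_real)
    then show ?thesis by (simp only: integral_mult_right_zero)
  qed
  have "strict_mono (\<lambda>k::nat. 2 * k)" by (auto simp: strict_mono_def)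
  moreover have "(LBINT x. f n x) = 0" if "n \<notin> range (\<lambda>k. 2 * k)" for n
    using that by (intro odd) (auto elim!: evenE)
  ultimately have "(\<lambda>k. LBINT x. f (2 * k) x) sums fourier_L1 (\<lambda>x. complex_of_real (g x)) \<xi>"
    using sums_mono_reindex[of "\<lambda>k. 2 * k" "\<lambda>n. LBINT x. f n x"] S by blast
  then show "(\<lambda>k. complex_of_real ((-1) ^ k / fact (2 * k) * (LBINT x. (\<xi> \<bullet> x) ^ (2 * k) * g x)))
      sums fourier_L1 (\<lambda>x. complex_of_real (g x)) \<xi>"
    unfolding ev .
qed

lemma integrable_exp_gauss:
  fixes \<xi> :: "'a::euclidean_space"
  shows "integrable lborel (\<lambda>x. exp \<bar>\<xi> \<bullet> x\<bar> * gauss 1 x)"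
proof (rule Bochner_Integration.integrable_bound)
  show "integrable lborel (\<lambda>x::'a. exp ((norm \<xi>)\<^sup>2 / 2) * gauss (1/2) x)"
    by (intro integrable_mult_right integrable_gauss) simp
  have "exp \<bar>\<xi> \<bullet> x\<bar> * gauss 1 x \<le> exp ((norm \<xi>)\<^sup>2 / 2) * gauss (1/2) x" for x
  proof -
    have "\<bar>\<xi> \<bullet> x\<bar> \<le> norm \<xi> * norm x" by (rule Cauchy_Schwarz_ineq2)
    also have "\<dots> \<le> (norm \<xi>)\<^sup>2 / 2 + (norm x)\<^sup>2 / 2"
      using sum_squares_bound[of "norm \<xi>" "norm x"] by simp
    finally show ?thesis by (simp add: gauss_def exp_add[symmetric])
  qed
  then show "AE x in lborel. norm (exp \<bar>\<xi> \<bullet> x\<bar> * gauss 1 x) \<le> norm (exp ((norm \<xi>)\<^sup>2 / 2) * gauss (1/2) x)"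
    by (simp add: abs_mult)
qed measurable

text \<open>Compare coefficients in \<open>s\<close> of the transform of the Gaussian at \<open>s \<xi>\<close>.\<close>

lemma gauss_moment:
  fixes \<xi> :: "'a::euclidean_space"
  shows "(LBINT x. (\<xi> \<bullet> x) ^ (2 * k) * gauss 1 x) = sqrt pi ^ DIM('a) * fact (2 * k) / fact k * ((norm \<xi>)\<^sup>2 / 4) ^ k"
proof -
  define M where "M k = (LBINT x. (\<xi> \<bullet> x) ^ (2 * k) * gauss 1 x)" for k
  define c where "c k = (-1) ^ k / fact (2 * k) * M k - sqrt pi ^ DIM('a) * ((- (norm \<xi>)\<^sup>2 / 4) ^ k /\<^sub>R fact k)" for k
  have "(\<lambda>k. c k * s ^ (2 * k)) sums 0" for s
  proof -
    have Ms: "(LBINT x. ((s *\<^sub>R \<xi>) \<bullet> x) ^ (2 * k) * gauss 1 x) = s ^ (2 * k) * M k" for k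
      unfolding M_def by (subst integral_mult_right_zero[symmetric]) (simp add: power_mult_distrib mult.assoc)
    have "(\<lambda>k. complex_of_real ((-1) ^ k / fact (2 * k) * (s ^ (2 * k) * M k)))
      sums fourier_L1 (\<lambda>x. cgauss 1 x) (s *\<^sub>R \<xi>)"
      using fourier_even_series(2)[of "gauss 1" "s *\<^sub>R \<xi>", OF _ _ integrable_exp_gauss] by (simp only: Ms) simp
    also have "fourier_L1 (\<lambda>x. cgauss 1 x) (s *\<^sub>R \<xi>)
        = complex_of_real (sqrt pi ^ DIM('a) * exp (- (norm \<xi>)\<^sup>2 / 4 * s\<^sup>2))"
      using gauss_fourier(2)[of 1 "s *\<^sub>R \<xi>"] by (simp add: fourier_L1_wave gauss_def power_mult_distrib mult_ac)
    finally have "(\<lambda>k. (-1) ^ k / fact (2 * k) * (s ^ (2 * k) * M k)) sums (sqrt pi ^ DIM('a) * exp (- (norm \<xi>)\<^sup>2 / 4 * s\<^sup>2))"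
      by (simp only: sums_of_real_iff)
    moreover have "(\<lambda>k. sqrt pi ^ DIM('a) * ((- (norm \<xi>)\<^sup>2 / 4 * s\<^sup>2) ^ k /\<^sub>R fact k)) sums (sqrt pi ^ DIM('a) * exp (- (norm \<xi>)\<^sup>2 / 4 * s\<^sup>2))"
      by (intro sums_mult exp_converges)
    ultimately have "(\<lambda>k. (-1) ^ k / fact (2 * k) * (s ^ (2 * k) * M k) - sqrt pi ^ DIM('a) * ((- (norm \<xi>)\<^sup>2 / 4 * s\<^sup>2) ^ k /\<^sub>R fact k)) sums (0::real)"
      using sums_diff by fastforce
    moreover have "(-1) ^ k / fact (2 * k) * (s ^ (2 * k) * M k) - sqrt pi ^ DIM('a) * ((- (norm \<xi>)\<^sup>2 / 4 * s\<^sup>2) ^ k /\<^sub>R fact k) = c k * s ^ (2 * k)" for k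
      by (simp only: c_def power_mult_distrib[of _ "s\<^sup>2"] power_mult[symmetric] left_diff_distrib) (simp add: mult_ac)
    ultimately show ?thesis by simp
  qed
  then have "c k = 0" by (rule even_powser_unique)
  then have 0: "(-1) ^ k / fact (2 * k) * M k = sqrt pi ^ DIM('a) * ((- (norm \<xi>)\<^sup>2 / 4) ^ k /\<^sub>R fact k)"
    by (simp only: c_def right_minus_eq)
  have P: "(- (norm \<xi>)\<^sup>2 / 4) ^ k = (-1) ^ k * ((norm \<xi>)\<^sup>2 / 4) ^ k"
    by (subst power_mult_distrib[symmetric]) simp
  have 1: "(-1) ^ k / fact (2 * k) * M k = sqrt pi ^ DIM('a) * ((-1) ^ k * (((norm \<xi>)\<^sup>2 / 4) ^ k / fact k))"
    unfolding 0 P by (simp only: real_scaleR_def divide_inverse mult_ac)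
  have "(-1) ^ k = (1::real) \<or> (-1) ^ k = (-1::real)" by (simp add: minus_one_power_iff)
  then have "M k / fact (2 * k) = sqrt pi ^ DIM('a) * (((norm \<xi>)\<^sup>2 / 4) ^ k / fact k)"
    by (rule disjE) (use 1 in simp_all)
  then show ?thesis by (simp add: M_def divide_eq_eq mult_ac)
qed

text \<open>\<open>nn_integral_radial\<close> gives the formula with a constant \<open>B\<close>
  that does not depend on \<open>f\<close>. Its value is found by inserting the Gaussian, for which
  the left side is \<open>gauss_moment\<close> and the right side a Gamma integral; no integration
  over the sphere is needed.\<close>

lemma nn_integral_radial_moment:
  fixes \<xi> :: "'a::euclidean_space" and f :: "real \<Rightarrow> ennreal"
  assumes f[measurable]: "f \<in> borel_measurable borel"
  shows "(\<integral>\<^sup>+x. ennreal ((\<xi> \<bullet> x) ^ (2 * k)) * f (norm x) \<partial>lborel)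
    = ennreal (2 * sqrt pi ^ DIM('a) * fact (2 * k) / (fact k * Gamma (real k + DIM('a) / 2)) * ((norm \<xi>)\<^sup>2 / 4) ^ k)
      * (\<integral>\<^sup>+r. ennreal (r ^ (2 * k + DIM('a) - 1)) * f r * indicator {0..} r \<partial>lborel)"
proof -
  let ?p = "\<lambda>x. (\<xi> \<bullet> x) ^ (2 * k)"
  have cb[measurable]: "cball 0 1 \<in> sets (borel :: 'a measure)" by (intro borel_closed closed_cball)
  obtain A where A: "(\<integral>\<^sup>+x. ennreal (?p x) * indicator (cball 0 1) x \<partial>lborel) = ennreal A" "A \<ge> 0"
  proof -
    have "(\<integral>\<^sup>+x. ennreal (?p x) * indicator (cball 0 1) x \<partial>lborel) \<le> (\<integral>\<^sup>+(x::'a). ennreal (norm \<xi> ^ (2 * k)) * indicator (cball 0 1) x \<partial>lborel)"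
    proof (rule nn_integral_mono)
      fix x :: 'a
      have "?p x \<le> norm \<xi> ^ (2 * k)" if "norm x \<le> 1"
      proof -
        have "\<bar>\<xi> \<bullet> x\<bar> \<le> norm \<xi> * norm x" by (rule Cauchy_Schwarz_ineq2)
        also have "\<dots> \<le> norm \<xi>" using that by (simp add: mult_left_le)
        finally have "\<bar>\<xi> \<bullet> x\<bar> ^ (2 * k) \<le> norm \<xi> ^ (2 * k)" by (intro power_mono) auto
        then show ?thesis by (simp add: power_mult)
      qed
      then show "ennreal (?p x) * indicator (cball 0 1) x \<le> ennreal (norm \<xi> ^ (2 * k)) * indicator (cball 0 1) x"
        by (auto split: split_indicator intro: ennreal_leI)
    qed
    also have "\<dots> < \<infinity>"
      using emeasure_lborel_cball_finite[of "0::'a" 1]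
      by (subst nn_integral_cmult_indicator) (auto simp: ennreal_mult_less_top)
    finally show ?thesis
      using that[of "enn2real (\<integral>\<^sup>+x. ennreal (?p x) * indicator (cball 0 1) x \<partial>lborel)"] by auto
  qed
  define B where "B = A * real (2 * k + DIM('a))"
  have B0: "B \<ge> 0" using A(2) by (simp add: B_def)
  have R: "(\<integral>\<^sup>+x. ennreal (?p x) * h (norm x) \<partial>lborel)
    = ennreal B * (\<integral>\<^sup>+r. ennreal (r ^ (2 * k + DIM('a) - 1)) * h r * indicator {0..} r \<partial>lborel)"
    if "h \<in> borel_measurable borel" for h
    unfolding B_def by (rule nn_integral_radial) (use that A in \<open>auto simp: power_mult_distrib zero_le_even_power\<close>)
  let ?s = "real k + DIM('a) / 2"
  have s: "?s > 0" by (simp add: add_nonneg_pos)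
  have "ennreal (sqrt pi ^ DIM('a) * fact (2 * k) / fact k * ((norm \<xi>)\<^sup>2 / 4) ^ k) = (\<integral>\<^sup>+x. ennreal (?p x * gauss 1 x) \<partial>lborel)"
    unfolding gauss_moment[symmetric]
    by (rule nn_integral_eq_integral[symmetric, OF fourier_even_series(1)])
       (auto intro!: integrable_exp_gauss mult_nonneg_nonneg zero_le_even_power)
  also have "\<dots> = (\<integral>\<^sup>+x. ennreal (?p x) * ennreal (exp (- (norm x)\<^sup>2)) \<partial>lborel)"
    by (intro nn_integral_cong) (simp add: gauss_def ennreal_mult'')
  also have "\<dots> = ennreal B * (\<integral>\<^sup>+r. ennreal (r ^ (2 * k + DIM('a) - 1)) * ennreal (exp (- r\<^sup>2)) * indicator {0..} r \<partial>lborel)"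
    by (rule R) measurable
  also have "(\<integral>\<^sup>+r. ennreal (r ^ (2 * k + DIM('a) - 1)) * ennreal (exp (- r\<^sup>2)) * indicator {0..} r \<partial>lborel)
    = (\<integral>\<^sup>+r. ennreal (exp (- r\<^sup>2) * r powr (2 * ?s - 1)) * indicator {0..} r \<partial>lborel)"
  proof (rule nn_integral_cong_AE)
    \<comment> \<open>The origin is left out because \<open>0 ^ 0 = 1\<close> while
      \<open>0 powr 0 = 0\<close>, which matters for k = 0 in dimension one.\<close>
    have "AE r in lborel. r \<noteq> (0::real)" by (rule AE_lborel_singleton)
    then show "AE r in lborel. ennreal (r ^ (2 * k + DIM('a) - 1)) * ennreal (exp (- r\<^sup>2)) * indicator {0..} r
      = ennreal (exp (- r\<^sup>2) * r powr (2 * ?s - 1)) * indicator {0..} (r::real)"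
    proof eventually_elim
      case (elim r)
      have "DIM('a) \<ge> 1" by (simp add: Suc_leI)
      then have "2 * ?s - 1 = real (2 * k + DIM('a) - 1)" by (subst of_nat_diff) (use DIM_positive[where 'a='a] in linarith, simp)
      then show ?case using elim
        by (auto split: split_indicator simp: powr_realpow ennreal_mult''[symmetric] mult.commute simp del: of_nat_diff)
    qed
  qed
  also have "\<dots> = ennreal (Gamma ?s / 2)" by (rule Gamma_nn_integral_square[OF s])
  also have "ennreal B * ennreal (Gamma ?s / 2) = ennreal (B * (Gamma ?s / 2))"
    using Gamma_real_pos[OF s] by (intro ennreal_mult''[symmetric]) simp
  finally have "sqrt pi ^ DIM('a) * fact (2 * k) / fact k * ((norm \<xi>)\<^sup>2 / 4) ^ k = B * (Gamma ?s / 2)"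
    using B0 Gamma_real_pos[OF s] by (subst (asm) ennreal_inj) auto
  then have "B = 2 * sqrt pi ^ DIM('a) * fact (2 * k) / (fact k * Gamma ?s) * ((norm \<xi>)\<^sup>2 / 4) ^ k"
    using Gamma_real_pos[OF s] by (simp add: field_simps)
  then show ?thesis using R[OF f] by simp
qed

text \<open>The factor \<open>fact (2 * k)\<close> of the angular constant cancels against the
  exponential series. The moments are prescribed as extended integrals, so that their finiteness is
  part of the hypothesis.\<close>

lemma fourier_radial_series:
  fixes f :: "real \<Rightarrow> real" and \<xi> :: "'a::euclidean_space"
  assumes f[measurable]: "f \<in> borel_measurable borel" and f0: "\<And>r. f r \<ge> 0"
    and int: "integrable lborel (\<lambda>x. exp \<bar>\<xi> \<bullet> x\<bar> * f (norm x))"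
    and m: "\<And>k. (\<integral>\<^sup>+r. ennreal (r ^ (2 * k + DIM('a) - 1)) * ennreal (f r) * indicator {0..} r \<partial>lborel) = ennreal (m k)"
      "\<And>k. m k \<ge> 0"
  shows "(\<lambda>k. complex_of_real (2 * sqrt pi ^ DIM('a) * (- (norm \<xi>)\<^sup>2 / 4) ^ k / (fact k * Gamma (real k + DIM('a) / 2)) * m k))
    sums fourier_L1 (\<lambda>x. complex_of_real (f (norm x))) \<xi>"
proof -
  have "(LBINT x. (\<xi> \<bullet> x) ^ (2 * k) * f (norm x))
     = 2 * sqrt pi ^ DIM('a) * fact (2 * k) / (fact k * Gamma (real k + DIM('a) / 2)) * ((norm \<xi>)\<^sup>2 / 4) ^ k * m k" (is "_ = ?R k") for k
  proof -
    have s: "real k + DIM('a) / 2 > 0" by (simp add: add_nonneg_pos)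
    have "(\<integral>\<^sup>+x. ennreal ((\<xi> \<bullet> x) ^ (2 * k) * f (norm x)) \<partial>lborel) = (\<integral>\<^sup>+x. ennreal ((\<xi> \<bullet> x) ^ (2 * k)) * ennreal (f (norm x)) \<partial>lborel)"
      by (intro nn_integral_cong) (simp add: ennreal_mult'' f0)
    also have "\<dots> = ennreal (?R k)"
      using nn_integral_radial_moment[of "\<lambda>r. ennreal (f r)" \<xi> k] m by (simp add: ennreal_mult''[symmetric])
    finally have "(\<integral>\<^sup>+x. ennreal ((\<xi> \<bullet> x) ^ (2 * k) * f (norm x)) \<partial>lborel) = ennreal (?R k)" .
    then show ?thesis
      using m(2)[of k] Gamma_real_pos[OF s]
      by (subst (asm) nn_integral_eq_integrable) (auto simp: f0 intro!: mult_nonneg_nonneg divide_nonneg_nonneg zero_le_even_power)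
  qed
  then have "(-1) ^ k / fact (2 * k) * (LBINT x. (\<xi> \<bullet> x) ^ (2 * k) * f (norm x))
    = 2 * sqrt pi ^ DIM('a) * (- (norm \<xi>)\<^sup>2 / 4) ^ k / (fact k * Gamma (real k + DIM('a) / 2)) * m k" for k
    using power_mult_distrib[of "-1" "(norm \<xi>)\<^sup>2 / 4" k] by (simp add: mult_ac)
  moreover have "(\<lambda>k. complex_of_real ((-1) ^ k / fact (2 * k) * (LBINT x. (\<xi> \<bullet> x) ^ (2 * k) * f (norm x))))
      sums fourier_L1 (\<lambda>x. complex_of_real (f (norm x))) \<xi>"
    by (rule fourier_even_series(2)) (use int in auto)
  ultimately show ?thesis by simp
qed

section \<open>The hypergeometric function Q and squares of Bessel functions\<close>

definition hyp01 :: "real \<Rightarrow> real \<Rightarrow> real" where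
  "hyp01 c z = (\<Sum>k. 1 / (fact k * pochhammer c k) * z ^ k)"

text \<open>Source of the recurring condition \<open>c \<ge> 1\<close>: it makes the series of
  \<open>hyp01\<close> dominated by the exponential series. The parameter \<delta> + 1/2 satisfies
  it because \<delta> > d/2 >= 1/2.\<close>

lemma pochhammer_ge_1: "c \<ge> (1::real) \<Longrightarrow> pochhammer c k \<ge> 1"
proof (induction k)
  case (Suc k)
  have "1 * 1 \<le> pochhammer c k * (c + real k)"
    using Suc by (intro mult_mono) auto
  then show ?case by (simp add: pochhammer_Suc)
qed simp

lemma summable_exp_bound:
  fixes a :: "nat \<Rightarrow> real"
  assumes "\<And>k. \<bar>a k\<bar> \<le> 1 / fact k"
  shows "summable (\<lambda>k. norm (a k * z ^ k))"
proof (rule summable_comparison_test)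
  show "\<exists>N. \<forall>n\<ge>N. norm (norm (a n * z ^ n)) \<le> \<bar>z\<bar> ^ n /\<^sub>R fact n"
  proof (intro exI allI impI)
    fix n
    have "\<bar>a n\<bar> * \<bar>z\<bar> ^ n \<le> 1 / fact n * \<bar>z\<bar> ^ n"
      by (intro mult_right_mono assms) simp
    then show "norm (norm (a n * z ^ n)) \<le> \<bar>z\<bar> ^ n /\<^sub>R fact n"
      by (simp add: abs_mult power_abs divide_inverse mult_ac)
  qed
  show "summable (\<lambda>n. \<bar>z\<bar> ^ n /\<^sub>R fact n)" by (rule summable_exp_generic)
qed

lemma hyp01_coeff_bound:
  fixes c :: real
  assumes c: "c \<ge> 1" shows "\<bar>1 / (fact k * pochhammer c k)\<bar> \<le> 1 / fact k"
proof -
  have p: "pochhammer c k \<ge> 1" using c by (rule pochhammer_ge_1)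
  then have "fact k * 1 \<le> fact k * pochhammer c k" by (intro mult_left_mono) auto
  then have "1 / (fact k * pochhammer c k) \<le> 1 / fact k"
    by (intro divide_left_mono) (use p in auto)
  then show ?thesis using p by simp
qed

lemma hyp01_summable:
  fixes c :: real
  shows "c \<ge> 1 \<Longrightarrow> summable (\<lambda>k. norm (1 / (fact k * pochhammer c k) * z ^ k))"
  by (rule summable_exp_bound) (rule hyp01_coeff_bound)

lemma hyp01_sums: "c \<ge> 1 \<Longrightarrow> (\<lambda>k. 1 / (fact k * pochhammer c k) * z ^ k) sums hyp01 c z"
  unfolding hyp01_def by (rule summable_sums) (rule summable_norm_cancel[OF hyp01_summable])

lemma hyp01_0 [simp]: "hyp01 c 0 = 1"
  unfolding hyp01_def by (subst powser_zero) simp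

lemma DERIV_hyp01:
  assumes c: "c \<ge> 1"
  shows "(hyp01 c has_field_derivative hyp01 (c + 1) z / c) (at z)"
proof -
  let ?a = "\<lambda>k. 1 / (fact k * pochhammer c k)"
  have "diffs ?a n = 1 / (fact n * pochhammer (c + 1) n) / c" for n
    using c by (simp add: diffs_def pochhammer_rec del: of_nat_Suc)
  then have "(\<Sum>n. diffs ?a n * z ^ n) = (\<Sum>n. 1 / (fact n * pochhammer (c + 1) n) * z ^ n / c)"
    by simp
  also have "\<dots> = hyp01 (c + 1) z / c"
    unfolding hyp01_def
    by (rule suminf_divide[OF summable_norm_cancel[OF hyp01_summable]]) (use c in simp)
  finally show ?thesis
    using termdiffs_strong_converges_everywhere[of ?a z] summable_norm_cancel[OF hyp01_summable[OF c]]
    unfolding hyp01_def[abs_def] by simp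
qed

lemma continuous_on_hyp01 [continuous_intros]:
  assumes "c \<ge> 1" "continuous_on A f" shows "continuous_on A (\<lambda>x. hyp01 c (f x))"
proof -
  have "continuous_on UNIV (hyp01 c)"
    using DERIV_hyp01[OF assms(1)] by (meson DERIV_continuous continuous_at_imp_continuous_on)
  then show ?thesis by (rule continuous_on_compose2[OF _ assms(2)]) simp
qed

text \<open>As differentiation raises the parameter by 1 and divides by it, this is the differential
  equation z F'' + c F' = F written as a contiguity relation; it follows by comparing
  coefficients.\<close>

lemma hyp01_ode:
  assumes c: "c \<ge> 1"
  shows "z / (c * (c + 1)) * hyp01 (c + 2) z + hyp01 (c + 1) z = hyp01 c z"
proof -
  have c1: "c + 1 \<ge> 1" "c + 2 \<ge> 1" using c by simp_all
  \<comment> \<open>The factor \<open>z\<close> shifts the series by one place; its coefficient at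
    index 0 is 0.\<close>
  let ?A = "\<lambda>k. if k = 0 then 0 else 1 / (c * (c + 1)) * (1 / (fact (k - 1) * pochhammer (c + 2) (k - 1)) * z ^ k)"
  have "(\<lambda>k. z / (c * (c + 1)) * (1 / (fact k * pochhammer (c + 2) k) * z ^ k)) sums (z / (c * (c + 1)) * hyp01 (c + 2) z)"
    by (intro sums_mult hyp01_sums c1)
  then have "(\<lambda>k. ?A (Suc k)) sums (z / (c * (c + 1)) * hyp01 (c + 2) z)"
    by (simp add: mult_ac)
  then have A: "?A sums (z / (c * (c + 1)) * hyp01 (c + 2) z)"
    by (subst (asm) sums_Suc_iff) simp
  have "(\<lambda>k. ?A k + 1 / (fact k * pochhammer (c + 1) k) * z ^ k) sums (z / (c * (c + 1)) * hyp01 (c + 2) z + hyp01 (c + 1) z)"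
    by (intro sums_add A hyp01_sums c1)
  moreover have "?A k + 1 / (fact k * pochhammer (c + 1) k) * z ^ k = 1 / (fact k * pochhammer c k) * z ^ k" for k
  proof (cases k)
    case (Suc n)
    define P where "P = pochhammer (c + 2) n"
    have P: "P > 0" using pochhammer_ge_1[OF c1(2), of n] by (simp add: P_def)
    have 1: "pochhammer (c + 1) (Suc n) = (c + 1) * P" by (simp add: pochhammer_rec P_def add.assoc)
    have 2: "pochhammer c (Suc n) = c * pochhammer (c + 1) n" by (simp add: pochhammer_rec)
    have 3: "pochhammer (c + 1) n * (c + 1 + n) = (c + 1) * P"
      using 1 by (simp add: pochhammer_Suc)
    have "c + 1 + n > 0" using c by simp
    then have 4: "pochhammer (c + 1) n = (c + 1) * P / (c + 1 + n)" using 3 by (simp add: field_simps)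
    have F: "fact (Suc n) = (real n + 1) * fact n" by simp
    have key: "1 / (c * (c + 1)) * (1 / (fact n * P)) + 1 / (((real n + 1) * fact n) * ((c + 1) * P))
      = 1 / (((real n + 1) * fact n) * (c * ((c + 1) * P / (c + 1 + n))))"
      using P c \<open>c + 1 + n > 0\<close> by (simp add: divide_simps)
    have "?A k + 1 / (fact k * pochhammer (c + 1) k) * z ^ k
      = (1 / (c * (c + 1)) * (1 / (fact n * P)) + 1 / (fact (Suc n) * ((c + 1) * P))) * z ^ k"
      unfolding Suc 1 P_def[symmetric] by (simp add: P_def distrib_right del: fact_Suc power_Suc)
    also have "\<dots> = 1 / (fact k * pochhammer c k) * z ^ k"
      unfolding Suc 2 4 F key ..
    finally show ?thesis .
  qed simp
  ultimately have "(\<lambda>k. 1 / (fact k * pochhammer c k) * z ^ k) sums (z / (c * (c + 1)) * hyp01 (c + 2) z + hyp01 (c + 1) z)"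
    by simp
  then show ?thesis using hyp01_sums[OF c] sums_unique2 by blast
qed

text \<open>Since (c)_k = (c)_i (c+i)_(k-i), each reciprocal Pochhammer symbol is a complementary
  one over (c)_k. All of these are binomial coefficients with the same upper argument c + k - 1, so
  Vandermonde's identity sums them.\<close>

lemma pochhammer_convolution:
  fixes c :: real
  assumes c: "c > 0"
  shows "(\<Sum>i\<le>k. 1 / (fact i * pochhammer c i) * (1 / (fact (k - i) * pochhammer c (k - i))))
    = pochhammer (2 * c + real k - 1) k / (fact k * (pochhammer c k)\<^sup>2)"
proof -
  let ?x = "c + real k - 1"
  have pp: "pochhammer c n > 0" for n using c by (rule pochhammer_pos)
  have "1 / (fact i * pochhammer c i) * (1 / (fact (k - i) * pochhammer c (k - i)))
      = (?x gchoose i) * (?x gchoose (k - i)) / (pochhammer c k)\<^sup>2" if "i \<le> k" for i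
  proof -
    have 1: "pochhammer c k = pochhammer c i * pochhammer (c + real i) (k - i)"
      using pochhammer_product[OF that, of c] by simp
    have 2: "pochhammer c k = pochhammer c (k - i) * pochhammer (c + real (k - i)) i"
      using pochhammer_product[of "k - i" k c] that by simp
    have 3: "?x gchoose (k - i) = pochhammer (c + real i) (k - i) / fact (k - i)"
      using that by (simp add: gbinomial_pochhammer' of_nat_diff algebra_simps)
    have 4: "?x gchoose i = pochhammer (c + real (k - i)) i / fact i"
      using that by (simp add: gbinomial_pochhammer' of_nat_diff algebra_simps)
    have "(?x gchoose i) * (?x gchoose (k - i)) / (pochhammer c k)\<^sup>2
       = (pochhammer (c + real (k - i)) i / pochhammer c k) * (pochhammer (c + real i) (k - i) / pochhammer c k) / (fact i * fact (k - i))"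
      unfolding 3 4 by (simp add: power2_eq_square)
    also have "pochhammer (c + real (k - i)) i / pochhammer c k = 1 / pochhammer c (k - i)"
      using pp[of k] unfolding 2 by (auto simp: divide_simps)
    also have "pochhammer (c + real i) (k - i) / pochhammer c k = 1 / pochhammer c i"
      using pp[of k] unfolding 1 by (auto simp: divide_simps)
    finally show ?thesis by (simp add: mult_ac)
  qed
  then have "(\<Sum>i\<le>k. 1 / (fact i * pochhammer c i) * (1 / (fact (k - i) * pochhammer c (k - i))))
    = (\<Sum>i\<le>k. (?x gchoose i) * (?x gchoose (k - i)) / (pochhammer c k)\<^sup>2)"
    by (intro sum.cong) auto
  also have "\<dots> = (\<Sum>i\<in>{0..k}. (?x gchoose i) * (?x gchoose (k - i))) / (pochhammer c k)\<^sup>2"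
    by (simp add: sum_divide_distrib atMost_atLeast0)
  also have "\<dots> = ((?x + ?x) gchoose k) / (pochhammer c k)\<^sup>2"
    unfolding gbinomial_Vandermonde ..
  also have "(?x + ?x) gchoose k = pochhammer (2 * c + real k - 1) k / fact k"
    by (simp add: gbinomial_pochhammer' algebra_simps)
  finally show ?thesis by simp
qed

text \<open>(2\<delta>)_(2k) is computed twice: split in the middle as (2\<delta>)_k
  (2\<delta>+k)_k, and by duplication as 4^k (\<delta>)_k (\<delta>+1/2)_k.\<close>

lemma hyp01_square_coeff:
  fixes \<delta> :: real
  assumes \<delta>: "\<delta> > 0"
  shows "pochhammer (2 * (\<delta> + 1/2) + real k - 1) k / (fact k * (pochhammer (\<delta> + 1/2) k)\<^sup>2)
    = 4 ^ k * pochhammer \<delta> k / (fact k * pochhammer (\<delta> + 1/2) k * pochhammer (2 * \<delta>) k)"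
proof -
  have pp: "pochhammer x n > 0" if "x > 0" for x :: real and n using that by (rule pochhammer_pos)
  have "pochhammer (2 * \<delta>) (2 * k) = pochhammer (2 * \<delta>) k * pochhammer (2 * \<delta> + real k) k"
    unfolding mult_2[of k] by (rule pochhammer_product')
  moreover have "pochhammer (2 * \<delta>) (2 * k) = 4 ^ k * pochhammer \<delta> k * pochhammer (\<delta> + 1/2) k"
    using pochhammer_double[of \<delta> k] by (simp add: power_mult)
  ultimately have A: "pochhammer (2 * \<delta> + real k) k = 4 ^ k * pochhammer \<delta> k * pochhammer (\<delta> + 1/2) k / pochhammer (2 * \<delta>) k"
    using pp[of "2 * \<delta>" k] \<delta> by (simp add: field_simps)
  have arg: "2 * (\<delta> + 1/2) + real k - 1 = 2 * \<delta> + real k" by simp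
  have alg: "X * P1 / P2 / (F * P1\<^sup>2) = X / (F * P1 * P2)" if "P1 > 0" "P2 > 0" "F > 0" for X P1 P2 F :: real
    using that by (simp add: divide_simps power2_eq_square)
  show ?thesis unfolding arg A by (rule alg) (use \<delta> in \<open>auto intro!: pp\<close>)
qed

text \<open>The Cauchy product of the series with itself. With c = \<delta> + 1/2 it is the
  classical formula by which the square of 0F1(; c; z) is 1F2(c - 1/2; c, 2c - 1; 4z).\<close>

lemma hyp01_square_sums:
  fixes \<delta> :: real
  assumes \<delta>: "\<delta> > 1/2"
  shows "(\<lambda>k. 4 ^ k * pochhammer \<delta> k / (fact k * pochhammer (\<delta> + 1/2) k * pochhammer (2 * \<delta>) k) * z ^ k)
    sums (hyp01 (\<delta> + 1/2) z)\<^sup>2"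
proof -
  let ?c = "\<delta> + 1/2"
  have c: "?c \<ge> 1" using \<delta> by simp
  let ?a = "\<lambda>k. 1 / (fact k * pochhammer ?c k)"
  have "(\<lambda>k. \<Sum>i\<le>k. (?a i * z ^ i) * (?a (k - i) * z ^ (k - i))) sums (hyp01 ?c z * hyp01 ?c z)"
    unfolding hyp01_def by (rule Cauchy_product_sums) (rule hyp01_summable[OF c])+
  moreover have "(\<Sum>i\<le>k. (?a i * z ^ i) * (?a (k - i) * z ^ (k - i)))
    = 4 ^ k * pochhammer \<delta> k / (fact k * pochhammer ?c k * pochhammer (2 * \<delta>) k) * z ^ k" for k
  proof -
    have "(?a i * z ^ i) * (?a (k - i) * z ^ (k - i)) = ?a i * ?a (k - i) * z ^ k" if "i \<le> k" for i
    proof -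
      have "z ^ k = z ^ i * z ^ (k - i)" using that by (simp flip: power_add)
      then show ?thesis by (simp only: mult_ac)
    qed
    then have "(\<Sum>i\<le>k. (?a i * z ^ i) * (?a (k - i) * z ^ (k - i))) = (\<Sum>i\<le>k. ?a i * ?a (k - i) * z ^ k)"
      by (intro sum.cong) auto
    also have "\<dots> = (\<Sum>i\<le>k. ?a i * ?a (k - i)) * z ^ k" by (rule sum_distrib_right[symmetric])
    also have "(\<Sum>i\<le>k. ?a i * ?a (k - i)) = pochhammer (2 * ?c + real k - 1) k / (fact k * (pochhammer ?c k)\<^sup>2)"
      using \<delta> by (intro pochhammer_convolution) simp
    also have "\<dots> = 4 ^ k * pochhammer \<delta> k / (fact k * pochhammer ?c k * pochhammer (2 * \<delta>) k)"
      using \<delta> by (intro hyp01_square_coeff) simp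
    finally show ?thesis .
  qed
  ultimately show ?thesis by (simp add: power2_eq_square)
qed

section \<open>The integral representation of \<open>Q\<close>\<close>

lemma Beta_shift:
  fixes a b :: real
  assumes "a > 0" "b > 0"
  shows "Beta (a + real k) b = Beta a b * pochhammer a k / pochhammer (a + b) k"
proof -
  have nn: "x > 0 \<Longrightarrow> x \<notin> \<int>\<^sub>\<le>\<^sub>0" for x :: real by (auto elim!: nonpos_Ints_cases)
  have 1: "Gamma (a + real k) = pochhammer a k * Gamma a"
    using pochhammer_Gamma[OF nn[OF assms(1)], of k] Gamma_real_pos[OF assms(1)] by simp
  have 2: "Gamma (a + b + real k) = pochhammer (a + b) k * Gamma (a + b)"
  proof -
    have ab: "a + b > 0" using assms by simp
    show ?thesis using pochhammer_Gamma[OF nn[OF ab], of k] Gamma_real_pos[OF ab] by simp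
  qed
  have 3: "a + real k + b = a + b + real k" by simp
  show ?thesis unfolding Beta_def 3 1 2 by (simp add: mult_ac)
qed

abbreviation Q_coeff :: "real \<Rightarrow> nat \<Rightarrow> real" where
  "Q_coeff \<delta> k \<equiv> pochhammer \<delta> k / (fact k * pochhammer (2 * \<delta>) k * pochhammer (2 * \<delta> + 1 / 2) k)"

text \<open>Equals Gamma(\<delta>+1/2) (x/2)^(1/2-\<delta>) J_(\<delta>-1/2)(x) for x > 0,
  normalised to be 1 at x = 0.\<close>

abbreviation bessel_j :: "real \<Rightarrow> real \<Rightarrow> real" where
  "bessel_j \<delta> x \<equiv> hyp01 (\<delta> + 1/2) (- x\<^sup>2 / 4)"

text \<open>A Beta density in u^2. Its moment of order 2k is Beta(\<delta>+1/2+k, \<delta>) / 2,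
  whose ratios replace the lower parameter \<delta>+1/2 of the series of j^2 by the 2\<delta>+1/2 of
  \<open>Q\<close>.\<close>

definition Q_weight :: "real \<Rightarrow> real \<Rightarrow> real" where
  "Q_weight \<delta> u = indicator {0..1} u * (u powr (2 * \<delta>) * (1 - u\<^sup>2) powr (\<delta> - 1))"

lemma Q_weight_nonneg: "Q_weight \<delta> u \<ge> 0"
  by (simp add: Q_weight_def)

lemma measurable_Q_weight [measurable]: "Q_weight \<delta> \<in> borel_measurable borel"
  unfolding Q_weight_def[abs_def] by measurable

lemma Q_weight_moment:
  assumes \<delta>: "\<delta> > 1/2"
  shows "integrable lborel (\<lambda>u. Q_weight \<delta> u * u ^ (2 * k))"
    and "(LBINT u. Q_weight \<delta> u * u ^ (2 * k)) = Beta (\<delta> + 1/2 + real k) \<delta> / 2"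
proof -
  let ?a = "\<delta> + 1/2 + real k"
  have a: "?a > 0" using \<delta> by simp
  have B: "Beta ?a \<delta> > 0" using Gamma_real_pos[of ?a] Gamma_real_pos[of \<delta>] Gamma_real_pos[of "?a + \<delta>"] \<delta> a by (simp add: Beta_def)
  have "(\<integral>\<^sup>+u. ennreal (Q_weight \<delta> u * u ^ (2 * k)) \<partial>lborel)
    = (\<integral>\<^sup>+u. ennreal (u powr (2 * ?a - 1) * (1 - u\<^sup>2) powr (\<delta> - 1)) * indicator {0..1} u \<partial>lborel)"
  proof (rule nn_integral_cong_AE)
    have "AE u in lborel. u \<noteq> (0::real)" by (rule AE_lborel_singleton)
    then show "AE u in lborel. ennreal (Q_weight \<delta> u * u ^ (2 * k)) = ennreal (u powr (2 * ?a - 1) * (1 - u\<^sup>2) powr (\<delta> - 1)) * indicator {0..1} u"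
    proof eventually_elim
      case (elim u)
      have "u powr (2 * \<delta>) * u ^ (2 * k) = u powr (2 * ?a - 1)" if "u > 0"
      proof -
        have "u ^ (2 * k) = u powr (real (2 * k))" using powr_realpow[OF that, of "2 * k"] by simp
        then have "u powr (2 * \<delta>) * u ^ (2 * k) = u powr (2 * \<delta> + real (2 * k))" by (simp only: powr_add)
        then show ?thesis by (simp add: algebra_simps)
      qed
      then show ?case using elim by (auto simp: Q_weight_def mult_ac split: split_indicator)
    qed
  qed
  also have "\<dots> = ennreal (Beta ?a \<delta> / 2)"
    by (rule Beta_nn_integral_square) (use \<delta> a in auto)
  finally have "integrable lborel (\<lambda>u. Q_weight \<delta> u * u ^ (2 * k)) \<and> (LBINT u. Q_weight \<delta> u * u ^ (2 * k)) = Beta ?a \<delta> / 2"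
    using B by (subst (asm) nn_integral_eq_integrable)
      (auto intro!: mult_nonneg_nonneg zero_le_even_power simp: Q_weight_nonneg)
  then show "integrable lborel (\<lambda>u. Q_weight \<delta> u * u ^ (2 * k))"
    and "(LBINT u. Q_weight \<delta> u * u ^ (2 * k)) = Beta ?a \<delta> / 2" by auto
qed

text \<open>The argument r u / 2 absorbs the 4^k of the square series: 4^k (- r^2 u^2 / 16)^k = (-
  r^2 / 4)^k u^(2k). Integration of each term against the weight then gives the coefficients of
  \<open>Q\<close>.\<close>

lemma Q_integral:
  assumes \<delta>: "\<delta> > 1/2"
  shows "Q \<delta> r = 2 / Beta (\<delta> + 1/2) \<delta> * (LBINT u. Q_weight \<delta> u * (bessel_j \<delta> (r * u / 2))\<^sup>2)"
    and "integrable lborel (\<lambda>u. Q_weight \<delta> u * (bessel_j \<delta> (r * u / 2))\<^sup>2)"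
proof -
  let ?I = "LBINT u. Q_weight \<delta> u * (bessel_j \<delta> (r * u / 2))\<^sup>2"
  let ?B = "Beta (\<delta> + 1/2) \<delta>"
  have B: "?B > 0"
    using Gamma_real_pos[of "\<delta> + 1/2"] Gamma_real_pos[of \<delta>] Gamma_real_pos[of "\<delta> + 1/2 + \<delta>"] \<delta> by (simp add: Beta_def)
  define b where "b k = 4 ^ k * pochhammer \<delta> k / (fact k * pochhammer (\<delta> + 1/2) k * pochhammer (2 * \<delta>) k)" for k
  have pp: "pochhammer x n > 0" if "x > 0" for x :: real and n using that by (rule pochhammer_pos)
  have b0: "b k \<ge> 0" for k unfolding b_def
    using \<delta> by (intro divide_nonneg_nonneg mult_nonneg_nonneg less_imp_le[OF pp]) auto
  define f where "f k u = b k * (- r\<^sup>2 / 16) ^ k * (Q_weight \<delta> u * u ^ (2 * k))" for k u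
  have fi: "integrable lborel (f k)" for k
    unfolding f_def by (intro integrable_mult_right Q_weight_moment \<delta>)
  have fs: "(\<lambda>k. f k u) sums (Q_weight \<delta> u * (bessel_j \<delta> (r * u / 2))\<^sup>2)" for u
  proof -
    have "(\<lambda>k. b k * (- (r * u / 2)\<^sup>2 / 4) ^ k) sums (bessel_j \<delta> (r * u / 2))\<^sup>2"
      unfolding b_def by (rule hyp01_square_sums[OF \<delta>])
    then have "(\<lambda>k. Q_weight \<delta> u * (b k * (- (r * u / 2)\<^sup>2 / 4) ^ k)) sums (Q_weight \<delta> u * (bessel_j \<delta> (r * u / 2))\<^sup>2)"
      by (rule sums_mult)
    moreover have "- (r * u / 2)\<^sup>2 / 4 = (- r\<^sup>2 / 16) * u\<^sup>2" by (simp add: power_mult_distrib power_divide)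
    moreover have "Q_weight \<delta> u * (b k * ((- r\<^sup>2 / 16) * u\<^sup>2) ^ k) = f k u" for k
      unfolding f_def power_mult[of u] power_mult_distrib[of _ "u\<^sup>2"] by (simp only: mult_ac)
    ultimately show ?thesis by (simp only:)
  qed
  have fn: "norm (f k u) \<le> (b k * (r\<^sup>2 / 16) ^ k) * Q_weight \<delta> u" for k u
  proof -
    have "norm (f k u) = (b k * (r\<^sup>2 / 16) ^ k) * (Q_weight \<delta> u * u ^ (2 * k))"
      using b0[of k] Q_weight_nonneg[of \<delta> u]
      by (simp add: f_def abs_mult power_abs power_mult power_divide)
    also have "\<dots> \<le> (b k * (r\<^sup>2 / 16) ^ k) * Q_weight \<delta> u"
    proof (intro mult_left_mono)
      show "Q_weight \<delta> u * u ^ (2 * k) \<le> Q_weight \<delta> u"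
      proof (cases "u \<in> {0..1}")
        case True
        then show ?thesis using Q_weight_nonneg by (intro mult_left_le power_le_one) auto
      qed (simp add: Q_weight_def)
    qed (use b0 in auto)
    finally show ?thesis .
  qed
  have sb: "summable (\<lambda>k. b k * x ^ k)" for x
    using hyp01_square_sums[OF \<delta>, of x] unfolding b_def by (rule sums_summable)
  have Wi: "integrable lborel (Q_weight \<delta>)" using Q_weight_moment(1)[OF \<delta>, of 0] by simp
  have AEs: "AE u in lborel. summable (\<lambda>k. norm (f k u))"
  proof (rule AE_I2)
    fix u
    show "summable (\<lambda>k. norm (f k u))"
    proof (rule summable_comparison_test'[where N=0])
      show "summable (\<lambda>k. (b k * (r\<^sup>2 / 16) ^ k) * Q_weight \<delta> u)" by (intro summable_mult2 sb)
    qed (use fn in simp)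
  qed
  have sn: "summable (\<lambda>k. LBINT u. norm (f k u))"
  proof (rule summable_comparison_test'[where N=0])
    show "summable (\<lambda>k. (b k * (r\<^sup>2 / 16) ^ k) * (LBINT u. Q_weight \<delta> u))"
      by (intro summable_mult2 sb)
    show "norm (LBINT u. norm (f k u)) \<le> (b k * (r\<^sup>2 / 16) ^ k) * (LBINT u. Q_weight \<delta> u)" for k
    proof -
      have "norm (LBINT u. norm (f k u)) = (LBINT u. norm (f k u))"
        by (simp add: Bochner_Integration.integral_nonneg)
      also have "\<dots> \<le> (LBINT u. (b k * (r\<^sup>2 / 16) ^ k) * Q_weight \<delta> u)"
        by (intro integral_mono integrable_norm fi integrable_mult_right Wi fn)
      finally show ?thesis by simp
    qed
  qed
  have eq: "(\<lambda>u. \<Sum>k. f k u) = (\<lambda>u. Q_weight \<delta> u * (bessel_j \<delta> (r * u / 2))\<^sup>2)"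
    by (intro ext sums_unique[symmetric] fs)
  show "integrable lborel (\<lambda>u. Q_weight \<delta> u * (bessel_j \<delta> (r * u / 2))\<^sup>2)"
    using integrable_suminf[OF fi AEs sn] unfolding eq .
  have "(\<lambda>k. LBINT u. f k u) sums ?I"
    using sums_integral[OF fi AEs sn] unfolding eq .
  moreover have "(LBINT u. f k u) = ?B / 2 * (Q_coeff \<delta> k * (- r\<^sup>2 / 4) ^ k)" for k
  proof -
    have p4: "(- r\<^sup>2 / 4) ^ k = 4 ^ k * (- r\<^sup>2 / 16) ^ k" by (simp flip: power_mult_distrib)
    have e: "\<delta> + 1/2 + \<delta> = 2 * \<delta> + 1/2" by simp
    have "(LBINT u. f k u) = b k * (- r\<^sup>2 / 16) ^ k * (Beta (\<delta> + 1/2 + real k) \<delta> / 2)"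
      unfolding f_def by (simp add: Q_weight_moment(2)[OF \<delta>])
    also have "Beta (\<delta> + 1/2 + real k) \<delta> = ?B * pochhammer (\<delta> + 1/2) k / pochhammer (2 * \<delta> + 1/2) k"
      using Beta_shift[of "\<delta> + 1/2" \<delta> k] \<delta> unfolding e by simp
    finally have I: "(LBINT u. f k u) = b k * (- r\<^sup>2 / 16) ^ k * (?B * pochhammer (\<delta> + 1/2) k / pochhammer (2 * \<delta> + 1/2) k / 2)" .
    have alg: "a * D / (F * P1 * P2) * R * (B * P1 / P3 / 2) = B / 2 * (D / (F * P2 * P3) * (a * R))"
      if "P1 > 0" "P2 > 0" "P3 > 0" "F > 0" for a D F P1 P2 P3 R B :: real
      using that by (simp add: divide_simps)
    show ?thesis unfolding I p4 b_def by (rule alg) (use \<delta> in \<open>auto intro!: pp\<close>)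
  qed
  ultimately have "(\<lambda>k. ?B / 2 * (Q_coeff \<delta> k * (- r\<^sup>2 / 4) ^ k))
    sums ?I" by simp
  then have "(\<lambda>k. 2 / ?B * (?B / 2 * (Q_coeff \<delta> k * (- r\<^sup>2 / 4) ^ k)))
    sums (2 / ?B * ?I)" by (rule sums_mult)
  then have "(\<lambda>k. Q_coeff \<delta> k * (- r\<^sup>2 / 4) ^ k)
    sums (2 / ?B * ?I)"
    using B by simp
  then show "Q \<delta> r = 2 / ?B * ?I"
    unfolding Q_series by (rule sums_unique[symmetric])
qed

section \<open>Two-sided bounds for Q\<close>

text \<open>The energy \<open>E = w'\<^sup>2 + w\<^sup>2\<close> satisfies \<open>|E'| \<le> |\<kappa>| E / x\<^sup>2\<close>, so \<open>E exp (- |\<kappa>| / x)\<close> increases and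
  \<open>E exp (|\<kappa>| / x)\<close> decreases.\<close>

lemma oscillator_energy_bounds:
  fixes w w' :: "real \<Rightarrow> real"
  assumes x0: "x0 > 0" and w: "\<And>x. x \<ge> x0 \<Longrightarrow> (w has_real_derivative w' x) (at x)"
    and w': "\<And>x. x \<ge> x0 \<Longrightarrow> (w' has_real_derivative (\<kappa> / x\<^sup>2 - 1) * w x) (at x)"
    and nz: "w x0 \<noteq> 0"
  obtains e0 e1 where "e0 > 0" "\<And>x. x \<ge> x0 \<Longrightarrow> e0 \<le> (w' x)\<^sup>2 + (w x)\<^sup>2" "\<And>x. x \<ge> x0 \<Longrightarrow> (w' x)\<^sup>2 + (w x)\<^sup>2 \<le> e1"
proof -
  define E where "E x = (w' x)\<^sup>2 + (w x)\<^sup>2" for x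
  have E0: "E x \<ge> 0" for x by (simp add: E_def)
  \<comment> \<open>The terms - 2 w w' and 2 w w' cancel. What is left carries 1 / x^2, which is
    integrable at infinity, so the energy can change only by a bounded factor.\<close>
  have dE: "(E has_real_derivative 2 * \<kappa> * (w x * w' x) / x\<^sup>2) (at x)" if "x \<ge> x0" for x
    unfolding E_def using that x0
    by (auto intro!: derivative_eq_intros w w' simp: field_simps)
  have bd: "\<bar>2 * \<kappa> * (w x * w' x) / x\<^sup>2\<bar> \<le> \<bar>\<kappa>\<bar> / x\<^sup>2 * E x" for x
  proof -
    have "2 * \<bar>w x * w' x\<bar> \<le> E x"
      using sum_squares_bound[of "\<bar>w x\<bar>" "\<bar>w' x\<bar>"] by (simp add: E_def abs_mult)
    then have "(\<bar>\<kappa>\<bar> / x\<^sup>2) * (2 * \<bar>w x * w' x\<bar>) \<le> (\<bar>\<kappa>\<bar> / x\<^sup>2) * E x"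
      by (rule mult_left_mono) simp
    then show ?thesis by (simp add: abs_mult mult_ac)
  qed
  have dx: "((\<lambda>x. exp (c / x)) has_real_derivative exp (c / x) * (- c / x\<^sup>2)) (at x)" if "x \<ge> x0" for x c :: real
    using that x0 by (auto intro!: derivative_eq_intros simp: power2_eq_square)
  have low: "E x0 * exp (- \<bar>\<kappa>\<bar> / x0) \<le> E x * exp (- \<bar>\<kappa>\<bar> / x)" if "x \<ge> x0" for x
  proof (rule DERIV_nonneg_imp_nondecreasing[OF that])
    fix y assume y: "x0 \<le> y"
    have "((\<lambda>x. E x * exp (- \<bar>\<kappa>\<bar> / x)) has_real_derivative
       2 * \<kappa> * (w y * w' y) / y\<^sup>2 * exp (- \<bar>\<kappa>\<bar> / y) + (exp (- \<bar>\<kappa>\<bar> / y) * (- (- \<bar>\<kappa>\<bar>) / y\<^sup>2)) * E y) (at y)"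
      by (rule DERIV_mult[OF dE[OF y] dx[OF y]])
    also have "2 * \<kappa> * (w y * w' y) / y\<^sup>2 * exp (- \<bar>\<kappa>\<bar> / y) + (exp (- \<bar>\<kappa>\<bar> / y) * (- (- \<bar>\<kappa>\<bar>) / y\<^sup>2)) * E y
      = exp (- \<bar>\<kappa>\<bar> / y) * (2 * \<kappa> * (w y * w' y) / y\<^sup>2 + \<bar>\<kappa>\<bar> / y\<^sup>2 * E y)" by (simp add: algebra_simps)
    finally have D: "((\<lambda>x. E x * exp (- \<bar>\<kappa>\<bar> / x)) has_real_derivative exp (- \<bar>\<kappa>\<bar> / y) * (2 * \<kappa> * (w y * w' y) / y\<^sup>2 + \<bar>\<kappa>\<bar> / y\<^sup>2 * E y)) (at y)" .
    moreover have "exp (- \<bar>\<kappa>\<bar> / y) * (2 * \<kappa> * (w y * w' y) / y\<^sup>2 + \<bar>\<kappa>\<bar> / y\<^sup>2 * E y) \<ge> 0" by (intro mult_nonneg_nonneg) (simp, use bd[of y] in linarith)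
    ultimately show "\<exists>z. ((\<lambda>x. E x * exp (- \<bar>\<kappa>\<bar> / x)) has_real_derivative z) (at y) \<and> 0 \<le> z" by blast
  qed
  have up: "E x * exp (\<bar>\<kappa>\<bar> / x) \<le> E x0 * exp (\<bar>\<kappa>\<bar> / x0)" if "x \<ge> x0" for x
  proof (rule DERIV_nonpos_imp_nonincreasing[OF that])
    fix y assume y: "x0 \<le> y"
    have "((\<lambda>x. E x * exp (\<bar>\<kappa>\<bar> / x)) has_real_derivative
       2 * \<kappa> * (w y * w' y) / y\<^sup>2 * exp (\<bar>\<kappa>\<bar> / y) + (exp (\<bar>\<kappa>\<bar> / y) * (- \<bar>\<kappa>\<bar> / y\<^sup>2)) * E y) (at y)"
      by (rule DERIV_mult[OF dE[OF y] dx[OF y]])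
    also have "2 * \<kappa> * (w y * w' y) / y\<^sup>2 * exp (\<bar>\<kappa>\<bar> / y) + (exp (\<bar>\<kappa>\<bar> / y) * (- \<bar>\<kappa>\<bar> / y\<^sup>2)) * E y
      = exp (\<bar>\<kappa>\<bar> / y) * (2 * \<kappa> * (w y * w' y) / y\<^sup>2 - \<bar>\<kappa>\<bar> / y\<^sup>2 * E y)" by (simp add: algebra_simps)
    finally have D: "((\<lambda>x. E x * exp (\<bar>\<kappa>\<bar> / x)) has_real_derivative exp (\<bar>\<kappa>\<bar> / y) * (2 * \<kappa> * (w y * w' y) / y\<^sup>2 - \<bar>\<kappa>\<bar> / y\<^sup>2 * E y)) (at y)" .
    moreover have "exp (\<bar>\<kappa>\<bar> / y) * (2 * \<kappa> * (w y * w' y) / y\<^sup>2 - \<bar>\<kappa>\<bar> / y\<^sup>2 * E y) \<le> 0" by (intro mult_nonneg_nonpos) (simp, use bd[of y] in linarith)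
    ultimately show "\<exists>z. ((\<lambda>x. E x * exp (\<bar>\<kappa>\<bar> / x)) has_real_derivative z) (at y) \<and> z \<le> 0" by blast
  qed
  show ?thesis
  proof (rule that[of "E x0 * exp (- \<bar>\<kappa>\<bar> / x0)" "E x0 * exp (\<bar>\<kappa>\<bar> / x0)"])
    have "E x0 > 0" unfolding E_def using nz by (simp add: add_nonneg_pos)
    then show "E x0 * exp (- \<bar>\<kappa>\<bar> / x0) > 0" by simp
    show "E x0 * exp (- \<bar>\<kappa>\<bar> / x0) \<le> (w' x)\<^sup>2 + (w x)\<^sup>2" if "x \<ge> x0" for x
    proof -
      have "exp (- \<bar>\<kappa>\<bar> / x) \<le> 1" using that x0 by simp
      then have "E x * exp (- \<bar>\<kappa>\<bar> / x) \<le> E x" using E0[of x] by (rule mult_left_le)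
      with low[OF that] show ?thesis by (simp add: E_def)
    qed
    show "(w' x)\<^sup>2 + (w x)\<^sup>2 \<le> E x0 * exp (\<bar>\<kappa>\<bar> / x0)" if "x \<ge> x0" for x
    proof -
      have "1 \<le> exp (\<bar>\<kappa>\<bar> / x)" using that x0 by simp
      then have "E x * 1 \<le> E x * exp (\<bar>\<kappa>\<bar> / x)" using E0[of x] by (rule mult_left_mono)
      with up[OF that] show ?thesis by (simp add: E_def)
    qed
  qed
qed

text \<open>Integrate \<open>(w w')' = E - (2 - \<kappa> / x\<^sup>2) w\<^sup>2 \<ge> e0 - 3 w\<^sup>2\<close>, where \<open>|w w'| \<le> E / 2\<close>.\<close>

lemma oscillator_integral_lower:
  fixes w w' :: "real \<Rightarrow> real"
  assumes x0: "x0 > 0" and w: "\<And>x. x \<ge> x0 \<Longrightarrow> (w has_real_derivative w' x) (at x)"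
    and w': "\<And>x. x \<ge> x0 \<Longrightarrow> (w' has_real_derivative (\<kappa> / x\<^sup>2 - 1) * w x) (at x)"
    and e0: "\<And>x. x \<ge> x0 \<Longrightarrow> e0 \<le> (w' x)\<^sup>2 + (w x)\<^sup>2"
    and e1: "\<And>x. x \<ge> x0 \<Longrightarrow> (w' x)\<^sup>2 + (w x)\<^sup>2 \<le> e1"
    and s: "s > 0" and ab: "a \<le> b" "s * a \<ge> x0" "(s * a)\<^sup>2 \<ge> \<bar>\<kappa>\<bar>" and a0: "a \<ge> 0"
  shows "integral {a..b} (\<lambda>u. (w (s * u))\<^sup>2) \<ge> (e0 * (b - a) - e1 / s) / 3"
    and "continuous_on {a..b} (\<lambda>u. (w (s * u))\<^sup>2)"
proof -
  have su: "s * u \<ge> x0" "(s * u)\<^sup>2 \<ge> \<bar>\<kappa>\<bar>" if "u \<in> {a..b}" for u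
  proof -
    have "s * u \<ge> s * a" using that s by simp
    then show "s * u \<ge> x0" using ab by linarith
    have "(s * u)\<^sup>2 \<ge> (s * a)\<^sup>2" using \<open>s * u \<ge> s * a\<close> s a0 by (intro power_mono) auto
    then show "(s * u)\<^sup>2 \<ge> \<bar>\<kappa>\<bar>" using ab by linarith
  qed
  have wc: "((\<lambda>u. w (s * u)) has_real_derivative w' (s * u) * s) (at u within {a..b})" if "u \<in> {a..b}" for u
    by (rule DERIV_chain2[where f=w and g="\<lambda>u. s * u", OF w[OF su(1)[OF that]]]) (auto intro!: derivative_eq_intros)
  have w'c: "((\<lambda>u. w' (s * u)) has_real_derivative ((\<kappa> / (s * u)\<^sup>2 - 1) * w (s * u)) * s) (at u within {a..b})" if "u \<in> {a..b}" for u
    by (rule DERIV_chain2[where f=w' and g="\<lambda>u. s * u", OF w'[OF su(1)[OF that]]]) (auto intro!: derivative_eq_intros)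
  have cw: "continuous_on {a..b} (\<lambda>u. w (s * u))"
    using wc by (meson DERIV_continuous_on)
  show c2: "continuous_on {a..b} (\<lambda>u. (w (s * u))\<^sup>2)"
    by (intro continuous_intros cw)
  let ?P = "\<lambda>u. w (s * u) * w' (s * u)"
  let ?P' = "\<lambda>u. (w' (s * u) * s) * w' (s * u) + (((\<kappa> / (s * u)\<^sup>2 - 1) * w (s * u)) * s) * w (s * u)"
  have FTC: "(?P' has_integral ?P b - ?P a) {a..b}"
    by (rule fundamental_theorem_of_calculus[OF ab(1)])
       (use DERIV_mult[OF wc w'c] in \<open>auto simp: has_real_derivative_iff_has_vector_derivative[symmetric]\<close>)
  have I: "((\<lambda>u. s * (e0 - 3 * (w (s * u))\<^sup>2)) has_integral s * (e0 * (b - a) - 3 * integral {a..b} (\<lambda>u. (w (s * u))\<^sup>2))) {a..b}"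
  proof -
    have "((\<lambda>u. (w (s * u))\<^sup>2) has_integral integral {a..b} (\<lambda>u. (w (s * u))\<^sup>2)) {a..b}"
      by (intro integrable_integral integrable_continuous_interval c2)
    moreover have "((\<lambda>u. e0) has_integral e0 * (b - a)) {a..b}"
      using has_integral_const_real[of e0 a b] ab(1) by (simp add: mult.commute)
    ultimately show ?thesis by (intro has_integral_mult_right has_integral_diff)
  qed
  have le: "s * (e0 - 3 * (w (s * u))\<^sup>2) \<le> ?P' u" if u: "u \<in> {a..b}" for u
  proof -
    have "s * u > 0" using su(1)[OF u] x0 by linarith
    then have pos: "(s * u)\<^sup>2 > 0" by (rule zero_less_power)
    \<comment> \<open>This is the purpose of the condition (s a)^2 >= |\<kappa>|: the coefficient 2
      - \<kappa> / x^2 stays below 3.\<close>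
    have "\<bar>\<kappa> / (s * u)\<^sup>2\<bar> \<le> 1" using su(2)[OF u] pos by (simp add: divide_le_eq)
    then have "\<kappa> / (s * u)\<^sup>2 \<ge> - 1" by linarith
    then have "(- 2) * (w (s * u))\<^sup>2 \<le> (\<kappa> / (s * u)\<^sup>2 - 1) * (w (s * u))\<^sup>2" by (intro mult_right_mono) auto
    then have "e0 - 3 * (w (s * u))\<^sup>2 \<le> (w' (s * u))\<^sup>2 + (\<kappa> / (s * u)\<^sup>2 - 1) * (w (s * u))\<^sup>2"
      using e0[OF su(1)[OF u]] by linarith
    then have "s * (e0 - 3 * (w (s * u))\<^sup>2) \<le> s * ((w' (s * u))\<^sup>2 + (\<kappa> / (s * u)\<^sup>2 - 1) * (w (s * u))\<^sup>2)"
      using s by (intro mult_left_mono) auto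
    also have "\<dots> = ?P' u" by (simp add: algebra_simps power2_eq_square)
    finally show ?thesis .
  qed
  \<comment> \<open>2 |w w'| is at most the energy. The two boundary terms together contribute at
    most \<open>e1\<close>, and division by the chain-rule factor \<open>s\<close> makes this small
    for large \<open>s\<close>.\<close>
  have Pb: "\<bar>?P u\<bar> \<le> e1 / 2" if "u \<in> {a..b}" for u
    using sum_squares_bound[of "\<bar>w (s * u)\<bar>" "\<bar>w' (s * u)\<bar>"] e1[OF su(1)[OF that]] by (simp add: abs_mult)
  have "s * (e0 * (b - a) - 3 * integral {a..b} (\<lambda>u. (w (s * u))\<^sup>2)) \<le> ?P b - ?P a"
    by (rule has_integral_le[OF I FTC le])
  also have "\<dots> \<le> e1" using Pb[of a] Pb[of b] ab(1) by auto
  finally have "e0 * (b - a) - 3 * integral {a..b} (\<lambda>u. (w (s * u))\<^sup>2) \<le> e1 / s"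
    using s by (simp add: field_simps)
  then show "integral {a..b} (\<lambda>u. (w (s * u))\<^sup>2) \<ge> (e0 * (b - a) - e1 / s) / 3" by simp
qed

text \<open>The function j satisfies j'' + (2\<delta> / x) j' + j = 0; the factor x^\<delta> removes
  the first-order term (Liouville normal form) and creates the potential \<delta> (\<delta> - 1) /
  x^2.\<close>

lemma bessel_derivs:
  fixes \<delta> x :: real
  assumes \<delta>: "\<delta> > 1/2" and x: "x > 0"
  defines "c \<equiv> \<delta> + 1/2"
  defines "w \<equiv> \<lambda>x. x powr \<delta> * hyp01 c (- x\<^sup>2 / 4)"
  defines "w' \<equiv> \<lambda>x. \<delta> * x powr (\<delta> - 1) * hyp01 c (- x\<^sup>2 / 4) + x powr \<delta> * (hyp01 (c + 1) (- x\<^sup>2 / 4) / c * (- x / 2))"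
  shows "(w has_real_derivative w' x) (at x)"
    and "(w' has_real_derivative (\<delta> * (\<delta> - 1) / x\<^sup>2 - 1) * w x) (at x)"
proof -
  have c: "c \<ge> 1" "c + 1 \<ge> 1" "c + 1 + 1 = c + 2" using \<delta> by (simp_all add: c_def)
  have inner: "((\<lambda>x. - x\<^sup>2 / 4) has_real_derivative (- x / 2)) (at x)" for x :: real
    by (auto intro!: derivative_eq_intros)
  have h: "((\<lambda>x. hyp01 c (- x\<^sup>2 / 4)) has_real_derivative hyp01 (c + 1) (- x\<^sup>2 / 4) / c * (- x / 2)) (at x)" for x
    by (rule DERIV_chain2[OF DERIV_hyp01[OF c(1)] inner])
  have h1: "((\<lambda>x. hyp01 (c + 1) (- x\<^sup>2 / 4)) has_real_derivative hyp01 (c + 2) (- x\<^sup>2 / 4) / (c + 1) * (- x / 2)) (at x)" for x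
    using DERIV_chain2[OF DERIV_hyp01[OF c(2)] inner] unfolding c(3) .
  have p: "((\<lambda>x. x powr r) has_real_derivative r * x powr (r - 1)) (at x)" for r
    using x by (rule has_real_derivative_powr)
  have "(w has_real_derivative \<delta> * x powr (\<delta> - 1) * hyp01 c (- x\<^sup>2 / 4) + hyp01 (c + 1) (- x\<^sup>2 / 4) / c * (- x / 2) * x powr \<delta>) (at x)"
    unfolding w_def by (rule DERIV_mult[OF p h])
  then show "(w has_real_derivative w' x) (at x)" by (simp add: w'_def mult_ac)
  let ?X = "x powr \<delta>" and ?F = "hyp01 c (- x\<^sup>2 / 4)" and ?F1 = "hyp01 (c + 1) (- x\<^sup>2 / 4)" and ?F2 = "hyp01 (c + 2) (- x\<^sup>2 / 4)"
  have "(w' has_real_derivative (\<delta> * ((\<delta> - 1) * x powr (\<delta> - 1 - 1)) * ?F + ?F1 / c * (- x / 2) * (\<delta> * x powr (\<delta> - 1)))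
      + (\<delta> * x powr (\<delta> - 1) * (?F1 / c * (- x / 2)) + (?F2 / (c + 1) * (- x / 2) / c * (- x / 2) + (- 1 / 2) * (?F1 / c)) * ?X)) (at x)"
    unfolding w'_def
    by (rule DERIV_add DERIV_mult DERIV_cmult DERIV_cdivide p h h1)+ (auto intro!: derivative_eq_intros)
  moreover have X1: "x powr (\<delta> - 1) = ?X / x" using x by (simp add: powr_diff)
  moreover have X2: "x powr (\<delta> - 1 - 1) = ?X / x\<^sup>2" using x X1 by (simp add: powr_diff power2_eq_square)
  moreover have "(\<delta> * ((\<delta> - 1) * (?X / x\<^sup>2)) * ?F + ?F1 / c * (- x / 2) * (\<delta> * (?X / x)))
      + (\<delta> * (?X / x) * (?F1 / c * (- x / 2)) + (?F2 / (c + 1) * (- x / 2) / c * (- x / 2) + (- 1 / 2) * (?F1 / c)) * ?X)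
      = (\<delta> * (\<delta> - 1) / x\<^sup>2 - 1) * w x"
  proof -
    have ode: "?F = (- x\<^sup>2 / 4) / (c * (c + 1)) * ?F2 + ?F1" by (rule hyp01_ode[OF c(1), symmetric])
    \<comment> \<open>The differential equation of \<open>hyp01\<close> eliminates the function with
      parameter c + 2.\<close>
    have a1: "?F2 / (c + 1) * (- x / 2) / c * (- x / 2) = ?F1 - ?F"
      unfolding ode using c(1) by (simp add: field_simps power2_eq_square)
    have a2: "?F1 / c * (- x / 2) * (\<delta> * (?X / x)) = - (\<delta> / (2 * c)) * ?F1 * ?X" using x c(1) by (simp add: field_simps)
    have a3: "\<delta> * (?X / x) * (?F1 / c * (- x / 2)) = - (\<delta> / (2 * c)) * ?F1 * ?X" using x c(1) by (simp add: field_simps)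
    \<comment> \<open>Because 2 c = 2 \<delta> + 1, all terms with parameter c + 1 cancel.\<close>
    have a4: "2 * (\<delta> / (2 * c)) + 1 / (2 * c) = 1" 
    proof -
      have "2 * (\<delta> / (2 * c)) + 1 / (2 * c) = (2 * \<delta> + 1) / (2 * c)" by (simp add: add_divide_distrib)
      moreover have "2 * \<delta> + 1 = 2 * c" by (simp add: c_def)
      ultimately show ?thesis using c(1) by (simp only:) simp
    qed
    have "(\<delta> * ((\<delta> - 1) * (?X / x\<^sup>2)) * ?F + - (\<delta> / (2 * c)) * ?F1 * ?X)
      + (- (\<delta> / (2 * c)) * ?F1 * ?X + ((?F1 - ?F) + (- 1 / 2) * (?F1 / c)) * ?X)
      = \<delta> * (\<delta> - 1) / x\<^sup>2 * (?X * ?F) - (2 * (\<delta> / (2 * c)) + 1 / (2 * c)) * ?F1 * ?X + (?F1 - ?F) * ?X"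
      by (simp add: algebra_simps)
    also have "\<dots> = (\<delta> * (\<delta> - 1) / x\<^sup>2 - 1) * w x"
      unfolding a4 w_def by (simp add: algebra_simps)
    finally show ?thesis unfolding a1 a2 a3 .
  qed
  ultimately show "(w' has_real_derivative (\<delta> * (\<delta> - 1) / x\<^sup>2 - 1) * w x) (at x)"
    by (simp only:)
qed

text \<open>The coefficients are at most 1 / k!, because (\<delta>)_k <= (2\<delta>)_k and the other
  denominator symbol is at least 1; so \<open>Q\<close> is an entire function of r^2.\<close>

lemma Q_continuous:
  assumes \<delta>: "\<delta> > 1/2"
  shows "continuous_on UNIV (Q \<delta>)"
proof -
  let ?q = "\<lambda>k. Q_coeff \<delta> k"
  have pp: "pochhammer x n > 0" if "x > 0" for x :: real and n using that by (rule pochhammer_pos)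
  have "\<bar>?q k\<bar> \<le> 1 / fact k" for k
  proof -
    have 1: "pochhammer \<delta> k \<le> pochhammer (2 * \<delta>) k"
      unfolding pochhammer_prod using \<delta> by (intro prod_mono) auto
    have 2: "1 \<le> pochhammer (2 * \<delta> + 1 / 2) k" using \<delta> by (intro pochhammer_ge_1) simp
    have p: "pochhammer \<delta> k > 0" "pochhammer (2 * \<delta>) k > 0" using \<delta> by (auto intro!: pp)
    have "pochhammer \<delta> k * 1 \<le> pochhammer (2 * \<delta>) k * pochhammer (2 * \<delta> + 1 / 2) k"
      using 1 2 p by (intro mult_mono) auto
    then have "pochhammer \<delta> k / (pochhammer (2 * \<delta>) k * pochhammer (2 * \<delta> + 1 / 2) k) \<le> 1"
      using p 2 by (simp add: divide_le_eq)
    then have "1 / fact k * (pochhammer \<delta> k / (pochhammer (2 * \<delta>) k * pochhammer (2 * \<delta> + 1 / 2) k)) \<le> 1 / fact k * 1"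
      by (intro mult_left_mono) auto
    moreover have "?q k = 1 / fact k * (pochhammer \<delta> k / (pochhammer (2 * \<delta>) k * pochhammer (2 * \<delta> + 1 / 2) k))"
      by (simp add: mult_ac)
    moreover have "?q k \<ge> 0" using p 2 by (intro divide_nonneg_nonneg) auto
    ultimately show ?thesis by simp
  qed
  then have "summable (\<lambda>k. ?q k * z ^ k)" for z :: real
    by (rule summable_norm_cancel[OF summable_exp_bound])
  then have "isCont (\<lambda>x. \<Sum>n. ?q n * x ^ n) x" for x
    by (rule isCont_powser_converges_everywhere)
  then have "continuous_on UNIV (\<lambda>x. \<Sum>n. ?q n * x ^ n)"
    by (simp add: continuous_at_imp_continuous_on)
  then have "continuous_on UNIV (\<lambda>r. \<Sum>n. ?q n * (- r\<^sup>2 / 4) ^ n)"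
    by (rule continuous_on_compose2) (auto intro!: continuous_intros)
  then show ?thesis unfolding Q_series[abs_def] .
qed

lemma Beta_pos: "a > 0 \<Longrightarrow> b > 0 \<Longrightarrow> Beta a b > (0::real)"
  using Gamma_real_pos[of a] Gamma_real_pos[of b] Gamma_real_pos[of "a + b"] by (simp add: Beta_def)

text \<open>The representing integrand is nonnegative with a positive weight on (0, 1). Were the
  integral 0, j(r u / 2) would vanish almost everywhere there, hence by continuity at u = 0 too,
  where it is 1.\<close>

lemma Q_pos:
  assumes \<delta>: "\<delta> > 1/2"
  shows "Q \<delta> r > 0"
proof -
  let ?j = "\<lambda>u. bessel_j \<delta> (r * u / 2)"
  let ?I = "LBINT u. Q_weight \<delta> u * (?j u)\<^sup>2"
  have cj: "continuous_on UNIV ?j" using \<delta> by (intro continuous_intros) auto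
  have "?I \<ge> 0" by (intro Bochner_Integration.integral_nonneg mult_nonneg_nonneg Q_weight_nonneg) auto
  moreover have "?I \<noteq> 0"
  proof
    assume "?I = 0"
    then have "AE u in lborel. Q_weight \<delta> u * (?j u)\<^sup>2 = 0"
      using integral_nonneg_eq_0_iff_AE[OF Q_integral(2)[OF \<delta>, of r]] Q_weight_nonneg by auto
    then have "AE u in lborel. u \<in> {0<..<1} \<longrightarrow> ?j u = 0"
    proof eventually_elim
      case (elim u)
      show ?case
      proof
        assume u: "u \<in> {0<..<1}"
        then have "u\<^sup>2 < 1" by (simp add: abs_square_less_1)
        then have "Q_weight \<delta> u > 0" using u by (simp add: Q_weight_def)
        then show "?j u = 0" using elim by simp
      qed
    qed
    then have "AE u \<in> {0<..<1} in lebesgue. u \<in> {u. ?j u = 0}"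
      using AE_completion by auto
    moreover have cl: "closed {u. ?j u = 0}" using cj by (intro closed_Collect_eq) auto
    ultimately have "{0<..<1} \<subseteq> {u. ?j u = 0}"
      using mem_closed_if_AE_lebesgue_open[OF open_greaterThanLessThan] by blast
    \<comment> \<open>The contradiction sits at the end point 0, outside the open interval, hence
      the closure.\<close>
    then have "closure {0<..<1} \<subseteq> {u. ?j u = 0}" using cl by (rule closure_minimal)
    moreover have "(0::real) \<in> closure {0<..<1}" by simp
    ultimately have "0 \<in> {u. ?j u = 0}" by (rule subsetD)
    then show False by simp
  qed
  ultimately have "?I > 0" by simp
  then show ?thesis unfolding Q_integral(1)[OF \<delta>]
    using Beta_pos[of "\<delta> + 1/2" \<delta>] \<delta> by simp
qed

text \<open>For x > 0 a constant multiple of sqrt x J_(\<delta>-1/2)(x).\<close>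

definition bessel_w :: "real \<Rightarrow> real \<Rightarrow> real" where
  "bessel_w \<delta> x = x powr \<delta> * bessel_j \<delta> x"

text \<open>The prefactor and the u^(2\<delta>) of the weight combine to (r u / 2)^(2\<delta>) and
  turn j^2 into w^2. The decay of \<open>Q\<close> thereby becomes boundedness of a mean of w^2 from
  both sides.\<close>

lemma Q_scaled_integral:
  assumes \<delta>: "\<delta> > 1/2" and r: "r > 0"
  shows "(r / 2) powr (2 * \<delta>) * Q \<delta> r = 2 / Beta (\<delta> + 1/2) \<delta> *
      (LBINT u. indicator {0..1} u * (1 - u\<^sup>2) powr (\<delta> - 1) * (bessel_w \<delta> (r / 2 * u))\<^sup>2)"
    and "integrable lborel (\<lambda>u. indicator {0..1} u * (1 - u\<^sup>2) powr (\<delta> - 1) * (bessel_w \<delta> (r / 2 * u))\<^sup>2)"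
proof -
  have eq: "(r / 2) powr (2 * \<delta>) * (Q_weight \<delta> u * (bessel_j \<delta> (r * u / 2))\<^sup>2)
    = indicator {0..1} u * (1 - u\<^sup>2) powr (\<delta> - 1) * (bessel_w \<delta> (r / 2 * u))\<^sup>2" for u
  proof (cases "u \<in> {0..1}")
    case True
    have p: "(r / 2 * u) powr \<delta> = (r / 2) powr \<delta> * u powr \<delta>"
      by (rule powr_mult)
    have sq: "y powr (2 * \<delta>) = (y powr \<delta>)\<^sup>2" for y :: real
      by (simp only: mult_2 powr_add power2_eq_square)
    have e: "r * u / 2 = r / 2 * u" by simp
    show ?thesis
      unfolding Q_weight_def bessel_w_def e p sq power_mult_distrib by (simp only: mult_ac)
  qed (simp add: Q_weight_def)
  show "integrable lborel (\<lambda>u. indicator {0..1} u * (1 - u\<^sup>2) powr (\<delta> - 1) * (bessel_w \<delta> (r / 2 * u))\<^sup>2)"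
    unfolding eq[symmetric] by (intro integrable_mult_right Q_integral \<delta>)
  show "(r / 2) powr (2 * \<delta>) * Q \<delta> r = 2 / Beta (\<delta> + 1/2) \<delta> *
      (LBINT u. indicator {0..1} u * (1 - u\<^sup>2) powr (\<delta> - 1) * (bessel_w \<delta> (r / 2 * u))\<^sup>2)"
    unfolding eq[symmetric] Q_integral(1)[OF \<delta>, of r] by simp
qed

lemma bessel_energy:
  assumes \<delta>: "\<delta> > 1/2"
  obtains x0 w' e0 e1 where "x0 > 0" "e0 > 0"
    "\<And>x. x \<ge> x0 \<Longrightarrow> (bessel_w \<delta> has_real_derivative w' x) (at x)"
    "\<And>x. x \<ge> x0 \<Longrightarrow> (w' has_real_derivative (\<delta> * (\<delta> - 1) / x\<^sup>2 - 1) * bessel_w \<delta> x) (at x)"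
    "\<And>x. x \<ge> x0 \<Longrightarrow> e0 \<le> (w' x)\<^sup>2 + (bessel_w \<delta> x)\<^sup>2"
    "\<And>x. x \<ge> x0 \<Longrightarrow> (w' x)\<^sup>2 + (bessel_w \<delta> x)\<^sup>2 \<le> e1"
proof -
  \<comment> \<open>j(0) = 1, so j is positive just to the right of 0; w does not vanish at such a
    point and the initial energy is positive.\<close>
  obtain x0 :: real where x0: "x0 > 0" "bessel_j \<delta> x0 > 0"
  proof -
    have "continuous_on UNIV (\<lambda>x. bessel_j \<delta> x)"
      using \<delta> by (intro continuous_intros) auto
    then have "((\<lambda>x. bessel_j \<delta> x) \<longlongrightarrow> bessel_j \<delta> 0) (at 0 within UNIV)"
      unfolding continuous_on_def by blast
    then have "((\<lambda>x. bessel_j \<delta> x) \<longlongrightarrow> bessel_j \<delta> 0) (at_right 0)"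
      by (rule tendsto_within_subset) simp
    then have "((\<lambda>x. bessel_j \<delta> x) \<longlongrightarrow> 1) (at_right 0)"
      by simp
    then have "\<forall>\<^sub>F x in at_right 0. bessel_j \<delta> x > 0"
      by (rule order_tendstoD) simp
    moreover have "\<forall>\<^sub>F x in at_right 0. x > (0::real)" by (rule eventually_at_right_less)
    ultimately have "\<forall>\<^sub>F x in at_right 0. x > (0::real) \<and> bessel_j \<delta> x > 0"
      by eventually_elim simp
    then show ?thesis using that eventually_happens'[of "at_right (0::real)"] by auto
  qed
  define w' where "w' x = \<delta> * x powr (\<delta> - 1) * bessel_j \<delta> x
     + x powr \<delta> * (hyp01 (\<delta> + 1/2 + 1) (- x\<^sup>2 / 4) / (\<delta> + 1/2) * (- x / 2))" for x
  have d: "(bessel_w \<delta> has_real_derivative w' x) (at x)"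
    "(w' has_real_derivative (\<delta> * (\<delta> - 1) / x\<^sup>2 - 1) * bessel_w \<delta> x) (at x)" if "x \<ge> x0" for x
    using bessel_derivs[OF \<delta>, of x] x0 that unfolding bessel_w_def[abs_def] w'_def[abs_def] by auto
  have "bessel_w \<delta> x0 \<noteq> 0" using x0 by (simp add: bessel_w_def)
  from oscillator_energy_bounds[OF x0(1) d this] obtain e0 e1 where
    "e0 > 0" "\<And>x. x \<ge> x0 \<Longrightarrow> e0 \<le> (w' x)\<^sup>2 + (bessel_w \<delta> x)\<^sup>2"
    "\<And>x. x \<ge> x0 \<Longrightarrow> (w' x)\<^sup>2 + (bessel_w \<delta> x)\<^sup>2 \<le> e1" by blast
  with x0 d show ?thesis by (intro that[of x0 e0 w' e1])
qed

text \<open>w^2 is bounded on the whole half-line: by compactness up to \<open>x0\<close>, by the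
  energy beyond. The remaining weight (1 - u^2)^(\<delta>-1) is integrable, as \<delta> > 0.\<close>

lemma Q_scaled_upper:
  assumes \<delta>: "\<delta> > 1/2"
  obtains C where "\<And>r. r > 0 \<Longrightarrow> (r / 2) powr (2 * \<delta>) * Q \<delta> r \<le> C"
proof -
  obtain x0 w' e0 e1 where e: "x0 > 0"
    "\<And>x. x \<ge> x0 \<Longrightarrow> (w' x)\<^sup>2 + (bessel_w \<delta> x)\<^sup>2 \<le> e1" using bessel_energy[OF \<delta>] by metis
  have "continuous_on {0..x0} (\<lambda>x. (bessel_w \<delta> x)\<^sup>2)"
    unfolding bessel_w_def using \<delta> by (intro continuous_intros continuous_on_powr') auto
  then have "bounded ((\<lambda>x. (bessel_w \<delta> x)\<^sup>2) ` {0..x0})"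
    by (intro compact_imp_bounded compact_continuous_image) auto
  then obtain M where M: "\<And>x. x \<in> {0..x0} \<Longrightarrow> (bessel_w \<delta> x)\<^sup>2 \<le> M"
    unfolding bounded_iff by fastforce
  define W where "W = max M e1"
  have W: "(bessel_w \<delta> x)\<^sup>2 \<le> W" if "x \<ge> 0" for x
  proof (cases "x \<le> x0")
    case True
    then show ?thesis using M[of x] that by (simp add: W_def)
  next
    case False
    then have "(w' x)\<^sup>2 + (bessel_w \<delta> x)\<^sup>2 \<le> e1" using e(2)[of x] by simp
    then show ?thesis unfolding W_def using zero_le_power2[of "w' x"] by linarith
  qed
  let ?v = "\<lambda>u. indicator {0..1} u * (1 - u\<^sup>2) powr (\<delta> - 1) :: real"
  \<comment> \<open>The Beta integral with first parameter 1/2: the power of r then has exponent 0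
    and is 1 except at r = 0.\<close>
  have vi: "integrable lborel ?v"
  proof -
    have "(\<integral>\<^sup>+r. ennreal (r powr (2 * (1/2) - 1) * (1 - r\<^sup>2) powr (\<delta> - 1)) * indicator {0..1} r \<partial>lborel) = ennreal (Beta (1/2) \<delta> / 2)"
      by (rule Beta_nn_integral_square) (use \<delta> in auto)
    also have "(\<integral>\<^sup>+r. ennreal (r powr (2 * (1/2) - 1) * (1 - r\<^sup>2) powr (\<delta> - 1)) * indicator {0..1} r \<partial>lborel)
       = (\<integral>\<^sup>+r. ennreal (?v r) \<partial>lborel)"
      by (rule nn_integral_cong_AE, use AE_lborel_singleton[of 0] in eventually_elim) (auto split: split_indicator)
    finally show ?thesis by (intro integrableI_nonneg) auto
  qed
  show ?thesis
  proof (rule that)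
    fix r :: real assume r: "r > 0"
    have "(LBINT u. ?v u * (bessel_w \<delta> (r / 2 * u))\<^sup>2) \<le> (LBINT u. ?v u * W)"
    proof (rule integral_mono[OF Q_scaled_integral(2)[OF \<delta> r]])
      show "integrable lborel (\<lambda>u. ?v u * W)" using vi by (rule integrable_mult_left)
      show "?v u * (bessel_w \<delta> (r / 2 * u))\<^sup>2 \<le> ?v u * W" for u
        using W[of "r / 2 * u"] r by (cases "u \<in> {0..1}") (auto intro!: mult_left_mono)
    qed
    then show "(r / 2) powr (2 * \<delta>) * Q \<delta> r \<le> 2 / Beta (\<delta> + 1/2) \<delta> * (LBINT u. ?v u * W)"
      unfolding Q_scaled_integral(1)[OF \<delta> r] using Beta_pos[of "\<delta> + 1/2" \<delta>] \<delta> by (intro mult_left_mono) auto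
  qed
qed

text \<open>Only u in [1/4, 1/2] is kept: there r u / 2 >= r / 8 is large enough for the oscillator
  estimate, and the weight, which may vanish or blow up at u = 1, is bounded below.\<close>

lemma Q_scaled_lower:
  assumes \<delta>: "\<delta> > 1/2"
  obtains R c where "c > 0" "\<And>r. r \<ge> R \<Longrightarrow> r > 0 \<Longrightarrow> (r / 2) powr (2 * \<delta>) * Q \<delta> r \<ge> c"
proof -
  obtain x0 w' e0 e1 where e: "x0 > 0" "e0 > 0"
    "\<And>x. x \<ge> x0 \<Longrightarrow> (bessel_w \<delta> has_real_derivative w' x) (at x)"
    "\<And>x. x \<ge> x0 \<Longrightarrow> (w' has_real_derivative (\<delta> * (\<delta> - 1) / x\<^sup>2 - 1) * bessel_w \<delta> x) (at x)"
    "\<And>x. x \<ge> x0 \<Longrightarrow> e0 \<le> (w' x)\<^sup>2 + (bessel_w \<delta> x)\<^sup>2"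
    "\<And>x. x \<ge> x0 \<Longrightarrow> (w' x)\<^sup>2 + (bessel_w \<delta> x)\<^sup>2 \<le> e1" using bessel_energy[OF \<delta>] by metis
  define \<kappa> where "\<kappa> = \<delta> * (\<delta> - 1)"
  \<comment> \<open>3/4 is 1 - (1/2)^2, the least value of 1 - u^2 on the chosen interval; the
    absolute value in the exponent covers both signs of \<delta> - 1.\<close>
  define m where "m = (3/4::real) powr \<bar>\<delta> - 1\<bar>"
  have m: "m > 0" by (simp add: m_def)
  have e1: "e1 > 0" using e(2) e(5)[of x0] e(6)[of x0] by linarith
  have mb: "m \<le> (1 - u\<^sup>2) powr (\<delta> - 1)" if "u \<in> {1/4..1/2}" for u :: real
  proof -
    have "u\<^sup>2 \<le> (1/2)\<^sup>2" using that by (intro power_mono) auto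
    then have l: "3/4 \<le> 1 - u\<^sup>2" by (simp add: power2_eq_square)
    show ?thesis
    proof (cases "\<delta> \<ge> 1")
      case True
      then show ?thesis unfolding m_def using l by (simp add: powr_mono2)
    next
      case False
      have "m \<le> 1" unfolding m_def by (rule powr_le1) auto
      also have "1 \<le> (1 - u\<^sup>2) powr (\<delta> - 1)"
      proof -
        have "1 powr (\<delta> - 1) \<le> (1 - u\<^sup>2) powr (\<delta> - 1)"
          by (rule powr_mono2') (use False l in auto)
        then show ?thesis by simp
      qed
      finally show ?thesis .
    qed
  qed
  \<comment> \<open>The three entries give r/8 >= x0, (r/8)^2 >= |\<kappa>|, and 2 e1 / r <= e0 / 8.
    The last leaves (e0/4 - e0/8) / 3 = e0/24 in the oscillator estimate.\<close>
  define R where "R = Max {8 * x0, 8 * (\<bar>\<kappa>\<bar> + 1), 16 * e1 / e0}"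
  show ?thesis
  proof (rule that)
    show "2 / Beta (\<delta> + 1/2) \<delta> * (m * (e0 / 24)) > 0"
      using Beta_pos[of "\<delta> + 1/2" \<delta>] \<delta> m e(2) by simp
    fix r :: real assume rR: "r \<ge> R" and r: "r > 0"
    have r1: "r \<ge> 8 * x0" "r \<ge> 8 * (\<bar>\<kappa>\<bar> + 1)" "r \<ge> 16 * e1 / e0" using rR by (simp_all add: R_def)
    have k: "(r / 2 * (1/4))\<^sup>2 \<ge> \<bar>\<kappa>\<bar>"
    proof -
      have "(\<bar>\<kappa>\<bar> + 1)\<^sup>2 \<le> (r / 2 * (1/4))\<^sup>2" using r1(2) by (intro power_mono) auto
      moreover have "\<bar>\<kappa>\<bar> \<le> (\<bar>\<kappa>\<bar> + 1)\<^sup>2" by (simp add: power2_sum)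
      ultimately show ?thesis by linarith
    qed
    have x: "r / 2 * (1/4) \<ge> x0" using r1(1) by simp
    have s: "r / 2 > 0" using r by simp
    note L = oscillator_integral_lower[OF e(1) e(3) e(4)[folded \<kappa>_def] e(5,6) s _ x k, of "1/2"]
    have "e0 / 24 \<le> (e0 * (1/2 - 1/4) - e1 / (r / 2)) / 3"
    proof -
      have "e1 / (r / 2) \<le> e0 / 8" using r1(3) r e(2) by (simp add: field_simps)
      then show ?thesis by simp
    qed
    also have "\<dots> \<le> integral {1/4..1/2} (\<lambda>u. (bessel_w \<delta> (r / 2 * u))\<^sup>2)"
      by (rule L(1)) auto
    also have "\<dots> = (LBINT u:{1/4..1/2}. (bessel_w \<delta> (r / 2 * u))\<^sup>2)"
      by (intro set_borel_integral_eq_integral(2)[symmetric] borel_integrable_atLeastAtMost' L(2)) auto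
    finally have I: "e0 / 24 \<le> (LBINT u:{1/4..1/2}. (bessel_w \<delta> (r / 2 * u))\<^sup>2)" .
    have "m * (e0 / 24) \<le> m * (LBINT u:{1/4..1/2}. (bessel_w \<delta> (r / 2 * u))\<^sup>2)"
      using I m by (intro mult_left_mono) auto
    also have "\<dots> = (LBINT u. m * (indicator {1/4..1/2} u *\<^sub>R (bessel_w \<delta> (r / 2 * u))\<^sup>2))"
      by (simp add: set_lebesgue_integral_def)
    also have "\<dots> \<le> (LBINT u. indicator {0..1} u * (1 - u\<^sup>2) powr (\<delta> - 1) * (bessel_w \<delta> (r / 2 * u))\<^sup>2)"
    proof (rule integral_mono[OF _ Q_scaled_integral(2)[OF \<delta> r]])
      have "set_integrable lborel {1/4..1/2} (\<lambda>u. (bessel_w \<delta> (r / 2 * u))\<^sup>2)"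
        by (intro borel_integrable_atLeastAtMost' L(2)) auto
      then show "integrable lborel (\<lambda>u. m * (indicator {1/4..1/2} u *\<^sub>R (bessel_w \<delta> (r / 2 * u))\<^sup>2))"
        unfolding set_integrable_def by (rule integrable_mult_right)
      show "m * (indicator {1/4..1/2} u *\<^sub>R (bessel_w \<delta> (r / 2 * u))\<^sup>2)
        \<le> indicator {0..1} u * (1 - u\<^sup>2) powr (\<delta> - 1) * (bessel_w \<delta> (r / 2 * u))\<^sup>2" for u
        using mb[of u] by (auto split: split_indicator intro!: mult_right_mono)
    qed
    finally show "2 / Beta (\<delta> + 1/2) \<delta> * (m * (e0 / 24)) \<le> (r / 2) powr (2 * \<delta>) * Q \<delta> r"
      unfolding Q_scaled_integral(1)[OF \<delta> r] using Beta_pos[of "\<delta> + 1/2" \<delta>] \<delta> by (intro mult_left_mono) auto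
  qed
qed

text \<open>Up to \<open>S\<close> the product is continuous and positive, so compactness gives both
  bounds. Beyond \<open>S\<close> the powers of 1 + r^2 and r^2 / 4 are comparable and the scaled
  bounds apply.\<close>

lemma Q_two_sided_bounds:
  assumes \<delta>: "\<delta> > 1/2"
  obtains c C where "0 < c" "\<And>r. r \<ge> 0 \<Longrightarrow> c \<le> (1 + r\<^sup>2) powr \<delta> * Q \<delta> r"
    "\<And>r. r \<ge> 0 \<Longrightarrow> (1 + r\<^sup>2) powr \<delta> * Q \<delta> r \<le> C"
proof -
  obtain U where U: "\<And>r. r > 0 \<Longrightarrow> (r / 2) powr (2 * \<delta>) * Q \<delta> r \<le> U" using Q_scaled_upper[OF \<delta>] by blast
  obtain R L where L: "L > 0" "\<And>r. r \<ge> R \<Longrightarrow> r > 0 \<Longrightarrow> (r / 2) powr (2 * \<delta>) * Q \<delta> r \<ge> L"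
    using Q_scaled_lower[OF \<delta>] by metis
  define S where "S = max R 1"
  let ?g = "\<lambda>r. (1 + r\<^sup>2) powr \<delta> * Q \<delta> r"
  have cg: "continuous_on {0..S} ?g"
    using continuous_on_subset[OF Q_continuous[OF \<delta>], of "{0..S}"]
    by (intro continuous_intros) (auto simp: add_nonneg_eq_0_iff)
  have ne: "{0..S} \<noteq> {}" by (simp add: S_def)
  obtain a where a: "a \<in> {0..S}" "\<And>r. r \<in> {0..S} \<Longrightarrow> ?g a \<le> ?g r"
    using continuous_attains_inf[OF compact_Icc ne cg] by blast
  obtain b where b: "\<And>r. r \<in> {0..S} \<Longrightarrow> ?g r \<le> ?g b"
    using continuous_attains_sup[OF compact_Icc ne cg] by blast
  have pw: "(x / 2) powr (2 * \<delta>) = (x\<^sup>2 / 4) powr \<delta>" if "x > 0" for x :: real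
  proof -
    have "(x / 2) powr (2 * \<delta>) = ((x / 2) powr 2) powr \<delta>" by (simp only: powr_powr)
    also have "(x / 2) powr 2 = x\<^sup>2 / 4" using that by (simp add: powr_numeral power_divide)
    finally show ?thesis .
  qed
  have ga: "?g a > 0"
  proof -
    have "1 + a\<^sup>2 > 0" by (simp add: add_pos_nonneg)
    then show ?thesis using Q_pos[OF \<delta>, of a] by simp
  qed
  have big: "L \<le> ?g r" "?g r \<le> 8 powr \<delta> * U" if "r > S" for r
  proof -
    have r: "r > 0" "r \<ge> R" "r \<ge> 1" using that by (auto simp: S_def)
    have r2: "r\<^sup>2 \<ge> 1" using r by simp
    have Qp: "Q \<delta> r > 0" by (rule Q_pos[OF \<delta>])
    have "(r / 2) powr (2 * \<delta>) * Q \<delta> r \<le> ?g r"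
      unfolding pw[OF r(1)] using Qp \<delta> by (intro mult_right_mono powr_mono2) auto
    then show "L \<le> ?g r" using L(2)[OF r(2,1)] by linarith
    \<comment> \<open>For r >= 1 one has 1 + r^2 <= 2 r^2 = 8 (r^2 / 4), whence the constant
      8.\<close>
    have "(1 + r\<^sup>2) powr \<delta> \<le> (8 * (r\<^sup>2 / 4)) powr \<delta>"
      using \<delta> r2 by (intro powr_mono2) auto
    also have "\<dots> = 8 powr \<delta> * (r\<^sup>2 / 4) powr \<delta>" by (rule powr_mult)
    finally have "?g r \<le> (8 powr \<delta> * (r\<^sup>2 / 4) powr \<delta>) * Q \<delta> r"
      using Qp by (intro mult_right_mono) auto
    also have "\<dots> = 8 powr \<delta> * ((r / 2) powr (2 * \<delta>) * Q \<delta> r)" unfolding pw[OF r(1)] by simp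
    also have "\<dots> \<le> 8 powr \<delta> * U" using U[OF r(1)] by (intro mult_left_mono) auto
    finally show "?g r \<le> 8 powr \<delta> * U" .
  qed
  show ?thesis
  proof (rule that[of "min (?g a) L" "max (?g b) (8 powr \<delta> * U)"])
    show "0 < min (?g a) L" using ga L(1) by simp
    show "min (?g a) L \<le> ?g r" if "r \<ge> 0" for r
      using a(2)[of r] big(1)[of r] that by (cases "r \<le> S") (auto simp: min_le_iff_disj)
    show "?g r \<le> max (?g b) (8 powr \<delta> * U)" if "r \<ge> 0" for r
      using b[of r] big(2)[of r] that by (cases "r \<le> S") (auto simp: le_max_iff_disj)
  qed
qed

section \<open>The Fourier transform of the radial function\<close>

text \<open>The substitution \<open>s = t + v\<close> moves the singularity of the integrand of \<open>\<Psi>\<close> to \<open>v = 0\<close>, independently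
  of \<open>t\<close>, so that dominated convergence applies for negative exponents as well.\<close>

definition psi_shift :: "nat \<Rightarrow> real \<Rightarrow> real \<Rightarrow> real \<Rightarrow> real" where
  "psi_shift d \<delta> t v = indicator {0..1} v *
     ((v * (v + 2 * t)) powr (\<delta> - (real d + 1) / 2) * (max 0 (1 - t - v)) powr (2 * \<delta> - 1))"

lemma measurable_psi_shift [measurable]: "psi_shift d \<delta> t \<in> borel_measurable borel"
  unfolding psi_shift_def[abs_def] by measurable

lemma psi_shift_nonneg: "psi_shift d \<delta> t v \<ge> 0"
  by (simp add: psi_shift_def)

text \<open>A sum of two majorants, one for each sign of \<alpha> = \<delta> - (d+1)/2, valid for t
  up to \<open>K\<close>. For \<alpha> >= 0 the base is at most 1 + 2K; for \<alpha> < 0 it is at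
  least v^2, giving v^(2\<alpha>), which is integrable at 0 because \<delta> > d/2.\<close>

definition psi_dom :: "nat \<Rightarrow> real \<Rightarrow> real \<Rightarrow> real \<Rightarrow> real" where
  "psi_dom d \<delta> K v = indicator {0..1} v * ((1 + 2 * K) powr \<bar>\<delta> - (real d + 1) / 2\<bar> + v powr (2 * \<delta> - real d - 1))"

lemma integrable_psi_dom:
  assumes \<delta>: "\<delta> > real d / 2"
  shows "integrable lborel (psi_dom d \<delta> K)"
proof -
  have "set_integrable lborel {0..1} (\<lambda>v. v powr (2 * \<delta> - real d - 1) * (1 - v) powr (1 - 1))"
    by (rule integrable_Beta) (use \<delta> in auto)
  then have "integrable lborel (\<lambda>v. indicator {0..1} v * v powr (2 * \<delta> - real d - 1))"
    unfolding set_integrable_def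
    by (rule integrable_cong_AE_imp) (use AE_lborel_singleton[of 1] in \<open>auto split: split_indicator elim!: eventually_mono\<close>)
  moreover have "integrable lborel (\<lambda>v::real. indicator {0..1} v * (1 + 2 * K) powr \<bar>\<delta> - (real d + 1) / 2\<bar>)"
    by (intro integrable_mult_left integrable_real_indicator) auto
  ultimately show ?thesis
    unfolding psi_dom_def by (simp add: distrib_left)
qed

lemma psi_shift_le_dom:
  assumes \<delta>: "\<delta> > real d / 2" "d \<ge> 1" and t: "0 \<le> t" "t \<le> K"
  shows "psi_shift d \<delta> t v \<le> psi_dom d \<delta> K v"
proof (cases "v \<in> {0..1} \<and> v \<noteq> 0")
  case True
  let ?a = "\<delta> - (real d + 1) / 2"
  have v: "0 < v" "v \<le> 1" using True by auto
  have b: "(max 0 (1 - t - v)) powr (2 * \<delta> - 1) \<le> 1"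
    using v t \<delta> by (intro powr_le1) auto
  have "(v * (v + 2 * t)) powr ?a \<le> (1 + 2 * K) powr \<bar>?a\<bar> + v powr (2 * \<delta> - real d - 1)"
  proof (cases "?a \<ge> 0")
    case True
    have "v * (v + 2 * t) \<le> 1 * (1 + 2 * K)" using v t by (intro mult_mono) auto
    then have "(v * (v + 2 * t)) powr ?a \<le> (1 + 2 * K) powr ?a" using v t True by (intro powr_mono2) auto
    then show ?thesis using True by (simp add: add_increasing2)
  next
    case False
    have "v * v \<le> v * (v + 2 * t)" using v t by (intro mult_left_mono) auto
    then have "(v * (v + 2 * t)) powr ?a \<le> (v * v) powr ?a" using v False by (intro powr_mono2') auto
    also have "\<dots> = v powr (2 * ?a)" by (simp only: powr_mult powr_add[symmetric] mult_2)
    also have "2 * ?a = 2 * \<delta> - real d - 1" by (simp add: field_simps)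
    finally show ?thesis by (simp add: add_increasing)
  qed
  then have "(v * (v + 2 * t)) powr ?a * (max 0 (1 - t - v)) powr (2 * \<delta> - 1)
     \<le> ((1 + 2 * K) powr \<bar>?a\<bar> + v powr (2 * \<delta> - real d - 1)) * 1"
    using b by (intro mult_mono) auto
  then show ?thesis using True by (simp add: psi_shift_def psi_dom_def)
next
  case False
  then show ?thesis by (auto simp: psi_shift_def psi_dom_def split: split_indicator)
qed

lemma integrable_psi_shift:
  assumes "\<delta> > real d / 2" "d \<ge> 1" "0 \<le> t"
  shows "integrable lborel (psi_shift d \<delta> t)"
  by (rule Bochner_Integration.integrable_bound[OF integrable_psi_dom[OF assms(1), of t]])
     (use psi_shift_le_dom[OF assms order_refl] psi_shift_nonneg in \<open>auto simp: abs_of_nonneg intro!: AE_I2 order.trans[OF _ abs_ge_self]\<close>)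

text \<open>The cut-off at s = 1 is hidden in \<open>max 0\<close>, since \<open>0 powr\<close> any
  exponent is 0. In contrast to an indicator this is continuous in \<open>t\<close>, because
  2\<delta> - 1 > 0.\<close>

lemma psi_shift_eq:
  assumes \<delta>: "\<delta> > real d / 2" "d \<ge> 1" and t: "0 \<le> t"
  shows "psi_shift d \<delta> t v = indicator {t..1} (t + v) * (((t + v)\<^sup>2 - t\<^sup>2) powr (\<delta> - (real d + 1) / 2) * (1 - (t + v)) powr (2 * \<delta> - 1))"
proof -
  have "(t + v)\<^sup>2 - t\<^sup>2 = v * (v + 2 * t)" by (simp add: power2_eq_square algebra_simps)
  moreover have "max 0 (1 - t - v) = (if t + v \<le> 1 then 1 - (t + v) else 0)" by simp
  ultimately show ?thesis
    using t by (auto simp: psi_shift_def split: split_indicator)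
qed

lemma psi_kernel_integral:
  assumes \<delta>: "\<delta> > real d / 2" "d \<ge> 1" and t: "0 \<le> t"
  shows "integrable lborel (\<lambda>s. indicator {t..1} s * ((s\<^sup>2 - t\<^sup>2) powr (\<delta> - (real d + 1) / 2) * (1 - s) powr (2 * \<delta> - 1)))"
    and "(LBINT s. indicator {t..1} s * ((s\<^sup>2 - t\<^sup>2) powr (\<delta> - (real d + 1) / 2) * (1 - s) powr (2 * \<delta> - 1))) = (LBINT v. psi_shift d \<delta> t v)"
proof -
  let ?f = "\<lambda>s. indicator {t..1} s * ((s\<^sup>2 - t\<^sup>2) powr (\<delta> - (real d + 1) / 2) * (1 - s) powr (2 * \<delta> - 1))"
  have e: "?f (t + v) = psi_shift d \<delta> t v" for v
    using psi_shift_eq[OF assms] by simp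
  show "integrable lborel ?f"
    using integral_translate(1)[of ?f t] integrable_psi_shift[OF assms] unfolding e by simp
  show "(LBINT s. ?f s) = (LBINT v. psi_shift d \<delta> t v)"
    using integral_translate(2)[of ?f t] unfolding e by simp
qed

definition psi_const :: "nat \<Rightarrow> real \<Rightarrow> real" where
  "psi_const d \<delta> = 1 / Beta (2 * \<delta> - real d) (2 * \<delta>)"

lemma psi_const_pos: "\<delta> > real d / 2 \<Longrightarrow> psi_const d \<delta> > 0"
  unfolding psi_const_def using Beta_pos[of "2 * \<delta> - real d" "2 * \<delta>"] by simp

lemma Psi_radial_eq:
  assumes \<delta>: "\<delta> > real d / 2" "d \<ge> 1" and t: "0 \<le> t"
  shows "\<Psi>_radial d \<delta> t = psi_const d \<delta> * (LBINT v. psi_shift d \<delta> t v)"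
proof (cases "t \<le> 1")
  case True
  then show ?thesis
    unfolding psi_kernel_integral(2)[OF assms, symmetric]
    by (simp add: \<Psi>_radial_def psi_const_def set_lebesgue_integral_def mult_ac)
next
  case False
  then have "psi_shift d \<delta> t v = 0" for v
    by (auto simp: psi_shift_def split: split_indicator)
  then show ?thesis using False by (simp add: \<Psi>_radial_def)
qed

lemma Psi_radial_nonneg:
  assumes \<delta>: "\<delta> > real d / 2" "d \<ge> 1" and t: "0 \<le> t"
  shows "\<Psi>_radial d \<delta> t \<ge> 0"
  unfolding Psi_radial_eq[OF assms]
  using psi_const_pos[OF \<delta>(1)] by (intro mult_nonneg_nonneg Bochner_Integration.integral_nonneg psi_shift_nonneg) auto

text \<open>Dominated convergence with \<open>psi_dom\<close>, where \<open>K\<close> bounds the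
  convergent sequence. The absolute value extends the profile evenly to the line, which also gives
  Borel measurability there.\<close>

lemma continuous_Psi_radial:
  assumes \<delta>: "\<delta> > real d / 2" "d \<ge> 1"
  shows "continuous_on UNIV (\<lambda>t. \<Psi>_radial d \<delta> \<bar>t\<bar>)"
  unfolding continuous_on_sequentially comp_def
proof (intro ballI allI impI, elim conjE)
  fix X :: "nat \<Rightarrow> real" and t assume X: "X \<longlonglongrightarrow> t"
  have Xa: "(\<lambda>n. \<bar>X n\<bar>) \<longlonglongrightarrow> \<bar>t\<bar>" using X by (rule tendsto_rabs)
  obtain K where K: "\<And>n. \<bar>X n\<bar> \<le> K"
    using convergent_imp_Bseq[of X] X by (auto simp: convergent_def Bseq_def)
  have "(\<lambda>n. LBINT v. psi_shift d \<delta> \<bar>X n\<bar> v) \<longlonglongrightarrow> (LBINT v. psi_shift d \<delta> \<bar>t\<bar> v)"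
  proof (rule integral_dominated_convergence[where w="psi_dom d \<delta> K"])
    show "AE v in lborel. (\<lambda>n. psi_shift d \<delta> \<bar>X n\<bar> v) \<longlonglongrightarrow> psi_shift d \<delta> \<bar>t\<bar> v"
      using AE_lborel_singleton[of 0]
    proof eventually_elim
      case (elim v)
      show ?case
      proof (cases "v \<in> {0..1}")
        case True
        then have v: "v > 0" using elim by auto
        have "v * (v + 2 * \<bar>t\<bar>) \<noteq> 0" using v by auto
        then have 1: "(\<lambda>n. (v * (v + 2 * \<bar>X n\<bar>)) powr (\<delta> - (real d + 1) / 2)) \<longlonglongrightarrow> (v * (v + 2 * \<bar>t\<bar>)) powr (\<delta> - (real d + 1) / 2)"
          by (intro tendsto_powr tendsto_intros Xa)
        have 2: "(\<lambda>n. (max 0 (1 - \<bar>X n\<bar> - v)) powr (2 * \<delta> - 1)) \<longlonglongrightarrow> (max 0 (1 - \<bar>t\<bar> - v)) powr (2 * \<delta> - 1)"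
          by (rule tendsto_powr') (use \<delta> in \<open>auto intro!: tendsto_intros Xa always_eventually\<close>)
        show ?thesis unfolding psi_shift_def by (intro tendsto_mult tendsto_const 1 2)
      qed (simp add: psi_shift_def)
    qed
    show "AE v in lborel. norm (psi_shift d \<delta> \<bar>X n\<bar> v) \<le> psi_dom d \<delta> K v" for n
      using psi_shift_le_dom[OF \<delta> _ K] psi_shift_nonneg by (intro AE_I2) simp
  qed (use integrable_psi_dom \<delta> in auto)
  then have "(\<lambda>n. psi_const d \<delta> * (LBINT v. psi_shift d \<delta> \<bar>X n\<bar> v)) \<longlonglongrightarrow> psi_const d \<delta> * (LBINT v. psi_shift d \<delta> \<bar>t\<bar> v)"
    by (rule tendsto_mult_left)
  then show "(\<lambda>n. \<Psi>_radial d \<delta> \<bar>X n\<bar>) \<longlonglongrightarrow> \<Psi>_radial d \<delta> \<bar>t\<bar>"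
    by (simp add: Psi_radial_eq[OF \<delta>])
qed

text \<open>Tonelli on the triangle 0 <= r <= s <= 1. For fixed s the substitution r = s y separates
  the variables and produces a Beta integral in y^2; a second Beta integral in s remains.\<close>

lemma Psi_radial_nn_moment:
  assumes \<delta>: "\<delta> > real d / 2" "d \<ge> 1"
  shows "(\<integral>\<^sup>+r. ennreal (r ^ (2 * k + d - 1)) * ennreal (\<Psi>_radial d \<delta> \<bar>r\<bar>) * indicator {0..} r \<partial>lborel)
    = ennreal (psi_const d \<delta> * (Beta (real k + real d / 2) (\<delta> - real d / 2 + 1/2) / 2 * Beta (2 * \<delta> + real (2 * k)) (2 * \<delta>)))"
proof -
  let ?\<alpha> = "\<delta> - (real d + 1) / 2" and ?\<beta> = "2 * \<delta> - 1" and ?n = "2 * k + d"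
  let ?c = "ennreal (psi_const d \<delta>)"
  have n: "?n \<ge> 1" using \<delta> by simp
  have \<alpha>1: "?\<alpha> + 1 = \<delta> - real d / 2 + 1/2" by (simp add: field_simps)
  have c0: "psi_const d \<delta> \<ge> 0" using psi_const_pos[OF \<delta>(1)] by simp
  let ?B1 = "Beta (real k + real d / 2) (?\<alpha> + 1)" and ?B2 = "Beta (2 * \<delta> + real (2 * k)) (2 * \<delta>)"
  have B1: "?B1 \<ge> 0" using \<delta> by (intro less_imp_le Beta_pos) (auto simp: field_simps)
  have B2: "?B2 \<ge> 0" using \<delta> by (intro less_imp_le Beta_pos) auto
  define G where "G r s = ennreal (if 0 \<le> r \<and> r \<le> s \<and> s \<le> 1 then r ^ (?n - 1) * ((s\<^sup>2 - r\<^sup>2) powr ?\<alpha> * (1 - s) powr ?\<beta>) else 0)" for r s :: real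
  have Gm: "(\<lambda>(r, s). G r s) \<in> borel_measurable (borel \<Otimes>\<^sub>M borel)"
    unfolding G_def by measurable
  have Gm1[measurable]: "(\<lambda>x. G (f x) (g x)) \<in> borel_measurable M" if "f \<in> borel_measurable M" "g \<in> borel_measurable M" for f g M
    using measurable_compose[OF measurable_Pair[OF that] Gm] by simp
  have Geq: "G r s = (ennreal (r ^ (?n - 1)) * indicator {0..} r) * (ennreal ((s\<^sup>2 - r\<^sup>2) powr ?\<alpha> * (1 - s) powr ?\<beta>) * indicator {r..1} s)" for r s :: real
    by (auto simp: G_def ennreal_mult'' split: split_indicator)
  have 1: "ennreal (r ^ (?n - 1)) * ennreal (\<Psi>_radial d \<delta> \<bar>r\<bar>) * indicator {0..} r = ?c * (\<integral>\<^sup>+s. G r s \<partial>lborel)" for r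
  proof (cases "r \<ge> 0")
    case True
    have "ennreal (\<Psi>_radial d \<delta> r) = ?c * ennreal (LBINT s. indicator {r..1} s * ((s\<^sup>2 - r\<^sup>2) powr ?\<alpha> * (1 - s) powr ?\<beta>))"
      unfolding Psi_radial_eq[OF \<delta> True] psi_kernel_integral(2)[OF \<delta> True] using c0 by (rule ennreal_mult')
    also have "ennreal (LBINT s. indicator {r..1} s * ((s\<^sup>2 - r\<^sup>2) powr ?\<alpha> * (1 - s) powr ?\<beta>))
      = (\<integral>\<^sup>+s. ennreal (indicator {r..1} s * ((s\<^sup>2 - r\<^sup>2) powr ?\<alpha> * (1 - s) powr ?\<beta>)) \<partial>lborel)"
      by (rule nn_integral_eq_integral[symmetric, OF psi_kernel_integral(1)[OF \<delta> True]]) auto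
    also have "\<dots> = (\<integral>\<^sup>+s. ennreal ((s\<^sup>2 - r\<^sup>2) powr ?\<alpha> * (1 - s) powr ?\<beta>) * indicator {r..1} s \<partial>lborel)"
      by (intro nn_integral_cong) (auto split: split_indicator)
    finally have e: "ennreal (\<Psi>_radial d \<delta> r) = ?c * (\<integral>\<^sup>+s. ennreal ((s\<^sup>2 - r\<^sup>2) powr ?\<alpha> * (1 - s) powr ?\<beta>) * indicator {r..1} s \<partial>lborel)" .
    have "(\<integral>\<^sup>+s. G r s \<partial>lborel) = (ennreal (r ^ (?n - 1)) * indicator {0..} r) * (\<integral>\<^sup>+s. ennreal ((s\<^sup>2 - r\<^sup>2) powr ?\<alpha> * (1 - s) powr ?\<beta>) * indicator {r..1} s \<partial>lborel)"
      unfolding Geq by (rule nn_integral_cmult) measurable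
    then show ?thesis using True by (simp add: e mult_ac)
  next
    case False
    then have "G r = (\<lambda>s. 0)" by (auto simp: G_def)
    then show ?thesis using False by simp
  qed
  have "(\<integral>\<^sup>+r. ennreal (r ^ (?n - 1)) * ennreal (\<Psi>_radial d \<delta> \<bar>r\<bar>) * indicator {0..} r \<partial>lborel)
    = (\<integral>\<^sup>+r. ?c * (\<integral>\<^sup>+s. G r s \<partial>lborel) \<partial>lborel)" by (simp only: 1)
  also have "\<dots> = ?c * (\<integral>\<^sup>+r. \<integral>\<^sup>+s. G r s \<partial>lborel \<partial>lborel)"
    by (rule nn_integral_cmult) measurable
  also have "(\<integral>\<^sup>+r. \<integral>\<^sup>+s. G r s \<partial>lborel \<partial>lborel) = (\<integral>\<^sup>+s. \<integral>\<^sup>+r. G r s \<partial>lborel \<partial>lborel)"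
    by (rule lborel_pair.Fubini'[symmetric]) measurable
  also have "\<dots> = (\<integral>\<^sup>+s. ennreal (?B1 / 2) * (ennreal (s powr (2 * \<delta> + real (2 * k) - 1) * (1 - s) powr (2 * \<delta> - 1)) * indicator {0..1} s) \<partial>lborel)"
  proof (rule nn_integral_cong_AE, use AE_lborel_singleton[of 0] in eventually_elim)
    case (elim s)
    show ?case
    proof (cases "s \<in> {0..1}")
      case False
      then have "G r s = 0" for r by (auto simp: G_def)
      then show ?thesis using False by simp
    next
      case True
      \<comment> \<open>Powers of s after r = s y: the integrand gives (2k + d - 1) + 2\<alpha>, the
        Jacobian one more, in total 2\<delta> + 2k - 1.\<close>
      then have s: "s > 0" "s \<le> 1" using elim by auto
      have "(\<integral>\<^sup>+r. G r s \<partial>lborel) = ennreal (s ^ DIM(real)) * (\<integral>\<^sup>+y. G (s *\<^sub>R y) s \<partial>lborel)"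
        by (rule nn_integral_scale[OF _ s(1)]) measurable
      also have "(\<integral>\<^sup>+y. G (s *\<^sub>R y) s \<partial>lborel) = (\<integral>\<^sup>+y. ennreal (s powr (real ?n - 1 + 2 * ?\<alpha>) * (1 - s) powr ?\<beta>) *
          (ennreal (y powr (2 * (real k + real d / 2) - 1) * (1 - y\<^sup>2) powr (?\<alpha> + 1 - 1)) * indicator {0..1} y) \<partial>lborel)"
      proof (rule nn_integral_cong_AE, use AE_lborel_singleton[of 0] in eventually_elim)
        case (elim y)
        show ?case
        proof (cases "y \<in> {0..1}")
          case False
          then have "G (s *\<^sub>R y) s = 0"
            using s by (auto simp: G_def zero_le_mult_iff mult_le_cancel_left1)
          then show ?thesis using False by simp
        next
          case True
          then have y: "y > 0" "y \<le> 1" using elim by auto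
          have i: "s * y \<le> s" using s y by (simp add: mult_left_le)
          have n1: "real (?n - 1) = 2 * (real k + real d / 2) - 1" using n by (subst of_nat_diff) auto
          have p1: "(s * y) ^ (?n - 1) = s powr (real (?n - 1)) * y powr (real (?n - 1))"
            using s y by (simp add: power_mult_distrib powr_realpow)
          have "s\<^sup>2 - (s * y)\<^sup>2 = s\<^sup>2 * (1 - y\<^sup>2)" by (simp add: power_mult_distrib algebra_simps)
          then have "(s\<^sup>2 - (s * y)\<^sup>2) powr ?\<alpha> = (s\<^sup>2) powr ?\<alpha> * (1 - y\<^sup>2) powr ?\<alpha>"
            by (simp only: powr_mult)
          also have "(s\<^sup>2) powr ?\<alpha> = s powr (2 * ?\<alpha>)"
          proof -
            have "s\<^sup>2 = s powr 2" using s by (simp add: powr_numeral)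
            then show ?thesis by (simp only: powr_powr)
          qed
          finally have p2: "(s\<^sup>2 - (s * y)\<^sup>2) powr ?\<alpha> = s powr (2 * ?\<alpha>) * (1 - y\<^sup>2) powr ?\<alpha>" .
          have p3: "s powr (real ?n - 1 + 2 * ?\<alpha>) = s powr (real (?n - 1)) * s powr (2 * ?\<alpha>)"
            using n by (simp only: powr_add[symmetric] of_nat_diff of_nat_1)
          have "G (s *\<^sub>R y) s = ennreal ((s * y) ^ (?n - 1) * ((s\<^sup>2 - (s * y)\<^sup>2) powr ?\<alpha> * (1 - s) powr ?\<beta>))"
            using s y i by (simp add: G_def)
          also have "(s * y) ^ (?n - 1) * ((s\<^sup>2 - (s * y)\<^sup>2) powr ?\<alpha> * (1 - s) powr ?\<beta>)
             = (s powr (real ?n - 1 + 2 * ?\<alpha>) * (1 - s) powr ?\<beta>) * (y powr (2 * (real k + real d / 2) - 1) * (1 - y\<^sup>2) powr (?\<alpha> + 1 - 1))"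
            unfolding p1 p2 p3 n1 by simp
          also have "ennreal \<dots> = ennreal (s powr (real ?n - 1 + 2 * ?\<alpha>) * (1 - s) powr ?\<beta>) * ennreal (y powr (2 * (real k + real d / 2) - 1) * (1 - y\<^sup>2) powr (?\<alpha> + 1 - 1))"
            by (rule ennreal_mult') simp
          finally show ?thesis using y by simp
        qed
      qed
      also have "\<dots> = ennreal (s powr (real ?n - 1 + 2 * ?\<alpha>) * (1 - s) powr ?\<beta>) * ennreal (?B1 / 2)"
        by (subst nn_integral_cmult, measurable, subst Beta_nn_integral_square) (use \<delta> in \<open>auto simp: field_simps\<close>)
      also have "ennreal (s ^ DIM(real)) * \<dots> = ennreal (s powr (2 * \<delta> + real (2 * k) - 1) * (1 - s) powr ?\<beta>) * ennreal (?B1 / 2)"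
      proof -
        have "2 * \<delta> + real (2 * k) - 1 = 1 + (real ?n - 1 + 2 * ?\<alpha>)" by (simp add: field_simps)
        then have "s powr (2 * \<delta> + real (2 * k) - 1) = s * s powr (real ?n - 1 + 2 * ?\<alpha>)"
          using s by (simp only: powr_add powr_one)
        then show ?thesis using s by (simp add: ennreal_mult' mult.assoc)
      qed
      finally show ?thesis using True by (simp add: mult_ac)
    qed
  qed
  also have "\<dots> = ennreal (?B1 / 2) * ennreal ?B2"
    by (subst nn_integral_cmult, measurable, subst Beta_nn_integral) (use \<delta> in auto)
  also have "?c * \<dots> = ennreal (psi_const d \<delta> * (?B1 / 2 * ?B2))"
    by (simp only: ennreal_mult''[OF B2] ennreal_mult'[OF c0])
  finally show ?thesis unfolding \<alpha>1 .
qed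

section \<open>Gamma identities and the transform of \<open>\<Psi>\<close>\<close>

lemma Gamma_duplication_real:
  fixes z :: real
  assumes z: "z > 0"
  shows "Gamma (2 * z) = Gamma z * Gamma (z + 1/2) * 2 powr (2 * z - 1) / sqrt pi"
proof -
  have nn: "complex_of_real x \<notin> \<int>\<^sub>\<le>\<^sub>0" if "x > 0" for x
    using that by (auto elim!: nonpos_Ints_cases simp: complex_eq_iff)
  have eq: "complex_of_real z + 1/2 = complex_of_real (z + 1/2)" by simp
  have z2: "complex_of_real (z + 1/2) \<notin> \<int>\<^sub>\<le>\<^sub>0" by (rule nn) (use z in simp)
  have "Gamma (complex_of_real z) * Gamma (complex_of_real (z + 1/2)) =
      exp ((1 - 2 * complex_of_real z) * of_real (ln 2)) * of_real (sqrt pi) * Gamma (2 * complex_of_real z)"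
    by (rule Gamma_legendre_duplication[of "complex_of_real z", unfolded eq, OF nn[OF z] z2])
  also have "exp ((1 - 2 * complex_of_real z) * of_real (ln 2)) = complex_of_real (exp ((1 - 2 * z) * ln 2))"
    by (simp add: exp_of_real[symmetric])
  also have "Gamma (2 * complex_of_real z) = complex_of_real (Gamma (2 * z))"
    using Gamma_complex_of_real[of "2 * z"] by simp
  finally have "complex_of_real (Gamma z * Gamma (z + 1/2)) = complex_of_real (exp ((1 - 2 * z) * ln 2) * sqrt pi * Gamma (2 * z))"
    by (simp only: Gamma_complex_of_real of_real_mult)
  then have e: "Gamma z * Gamma (z + 1/2) = exp ((1 - 2 * z) * ln 2) * sqrt pi * Gamma (2 * z)"
    by (simp only: of_real_eq_iff)
  have "exp ((1 - 2 * z) * ln 2) * 2 powr (2 * z - 1) = (1::real)"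
    by (simp add: powr_def exp_add[symmetric] algebra_simps)
  then have "(exp ((1 - 2 * z) * ln 2) * 2 powr (2 * z - 1)) * (sqrt pi * Gamma (2 * z)) = sqrt pi * Gamma (2 * z)" by simp
  then have "Gamma z * Gamma (z + 1/2) * 2 powr (2 * z - 1) = sqrt pi * Gamma (2 * z)"
    unfolding e by (simp add: mult_ac)
  then show ?thesis by (simp add: field_simps)
qed

text \<open>The right-hand side is the term k = 0 of the transform series, that is, the integral of
  \<open>\<Psi>\<close>. Legendre's duplication formula at \<delta> and at \<delta> - d/2 brings the
  given constant into this form.\<close>

lemma eta_alt:
  assumes \<delta>: "\<delta> > real d / 2" "d \<ge> 1"
  shows "\<eta> d \<delta> = sqrt pi ^ d * Gamma (\<delta> - real d / 2 + 1/2) / Gamma (\<delta> + 1/2) * Beta (2 * \<delta>) (2 * \<delta>) * psi_const d \<delta>"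
proof -
  define g1 g2 g3 g4 g5 g6 where "g1 = Gamma (\<delta> - real d / 2)" and "g2 = Gamma (\<delta> - real d / 2 + 1/2)"
    and "g3 = Gamma \<delta>" and "g4 = Gamma (\<delta> + 1/2)" and "g5 = Gamma (4 * \<delta>)" and "g6 = Gamma (4 * \<delta> - real d)"
  define h where "h = Gamma (real d / 2)"
  define P where "P = sqrt pi ^ d"
  have pos: "g1 > 0" "g2 > 0" "g3 > 0" "g4 > 0" "g5 > 0" "g6 > 0" "h > 0"
    unfolding g1_def g2_def g3_def g4_def g5_def g6_def h_def using \<delta> by (auto intro!: Gamma_real_pos)
  have D1: "Gamma (2 * \<delta>) = g3 * g4 * 2 powr (2 * \<delta> - 1) / sqrt pi"
    unfolding g3_def g4_def using \<delta> by (intro Gamma_duplication_real) auto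
  have D2: "Gamma (2 * \<delta> - real d) = g1 * g2 * 2 powr (2 * \<delta> - real d - 1) / sqrt pi"
    using Gamma_duplication_real[of "\<delta> - real d / 2"] \<delta> unfolding g1_def g2_def by (simp add: right_diff_distrib)
  define x where "x = (2::real) powr (2 * \<delta> - real d - 1)"
  define y where "y = (2::real) powr real d"
  have xy: "x > 0" "y > 0" by (simp_all add: x_def y_def)
  have X1: "2 powr (2 * \<delta> - 1) = x * y" unfolding x_def y_def powr_add[symmetric] by simp
  have X2: "2 powr (1 - real d) = 2 / y" unfolding y_def by (simp add: powr_diff)
  have P': "pi powr (real d / 2) = P"
    unfolding P_def powr_half_sqrt[symmetric, OF pi_ge_zero] by (simp add: powr_realpow[symmetric] powr_powr)
  have B1: "Beta (2 * \<delta>) (2 * \<delta>) = Gamma (2 * \<delta>) * Gamma (2 * \<delta>) / g5" by (simp add: Beta_def g5_def)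
  have B2: "Beta (2 * \<delta> - real d) (2 * \<delta>) = Gamma (2 * \<delta> - real d) * Gamma (2 * \<delta>) / g6"
    by (simp add: Beta_def g6_def algebra_simps)
  have "\<eta> d \<delta> = 2 * P / h * (1 / ((2 / y) * g5 * g1 / (g3 * g6 * h)))"
    unfolding \<eta>_def \<tau>_def P' X2 by (simp add: g1_def g3_def g5_def g6_def h_def)
  also have "\<dots> = P * g3 * g6 * y / (g5 * g1)"
    using pos xy by (simp add: field_simps)
  also have "\<dots> = P * g2 / g4 * (Gamma (2 * \<delta>) * Gamma (2 * \<delta>) / g5) * (1 / (Gamma (2 * \<delta> - real d) * Gamma (2 * \<delta>) / g6))"
    unfolding D1 D2 X1 x_def[symmetric] using pos xy by (simp add: field_simps)
  finally show ?thesis unfolding psi_const_def B1 B2 P_def g2_def g4_def .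
qed

lemma pochhammer_double_real: "pochhammer (2 * z) (2 * k) = 4 ^ k * pochhammer z k * pochhammer (z + 1/2 :: real) k"
  using pochhammer_double[of z k] by (simp add: power_mult)

lemma Gamma_shift: "x > (0::real) \<Longrightarrow> Gamma (x + real k) = pochhammer x k * Gamma x"
proof -
  assume x: "x > 0"
  then have "x \<notin> \<int>\<^sub>\<le>\<^sub>0" by (auto elim!: nonpos_Ints_cases)
  then show ?thesis using pochhammer_Gamma[of x k] Gamma_real_pos[OF x] by simp
qed

text \<open>The first Beta function cancels Gamma(k + d/2) and leaves (\<delta>+1/2)_k below. The
  second contributes (2\<delta>)_(2k) / (4\<delta>)_(2k), which duplication splits into (\<delta>)_k
  (\<delta>+1/2)_k over (2\<delta>)_k (2\<delta>+1/2)_k; the symbols of \<delta>+1/2 cancel.\<close>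

lemma Psi_fourier_coeff:
  assumes \<delta>: "\<delta> > real d / 2" "d \<ge> 1"
  shows "2 * sqrt pi ^ d * z ^ k / (fact k * Gamma (real k + real d / 2)) *
      (psi_const d \<delta> * (Beta (real k + real d / 2) (\<delta> - real d / 2 + 1/2) / 2 * Beta (2 * \<delta> + real (2 * k)) (2 * \<delta>)))
    = \<eta> d \<delta> * (Q_coeff \<delta> k * z ^ k)"
proof -
  have pp: "pochhammer x n > 0" if "x > 0" for x :: real and n using that by (rule pochhammer_pos)
  define G where "G = Gamma (real k + real d / 2)"
  have G: "G > 0" unfolding G_def using \<delta> by (intro Gamma_real_pos) auto
  define A where "A = Gamma (\<delta> - real d / 2 + 1/2)"
  define H where "H = Gamma (\<delta> + 1/2)"
  have H: "H > 0" unfolding H_def using \<delta> by (intro Gamma_real_pos) auto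
  define p1 p2 p3 p4 where "p1 = pochhammer \<delta> k" and "p2 = pochhammer (\<delta> + 1/2) k"
    and "p3 = pochhammer (2 * \<delta>) k" and "p4 = pochhammer (2 * \<delta> + 1/2) k"
  have p: "p1 > 0" "p2 > 0" "p3 > 0" "p4 > 0" unfolding p1_def p2_def p3_def p4_def using \<delta> by (auto intro!: pp)
  have B1: "Beta (real k + real d / 2) (\<delta> - real d / 2 + 1/2) = G * A / (p2 * H)"
  proof -
    have "real k + real d / 2 + (\<delta> - real d / 2 + 1/2) = (\<delta> + 1/2) + real k" by simp
    then show ?thesis
      using Gamma_shift[of "\<delta> + 1/2" k] \<delta> by (simp only: Beta_def G_def A_def H_def p2_def)
  qed
  have B2: "Beta (2 * \<delta> + real (2 * k)) (2 * \<delta>) = Beta (2 * \<delta>) (2 * \<delta>) * (4 ^ k * p1 * p2) / (4 ^ k * p3 * p4)"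
  proof -
    have "2 * \<delta> + 2 * \<delta> = 2 * (2 * \<delta>)" by simp
    then show ?thesis
      using Beta_shift[of "2 * \<delta>" "2 * \<delta>" "2 * k"] \<delta> 
      by (simp only: pochhammer_double_real p1_def p2_def p3_def p4_def)
  qed
  have alg: "2 * P * Z / (F * G) * (c * (G * A / (p2 * H) / 2 * (B * (f * p1 * p2) / (f * p3 * p4))))
    = P * A / H * B * c * (p1 / (F * p3 * p4) * Z)" if "F > 0" "f > 0" for P Z F c B f :: real
    using that G H p by (simp add: field_simps)
  show ?thesis
    unfolding eta_alt[OF \<delta>] B1 B2 G_def[symmetric] A_def[symmetric] H_def[symmetric]
      p1_def[symmetric] p3_def[symmetric] p4_def[symmetric]
    by (rule alg) auto
qed

lemma continuous_Psi:
  assumes \<delta>: "\<delta> > real d / 2" "d \<ge> 1"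
  shows "continuous_on UNIV (\<Psi> d \<delta> :: 'a::euclidean_space \<Rightarrow> complex)"
proof -
  have "continuous_on UNIV (\<lambda>x::'a. \<Psi>_radial d \<delta> \<bar>norm x\<bar>)"
    by (rule continuous_on_compose2[OF continuous_Psi_radial[OF \<delta>]]) (auto intro!: continuous_intros)
  then have "continuous_on UNIV (\<lambda>x::'a. complex_of_real (\<Psi>_radial d \<delta> \<bar>norm x\<bar>))"
    by (rule continuous_on_of_real)
  then show ?thesis unfolding \<Psi>_def[abs_def] by simp
qed

lemma bounded_support_integrable:
  fixes f :: "'a::euclidean_space \<Rightarrow> 'b::euclidean_space"
  assumes "continuous_on UNIV f" "\<And>x. norm x > R \<Longrightarrow> f x = 0"
  shows "integrable lborel f"
proof -
  have "integrable lborel (\<lambda>x. indicator (cball 0 R) x *\<^sub>R f x)"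
    by (intro borel_integrable_compact continuous_on_subset[OF assms(1)]) auto
  moreover have "(\<lambda>x. indicator (cball 0 R) x *\<^sub>R f x) = f"
    using assms(2) by (force simp: indicator_def)
  ultimately show ?thesis by simp
qed

lemma Psi_integrable:
  assumes \<delta>: "\<delta> > real d / 2" "d \<ge> 1"
  shows "integrable lborel (\<Psi> d \<delta> :: 'a::euclidean_space \<Rightarrow> complex)"
    and "square_integrable (\<Psi> d \<delta> :: 'a::euclidean_space \<Rightarrow> complex)"
proof -
  have z: "\<Psi> d \<delta> x = 0" if "norm x > 1" for x :: 'a
    using that by (simp add: \<Psi>_def \<Psi>_radial_def)
  show i: "integrable lborel (\<Psi> d \<delta> :: 'a \<Rightarrow> complex)"
    by (rule bounded_support_integrable[OF continuous_Psi[OF \<delta>] z])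
  have "integrable lborel (\<lambda>x::'a. (norm (\<Psi> d \<delta> x))\<^sup>2)"
    by (rule bounded_support_integrable[where R=1]) (use z in \<open>auto intro!: continuous_intros continuous_Psi \<delta>\<close>)
  then show "square_integrable (\<Psi> d \<delta> :: 'a \<Rightarrow> complex)"
    using i by (simp add: square_integrable_def)
qed

lemma fourier_Psi:
  fixes \<xi> :: "'a::euclidean_space"
  assumes \<delta>: "\<delta> > real d / 2" and d: "d = DIM('a)"
  shows "fourier_L1 (\<Psi> d \<delta>) \<xi> = complex_of_real (\<eta> d \<delta> * Q \<delta> (norm \<xi>))"
proof -
  let ?m = "\<lambda>k. psi_const d \<delta> * (Beta (real k + real d / 2) (\<delta> - real d / 2 + 1/2) / 2 * Beta (2 * \<delta> + real (2 * k)) (2 * \<delta>))"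
  have d1: "d \<ge> 1" using d by (simp add: Suc_leI)
  note D = \<delta> d1
  let ?z = "- (norm \<xi>)\<^sup>2 / 4"
  let ?q = "\<lambda>k. Q_coeff \<delta> k * ?z ^ k"
  \<comment> \<open>Compact support and continuity supply the exponential moment required by the
    series expansion.\<close>
  have int: "integrable lborel (\<lambda>x. exp \<bar>\<xi> \<bullet> x\<bar> * \<Psi>_radial d \<delta> \<bar>norm x\<bar>)"
  proof (rule bounded_support_integrable[where R=1])
    show "continuous_on UNIV (\<lambda>x. exp \<bar>\<xi> \<bullet> x\<bar> * \<Psi>_radial d \<delta> \<bar>norm x\<bar>)"
      by (intro continuous_intros continuous_on_compose2[OF continuous_Psi_radial[OF D]]) auto
  qed (simp add: \<Psi>_radial_def)
  have Bp: "Beta (real k + real d / 2) (\<delta> - real d / 2 + 1/2) > 0" "Beta (2 * \<delta> + real (2 * k)) (2 * \<delta>) > 0" for k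
    using D by (auto intro!: Beta_pos)
  have "(\<lambda>k. complex_of_real (2 * sqrt pi ^ DIM('a) * ?z ^ k / (fact k * Gamma (real k + real DIM('a) / 2)) *
      (?m k)))
    sums fourier_L1 (\<lambda>x. complex_of_real (\<Psi>_radial d \<delta> \<bar>norm x\<bar>)) \<xi>"
  proof (rule fourier_radial_series[OF _ _ int])
    show "(\<lambda>r. \<Psi>_radial d \<delta> \<bar>r\<bar>) \<in> borel_measurable borel"
      by (rule borel_measurable_continuous_onI[OF continuous_Psi_radial[OF D]])
    show "0 \<le> \<Psi>_radial d \<delta> \<bar>r\<bar>" for r by (rule Psi_radial_nonneg[OF D]) simp
  next
    fix k
    show "(\<integral>\<^sup>+r. ennreal (r ^ (2 * k + DIM('a) - 1)) * ennreal (\<Psi>_radial d \<delta> \<bar>r\<bar>) * indicator {0..} r \<partial>lborel)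
      = ennreal (?m k)"
      using Psi_radial_nn_moment[OF D, of k] unfolding d .
    show "0 \<le> ?m k"
      using psi_const_pos[OF \<delta>] Bp[of k] by (intro mult_nonneg_nonneg) auto
  qed
  then have S: "(\<lambda>k. complex_of_real (\<eta> d \<delta> * ?q k)) sums fourier_L1 (\<Psi> d \<delta>) \<xi>"
    unfolding d[symmetric] Psi_fourier_coeff[OF D] by (simp add: \<Psi>_def[abs_def])
  \<comment> \<open>Convergence of the series of \<open>Q\<close> is inherited from the transform
    series, as its constant factor is nonzero.\<close>
  have s: "summable ?q"
  proof -
    have "summable (\<lambda>k. complex_of_real (\<eta> d \<delta> * ?q k))" using S by (rule sums_summable)
    then have "summable (\<lambda>k. \<eta> d \<delta> * ?q k)" by (simp only: summable_of_real_iff)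
    moreover have "\<eta> d \<delta> \<noteq> 0"
    proof -
      have "Gamma (\<delta> - real d / 2 + 1/2) > 0" "Gamma (\<delta> + 1/2) > 0" "Beta (2 * \<delta>) (2 * \<delta>) > 0"
        using D by (auto intro!: Gamma_real_pos Beta_pos)
      then show ?thesis unfolding eta_alt[OF D] using psi_const_pos[OF \<delta>] by simp
    qed
    ultimately show ?thesis by (simp only: summable_cmult_iff) simp
  qed
  have "?q sums Q \<delta> (norm \<xi>)" unfolding Q_series using s by (rule summable_sums)
  then have "(\<lambda>k. complex_of_real (\<eta> d \<delta> * ?q k)) sums complex_of_real (\<eta> d \<delta> * Q \<delta> (norm \<xi>))"
    by (intro sums_of_real sums_mult)
  with S show ?thesis by (rule sums_unique2)
qed

section \<open>The Sobolev space\<close>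

definition sob_weight :: "real \<Rightarrow> 'a::euclidean_space \<Rightarrow> real" where
  "sob_weight \<delta> \<xi> = (1 + (norm \<xi>)\<^sup>2) powr (\<delta> / 2)"

lemma sob_weight_pos: "sob_weight \<delta> \<xi> > 0"
  using zero_le_power2[of "norm \<xi>"] unfolding sob_weight_def by (auto simp: powr_gt_zero simp del: zero_le_power2) (metis add_pos_nonneg less_numeral_extra(1,3) zero_le_power2)

lemma sob_weight_square: "(sob_weight \<delta> \<xi>)\<^sup>2 = (1 + (norm \<xi>)\<^sup>2) powr \<delta>"
  unfolding sob_weight_def power2_eq_square powr_add[symmetric] by simp

lemma sob_weight_ge_1: "\<delta> \<ge> 0 \<Longrightarrow> sob_weight \<delta> \<xi> \<ge> 1"
  unfolding sob_weight_def by (intro ge_one_powr_ge_zero) auto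

lemma continuous_on_sob_weight: "continuous_on UNIV (sob_weight \<delta>)"
  unfolding sob_weight_def[abs_def]
  by (intro continuous_intros) (metis add_pos_nonneg less_irrefl zero_le_power2 zero_less_one)

lemma measurable_sob_weight [measurable]: "sob_weight \<delta> \<in> borel_measurable borel"
  by (rule borel_measurable_continuous_onI[OF continuous_on_sob_weight])

text \<open>Radial integration is the case k = 0 of \<open>nn_integral_radial_moment\<close>, with
  \<xi> = 0 since \<open>0 ^ 0 = 1\<close>. The radial integrand is at most 1 on [0, 1] and at most
  r^(d-1-2\<delta>) beyond, with exponent below -1.\<close>

lemma integrable_japanese_bracket:
  assumes \<delta>: "\<delta> > real DIM('a) / 2"
  shows "integrable lborel (\<lambda>\<xi>::'a::euclidean_space. (1 + (norm \<xi>)\<^sup>2) powr (- \<delta>))"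
proof -
  let ?d = "DIM('a)"
  let ?f = "\<lambda>r::real. ennreal ((1 + r\<^sup>2) powr (- \<delta>))"
  have tail: "(\<integral>\<^sup>+r. ennreal (r powr (real ?d - 1 - 2 * \<delta>)) * indicator {1..} r \<partial>lborel)
    = ennreal (0 - 1 powr (real ?d - 2 * \<delta>) / (real ?d - 2 * \<delta>))"
  proof (rule nn_integral_FTC_atLeast)
    fix r :: real assume r: "1 \<le> r"
    have "((\<lambda>r. r powr (real ?d - 2 * \<delta>)) has_real_derivative (real ?d - 2 * \<delta>) * r powr (real ?d - 2 * \<delta> - 1)) (at r)"
      by (rule has_real_derivative_powr) (use r in simp)
    then have "((\<lambda>r. r powr (real ?d - 2 * \<delta>) / (real ?d - 2 * \<delta>)) has_real_derivative ((real ?d - 2 * \<delta>) * r powr (real ?d - 2 * \<delta> - 1)) / (real ?d - 2 * \<delta>)) (at r)"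
      by (rule DERIV_cdivide)
    moreover have "((real ?d - 2 * \<delta>) * r powr (real ?d - 2 * \<delta> - 1)) / (real ?d - 2 * \<delta>) = r powr (real ?d - 2 * \<delta> - 1)"
      using \<delta> by simp
    moreover have "real ?d - 2 * \<delta> - 1 = real ?d - 1 - 2 * \<delta>" by simp
    ultimately show "((\<lambda>r. r powr (real ?d - 2 * \<delta>) / (real ?d - 2 * \<delta>)) has_real_derivative r powr (real ?d - 1 - 2 * \<delta>)) (at r)"
      by (simp only:)
  next
    have "((\<lambda>r. r powr (real ?d - 2 * \<delta>)) \<longlongrightarrow> 0) at_top"
      by (rule tendsto_neg_powr) (use \<delta> in \<open>auto intro: filterlim_ident\<close>)
    then show "((\<lambda>r. r powr (real ?d - 2 * \<delta>) / (real ?d - 2 * \<delta>)) \<longlongrightarrow> 0) at_top"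
      by (rule tendsto_divide_zero)
  qed auto
  have "(\<integral>\<^sup>+\<xi>. ?f (norm (\<xi>::'a)) \<partial>lborel) = (\<integral>\<^sup>+\<xi>. ennreal ((0 \<bullet> (\<xi>::'a)) ^ (2 * 0)) * ?f (norm \<xi>) \<partial>lborel)" by simp
  also have "\<dots> = ennreal (2 * sqrt pi ^ DIM('a) * fact (2 * 0) / (fact 0 * Gamma (real 0 + DIM('a) / 2)) * ((norm (0::'a))\<^sup>2 / 4) ^ 0)
      * (\<integral>\<^sup>+r. ennreal (r ^ (2 * 0 + DIM('a) - 1)) * ?f r * indicator {0..} r \<partial>lborel)" (is "_ = ?c * ?I")
    by (rule nn_integral_radial_moment) measurable
  also have "?I \<le> (\<integral>\<^sup>+r. indicator {0..1} r + ennreal (r powr (real ?d - 1 - 2 * \<delta>)) * indicator {1..} r \<partial>lborel)"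
  proof (rule nn_integral_mono)
    fix r :: real
    consider "r < 0" | "0 \<le> r" "r \<le> 1" | "r > 1" by linarith
    then show "ennreal (r ^ (2 * 0 + DIM('a) - 1)) * ?f r * indicator {0..} r
       \<le> indicator {0..1} r + ennreal (r powr (real ?d - 1 - 2 * \<delta>)) * indicator {1..} r"
    proof cases
      case 2
      have "r ^ (?d - 1) * (1 + r\<^sup>2) powr (- \<delta>) \<le> 1 * 1"
      proof (rule mult_mono)
        show "r ^ (?d - 1) \<le> 1" using 2 by (intro power_le_one)
        have "1 powr \<delta> \<le> (1 + r\<^sup>2) powr \<delta>" by (rule powr_mono2) (use \<delta> in \<open>auto intro: order.trans[of _ "real DIM('a) / 2"]\<close>)
        then show "(1 + r\<^sup>2) powr (- \<delta>) \<le> 1" by (simp add: powr_minus inverse_le_1_iff)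
      qed auto
      then have "ennreal (r ^ (?d - 1)) * ?f r \<le> 1"
        by (subst ennreal_mult''[symmetric]) (auto simp: ennreal_le_1)
      then show ?thesis using 2 by (auto intro: add_increasing2)
    next
      case 3
      have "(1 + r\<^sup>2) powr (- \<delta>) \<le> (r\<^sup>2) powr (- \<delta>)"
        by (rule powr_mono2') (use \<delta> 3 in \<open>auto intro: order.trans[of _ "real DIM('a) / 2"]\<close>)
      also have "(r\<^sup>2) powr (- \<delta>) = r powr (- (2 * \<delta>))"
      proof -
        have "r\<^sup>2 = r powr 2" using 3 by (simp add: powr_numeral)
        then show ?thesis by (simp add: powr_powr)
      qed
      finally have "r ^ (?d - 1) * (1 + r\<^sup>2) powr (- \<delta>) \<le> r ^ (?d - 1) * r powr (- (2 * \<delta>))"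
        using 3 by (intro mult_left_mono) auto
      also have "r ^ (?d - 1) * r powr (- (2 * \<delta>)) = r powr (real ?d - 1 - 2 * \<delta>)"
      proof -
        have "r ^ (?d - 1) = r powr (real (?d - 1))" by (rule powr_realpow[symmetric]) (use 3 in simp)
        then show ?thesis by (simp add: powr_add[symmetric] of_nat_diff Suc_leI)
      qed
      finally have "ennreal (r ^ (?d - 1) * (1 + r\<^sup>2) powr (- \<delta>)) \<le> ennreal (r powr (real ?d - 1 - 2 * \<delta>))"
        by (rule ennreal_leI)
      then show ?thesis using 3 by (simp add: ennreal_mult'')
    qed auto
  qed
  also have "\<dots> = 1 + ennreal (0 - 1 powr (real ?d - 2 * \<delta>) / (real ?d - 2 * \<delta>))"
    by (subst nn_integral_add) (auto simp: tail)
  finally have "(\<integral>\<^sup>+\<xi>. ?f (norm (\<xi>::'a)) \<partial>lborel) \<le> ?c * (1 + ennreal (0 - 1 powr (real ?d - 2 * \<delta>) / (real ?d - 2 * \<delta>)))"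
    by (simp add: mult_left_mono)
  also have "\<dots> < \<infinity>" by (simp add: ennreal_mult_less_top)
  finally show ?thesis by (intro integrableI_nonneg) auto
qed

lemma square_integrable_cong_AE:
  assumes "square_integrable f" "g \<in> borel_measurable borel" "AE x in lborel. f x = g x"
  shows "square_integrable g"
  using assms L2n_cong_AE[OF assms(3)] by (simp add: square_integrable_L2n)

lemma square_integrable_cnj: "square_integrable f \<Longrightarrow> square_integrable (\<lambda>x. cnj (f x))"
proof -
  have "cnj \<in> borel_measurable borel"
    by (intro borel_measurable_continuous_onI continuous_intros)
  then show "square_integrable f \<Longrightarrow> square_integrable (\<lambda>x. cnj (f x))"
    using measurable_compose[of f borel borel cnj borel] by (simp add: square_integrable_def)
qed

text \<open>The argument \<open>dummy\<close> only fixes the type \<open>'a\<close> of the locale.\<close>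

locale sobolev_setting =
  fixes d :: nat and \<delta> :: real and dummy :: "'a::euclidean_space itself"
  assumes d: "d = DIM('a)" and \<delta>: "\<delta> > real d / 2"
begin

lemma d1: "d \<ge> 1" using d by (simp add: Suc_leI)

lemma delta_gt_half: "\<delta> > 1/2" using \<delta> d1 by linarith

abbreviation W :: "'a \<Rightarrow> real" where "W \<equiv> sob_weight \<delta>"
abbreviation V :: "('a \<Rightarrow> complex) set" where "V \<equiv> sobolev \<delta>"
abbreviation R :: "'a \<Rightarrow> real" where "R \<xi> \<equiv> Q \<delta> (norm \<xi>)"
abbreviation ip :: "('a \<Rightarrow> complex) \<Rightarrow> ('a \<Rightarrow> complex) \<Rightarrow> complex" where "ip \<equiv> \<Psi>_inner d \<delta>"

abbreviation ipf :: "('a \<Rightarrow> complex) \<Rightarrow> ('a \<Rightarrow> complex) \<Rightarrow> 'a \<Rightarrow> complex" where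
  "ipf u v \<xi> \<equiv> fourier u \<xi> * cnj (fourier v \<xi>) / complex_of_real (R \<xi>)"

definition K :: real where "K = (2 * pi) powr (- real d) * (1 / \<eta> d \<delta>)"

lemma eta_pos: "\<eta> d \<delta> > 0"
proof -
  have "Gamma (\<delta> - real d / 2 + 1/2) > 0" "Gamma (\<delta> + 1/2) > 0" "Beta (2 * \<delta>) (2 * \<delta>) > 0"
    using \<delta> d1 by (auto intro!: Gamma_real_pos Beta_pos)
  then show ?thesis unfolding eta_alt[OF \<delta> d1] using psi_const_pos[OF \<delta>] by simp
qed

lemma two_pi_powr: "(2 * pi) powr (- real d) = 1 / (2 * pi) ^ DIM('a)"
  by (simp add: powr_minus powr_realpow d inverse_eq_divide)

lemma K_pos: "K > 0" using eta_pos by (simp add: K_def)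

lemma R_pos: "R \<xi> > 0" by (rule Q_pos[OF delta_gt_half])

lemma continuous_R: "continuous_on UNIV R"
  by (rule continuous_on_compose2[OF Q_continuous[OF delta_gt_half]]) (auto intro!: continuous_intros)

lemma measurable_R [measurable]: "R \<in> borel_measurable borel"
  by (rule borel_measurable_continuous_onI[OF continuous_R])

lemma weight_bounds:
  obtains c C where "0 < c" "0 < C" "\<And>\<xi>::'a. c \<le> (W \<xi>)\<^sup>2 * R \<xi>" "\<And>\<xi>::'a. (W \<xi>)\<^sup>2 * R \<xi> \<le> C"
proof -
  obtain c C where cC: "0 < c" "\<And>r. r \<ge> 0 \<Longrightarrow> c \<le> (1 + r\<^sup>2) powr \<delta> * Q \<delta> r"
    "\<And>r. r \<ge> 0 \<Longrightarrow> (1 + r\<^sup>2) powr \<delta> * Q \<delta> r \<le> C"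
    using Q_two_sided_bounds[OF delta_gt_half] by blast
  have "0 < C" using cC(1) cC(2)[of 0] cC(3)[of 0] by simp
  then show ?thesis using cC by (intro that[of c C]) (auto simp: sob_weight_square)
qed

text \<open>The decisive use of \<delta> > d/2: by Cauchy-Schwarz against this function the
  transforms of Sobolev functions are integrable, so that pointwise inversion is available.\<close>

lemma inverse_weight: "square_integrable (\<lambda>\<xi>::'a. complex_of_real (1 / W \<xi>))"
proof -
  have "(norm (complex_of_real (1 / W \<xi>)))\<^sup>2 = (1 + (norm \<xi>)\<^sup>2) powr (- \<delta>)" for \<xi> :: 'a
    by (simp add: power_divide sob_weight_square powr_minus inverse_eq_divide norm_divide)
  moreover have "integrable lborel (\<lambda>\<xi>::'a. (1 + (norm \<xi>)\<^sup>2) powr (- \<delta>))"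
    using \<delta> unfolding d by (rule integrable_japanese_bracket)
  ultimately show ?thesis unfolding square_integrable_def by simp
qed

lemma sobolevD:
  assumes "u \<in> V"
  shows "square_integrable u" "continuous_on UNIV u"
    "square_integrable (\<lambda>\<xi>. complex_of_real (W \<xi>) * fourier u \<xi>)"
    "is_fourier_L2 u (fourier u)" "integrable lborel (fourier u)" "fourier u \<in> borel_measurable borel"
proof -
  show u: "square_integrable u" "continuous_on UNIV u"
    and w: "square_integrable (\<lambda>\<xi>. complex_of_real (W \<xi>) * fourier u \<xi>)"
    using assms by (auto simp: sobolev_def sobolev_L2_def sob_weight_def)
  show "is_fourier_L2 u (fourier u)" by (rule is_fourier_L2_fourier[OF u(1)])
  show "fourier u \<in> borel_measurable borel" using square_integrable_fourier[OF u(1)] by (rule square_integrableD)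
  have "complex_of_real (1 / W \<xi>) * (complex_of_real (W \<xi>) * fourier u \<xi>) = fourier u \<xi>" for \<xi>
    using sob_weight_pos[of \<delta> \<xi>] by simp
  then show "integrable lborel (fourier u)"
    using L2_integrable_mult(1)[OF inverse_weight w] by simp
qed

text \<open>Membership can be tested on any representative \<open>g\<close> of the transform, since
  the chosen one agrees with it almost everywhere.\<close>

lemma sobolevI:
  assumes "continuous_on UNIV u" "is_fourier_L2 u g" "square_integrable (\<lambda>\<xi>. complex_of_real (W \<xi>) * g \<xi>)"
  shows "u \<in> V"
proof -
  have u: "square_integrable u" using assms(2) by (simp add: is_fourier_L2_def)
  have [measurable]: "fourier u \<in> borel_measurable borel" using square_integrable_fourier[OF u] by (rule square_integrableD)
  have "square_integrable (\<lambda>\<xi>. complex_of_real (W \<xi>) * fourier u \<xi>)"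
    by (rule square_integrable_cong_AE[OF assms(3)]) (use fourier_AE_eq[OF assms(2)] in auto)
  then show ?thesis using u assms(1) by (simp add: sobolev_def sobolev_L2_def sob_weight_def)
qed

lemma sobolev_add:
  assumes u: "u \<in> V" and v: "v \<in> V"
  shows "(\<lambda>x. u x + v x) \<in> V"
proof (rule sobolevI[OF _ is_fourier_L2_add[OF sobolevD(4)[OF u] sobolevD(4)[OF v]]])
  show "continuous_on UNIV (\<lambda>x. u x + v x)" by (intro continuous_intros sobolevD u v)
  show "square_integrable (\<lambda>\<xi>. complex_of_real (W \<xi>) * (fourier u \<xi> + fourier v \<xi>))"
    unfolding distrib_left by (intro square_integrable_add sobolevD u v)
qed

lemma sobolev_cmult:
  assumes u: "u \<in> V"
  shows "(\<lambda>x. c * u x) \<in> V"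
proof (rule sobolevI[OF _ is_fourier_L2_cmult[OF sobolevD(4)[OF u]]])
  show "continuous_on UNIV (\<lambda>x. c * u x)" by (intro continuous_intros sobolevD u)
  show "square_integrable (\<lambda>\<xi>. complex_of_real (W \<xi>) * (c * fourier u \<xi>))"
    unfolding mult.left_commute[of _ c] by (intro square_integrable_cmult sobolevD u)
qed

lemma sobolev_zero: "(\<lambda>x. 0) \<in> V"
proof (rule sobolevI)
  have s: "square_integrable (\<lambda>x::'a. 0)" by (simp add: square_integrable_def)
  then show "is_fourier_L2 (\<lambda>x::'a. 0) (fourier_L1 (\<lambda>x. 0))" by (intro is_fourier_L2_L1) auto
  show "square_integrable (\<lambda>\<xi>::'a. complex_of_real (W \<xi>) * fourier_L1 (\<lambda>x. 0) \<xi>)"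
    using s by (simp add: fourier_L1_def)
qed simp

lemma sobolev_diff: "u \<in> V \<Longrightarrow> v \<in> V \<Longrightarrow> (\<lambda>x. u x - v x) \<in> V"
  using sobolev_add[of u "\<lambda>x. - 1 * v x"] sobolev_cmult[of v "-1"] by simp

text \<open>Only almost everywhere: the representatives chosen for a sum and for its summands are
  unrelated on null sets.\<close>

lemma fourier_add_AE: "u \<in> V \<Longrightarrow> v \<in> V \<Longrightarrow> AE \<xi> in lborel. fourier (\<lambda>x. u x + v x) \<xi> = fourier u \<xi> + fourier v \<xi>"
  by (intro fourier_AE_eq is_fourier_L2_add sobolevD(4))

lemma fourier_diff_AE: "u \<in> V \<Longrightarrow> v \<in> V \<Longrightarrow> AE \<xi> in lborel. fourier (\<lambda>x. u x - v x) \<xi> = fourier u \<xi> - fourier v \<xi>"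
  by (intro fourier_AE_eq is_fourier_L2_diff sobolevD(4))

lemma fourier_cmult_AE: "u \<in> V \<Longrightarrow> AE \<xi> in lborel. fourier (\<lambda>x. c * u x) \<xi> = c * fourier u \<xi>"
  by (intro fourier_AE_eq is_fourier_L2_cmult sobolevD(4))

section \<open>The inner product and its norm\<close>

lemma ip_eq: "ip u v = complex_of_real K * (LBINT \<xi>. ipf u v \<xi>)"
  by (simp add: \<Psi>_inner_def K_def)

text \<open>The lower bound for \<open>Q\<close> gives 1 / R <= W^2 / c, and the product of two
  weighted transforms is integrable. Additivity of the inner product rests on this.\<close>

lemma ip_integrable:
  assumes u: "u \<in> V" and v: "v \<in> V"
  shows "integrable lborel (\<lambda>\<xi>. ipf u v \<xi>)"
proof -
  obtain c C where c: "0 < c" "\<And>\<xi>::'a. c \<le> (W \<xi>)\<^sup>2 * R \<xi>" using weight_bounds by metis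
  note [measurable] = sobolevD(6)[OF u] sobolevD(6)[OF v]
  have cm: "(\<lambda>\<xi>. cnj (fourier v \<xi>)) \<in> borel_measurable borel"
    using square_integrable_cnj[OF square_integrable_fourier[OF sobolevD(1)[OF v]]] by (rule square_integrableD)
  note [measurable] = cm
  have "integrable lborel (\<lambda>\<xi>. (complex_of_real (W \<xi>) * fourier u \<xi>) * cnj (complex_of_real (W \<xi>) * fourier v \<xi>))"
    by (intro L2_integrable_mult square_integrable_cnj sobolevD u v)
  then have "integrable lborel (\<lambda>\<xi>. complex_of_real (1 / c) * ((complex_of_real (W \<xi>) * fourier u \<xi>) * cnj (complex_of_real (W \<xi>) * fourier v \<xi>)))"
    by (rule integrable_mult_right)
  then show ?thesis
  proof (rule Bochner_Integration.integrable_bound)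
    show "AE \<xi> in lborel. norm (ipf u v \<xi>)
      \<le> norm (complex_of_real (1 / c) * ((complex_of_real (W \<xi>) * fourier u \<xi>) * cnj (complex_of_real (W \<xi>) * fourier v \<xi>)))"
    proof (rule AE_I2)
      fix \<xi> :: 'a
      have "1 / R \<xi> \<le> (W \<xi>)\<^sup>2 / c" using c(2)[of \<xi>] c(1) R_pos[of \<xi>] by (simp add: field_simps)
      then have "norm (fourier u \<xi>) * norm (fourier v \<xi>) * (1 / R \<xi>) \<le> norm (fourier u \<xi>) * norm (fourier v \<xi>) * ((W \<xi>)\<^sup>2 / c)"
        by (intro mult_left_mono) auto
      then show "norm (ipf u v \<xi>)
      \<le> norm (complex_of_real (1 / c) * ((complex_of_real (W \<xi>) * fourier u \<xi>) * cnj (complex_of_real (W \<xi>) * fourier v \<xi>)))"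
        using R_pos[of \<xi>] sob_weight_pos[of \<delta> \<xi>] c(1)
        by (simp add: norm_mult norm_divide power2_eq_square mult_ac)
    qed
  qed measurable
qed

lemma measurable_ip_integrand:
  assumes "u \<in> V" "v \<in> V"
  shows "(\<lambda>\<xi>. ipf u v \<xi>) \<in> borel_measurable lborel"
  using ip_integrable[OF assms] by (rule borel_measurable_integrable)

lemma ip_add:
  assumes u: "u \<in> V" and v: "v \<in> V" and w: "w \<in> V"
  shows "ip (\<lambda>x. u x + v x) w = ip u w + ip v w"
proof -
  have "(LBINT \<xi>. ipf (\<lambda>x. u x + v x) w \<xi>)
    = (LBINT \<xi>. ipf u w \<xi> + ipf v w \<xi>)"
  proof (rule integral_cong_AE)
    show "AE \<xi> in lborel. ipf (\<lambda>x. u x + v x) w \<xi>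
      = ipf u w \<xi> + ipf v w \<xi>"
      using fourier_add_AE[OF u v] by eventually_elim (simp add: distrib_right add_divide_distrib)
  qed (intro measurable_ip_integrand borel_measurable_add sobolev_add u v w)+
  also have "\<dots> = (LBINT \<xi>. ipf u w \<xi>) + (LBINT \<xi>. ipf v w \<xi>)"
    by (intro Bochner_Integration.integral_add ip_integrable u v w)
  finally show ?thesis unfolding ip_eq by (simp only: distrib_left)
qed

lemma ip_cmult:
  assumes u: "u \<in> V" and v: "v \<in> V"
  shows "ip (\<lambda>x. c * u x) v = c * ip u v"
proof -
  have "(LBINT \<xi>. ipf (\<lambda>x. c * u x) v \<xi>)
    = (LBINT \<xi>. c * (ipf u v \<xi>))"
  proof (rule integral_cong_AE)
    show "AE \<xi> in lborel. ipf (\<lambda>x. c * u x) v \<xi>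
      = c * (ipf u v \<xi>)"
      using fourier_cmult_AE[OF u, of c] by eventually_elim simp
  qed (intro measurable_ip_integrand borel_measurable_times borel_measurable_const sobolev_cmult u v)+
  also have "\<dots> = c * (LBINT \<xi>. ipf u v \<xi>)"
    by (rule integral_mult_right_zero)
  finally show ?thesis unfolding ip_eq by (simp only: mult.left_commute)
qed

lemma ip_cnj: "ip v u = cnj (ip u v)"
  unfolding ip_eq complex_cnj_mult complex_cnj_complex_of_real Bochner_Integration.integral_cnj[symmetric]
  by (simp add: mult.commute)

definition nrm2 :: "('a \<Rightarrow> complex) \<Rightarrow> real" where
  "nrm2 u = (LBINT \<xi>. (norm (fourier u \<xi>))\<^sup>2 / R \<xi>)"

lemma ip_self_integrand:
  "ipf u u \<xi> = complex_of_real ((norm (fourier u \<xi>))\<^sup>2 / R \<xi>)"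
  unfolding complex_norm_square[symmetric] by simp

lemma nrm2_integrable: "u \<in> V \<Longrightarrow> integrable lborel (\<lambda>\<xi>. (norm (fourier u \<xi>))\<^sup>2 / R \<xi>)"
  using integrable_Re[OF ip_integrable[of u u]] unfolding ip_self_integrand by simp

lemma ip_self: "ip u u = complex_of_real (K * nrm2 u)"
  unfolding ip_eq ip_self_integrand nrm2_def integral_complex_of_real of_real_mult ..

lemma nrm2_nonneg: "nrm2 u \<ge> 0"
  unfolding nrm2_def using R_pos by (intro Bochner_Integration.integral_nonneg divide_nonneg_pos) auto

text \<open>Injectivity of the transform gives 0 almost everywhere, continuity of the representative
  everywhere.\<close>

lemma eq_zero_if_fourier_AE_zero:
  assumes u: "u \<in> V" and 0: "AE \<xi> in lborel. fourier u \<xi> = 0"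
  shows "u = (\<lambda>x. 0)"
  using fourier_L2_inj[OF sobolevD(4)[OF u] 0]
  by (intro continuous_AE_eq) (auto intro: sobolevD u)

lemma ip_definite:
  assumes u: "u \<in> V" and 0: "ip u u = 0"
  shows "u = (\<lambda>x. 0)"
proof (rule eq_zero_if_fourier_AE_zero[OF u])
  have "nrm2 u = 0" using 0 K_pos unfolding ip_self by simp
  then have "AE \<xi> in lborel. (norm (fourier u \<xi>))\<^sup>2 / R \<xi> = 0"
    unfolding nrm2_def using integral_nonneg_eq_0_iff_AE[OF nrm2_integrable[OF u]] R_pos
    by (simp add: less_imp_le)
  then show "AE \<xi> in lborel. fourier u \<xi> = 0"
  proof eventually_elim
    case (elim \<xi>)
    then show ?case using R_pos[of \<xi>] by simp
  qed
qed

lemma inner_product: "inner_product_on V ip"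
  unfolding inner_product_on_def
proof (intro conjI ballI allI impI)
  show "ip u u \<in> \<real>\<^sub>\<ge>\<^sub>0" for u
    unfolding ip_self using K_pos nrm2_nonneg[of u] by (simp add: nonneg_Reals_of_real_iff)
qed (auto simp: ip_add ip_cmult intro: ip_cnj ip_definite)

lemma subspace: "function_subspace V"
  unfolding function_subspace_def using sobolev_zero sobolev_add sobolev_cmult by blast

text \<open>The squared Sobolev norm expressed as an L2 norm of the weighted transform, so that
  \<open>L2_complete\<close> can be applied to it.\<close>

definition wnrm :: "('a \<Rightarrow> complex) \<Rightarrow> ennreal" where
  "wnrm g = L2n (\<lambda>\<xi>. complex_of_real (W \<xi>) * g \<xi>)"

lemma nrm2_wnrm:
  obtains A B where "A > 0" "B > 0" "\<And>u. u \<in> V \<Longrightarrow> ennreal (nrm2 u) \<le> ennreal A * wnrm (fourier u)"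
    "\<And>u. u \<in> V \<Longrightarrow> wnrm (fourier u) \<le> ennreal (B * nrm2 u)"
proof -
  obtain c C where c: "0 < c" "0 < C" "\<And>\<xi>::'a. c \<le> (W \<xi>)\<^sup>2 * R \<xi>" "\<And>\<xi>::'a. (W \<xi>)\<^sup>2 * R \<xi> \<le> C"
    using weight_bounds by metis
  have nn: "ennreal (nrm2 u) = (\<integral>\<^sup>+\<xi>. ennreal ((norm (fourier u \<xi>))\<^sup>2 / R \<xi>) \<partial>lborel)" if "u \<in> V" for u
    unfolding nrm2_def using R_pos
    by (intro nn_integral_eq_integral[symmetric] nrm2_integrable that) (auto intro!: divide_nonneg_pos AE_I2)
  have wn: "wnrm g = (\<integral>\<^sup>+\<xi>. ennreal ((W \<xi>)\<^sup>2 * (norm (g \<xi>))\<^sup>2) \<partial>lborel)" for g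
    using sob_weight_pos[of \<delta>] by (simp add: wnrm_def L2n_def norm_mult power_mult_distrib)
  show ?thesis
  proof (rule that[of "1 / c" C])
    show "1 / c > 0" "C > 0" using c by auto
    fix u assume u: "u \<in> V"
    note [measurable] = sobolevD(6)[OF u]
    have "ennreal (nrm2 u) \<le> (\<integral>\<^sup>+\<xi>. ennreal (1 / c) * ennreal ((W \<xi>)\<^sup>2 * (norm (fourier u \<xi>))\<^sup>2) \<partial>lborel)"
      unfolding nn[OF u]
    proof (rule nn_integral_mono)
      fix \<xi> :: 'a
      have "1 / R \<xi> \<le> (W \<xi>)\<^sup>2 / c" using c(3)[of \<xi>] c(1) R_pos[of \<xi>] by (simp add: field_simps)
      then have "(norm (fourier u \<xi>))\<^sup>2 * (1 / R \<xi>) \<le> (norm (fourier u \<xi>))\<^sup>2 * ((W \<xi>)\<^sup>2 / c)"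
        by (intro mult_left_mono) auto
      then have "ennreal ((norm (fourier u \<xi>))\<^sup>2 / R \<xi>) \<le> ennreal (1 / c * ((W \<xi>)\<^sup>2 * (norm (fourier u \<xi>))\<^sup>2))"
        by (intro ennreal_leI) (simp add: mult_ac)
      also have "\<dots> = ennreal (1 / c) * ennreal ((W \<xi>)\<^sup>2 * (norm (fourier u \<xi>))\<^sup>2)"
        using c(1) by (intro ennreal_mult') auto
      finally show "ennreal ((norm (fourier u \<xi>))\<^sup>2 / R \<xi>) \<le> \<dots>" .
    qed
    also have "\<dots> = ennreal (1 / c) * wnrm (fourier u)"
      unfolding wn by (rule nn_integral_cmult) measurable
    finally show "ennreal (nrm2 u) \<le> ennreal (1 / c) * wnrm (fourier u)" .
    have "wnrm (fourier u) \<le> (\<integral>\<^sup>+\<xi>. ennreal C * ennreal ((norm (fourier u \<xi>))\<^sup>2 / R \<xi>) \<partial>lborel)"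
      unfolding wn
    proof (rule nn_integral_mono)
      fix \<xi> :: 'a
      have "(W \<xi>)\<^sup>2 \<le> C / R \<xi>" using c(4)[of \<xi>] R_pos[of \<xi>] by (simp add: field_simps)
      then have "(W \<xi>)\<^sup>2 * (norm (fourier u \<xi>))\<^sup>2 \<le> C / R \<xi> * (norm (fourier u \<xi>))\<^sup>2"
        by (intro mult_right_mono) auto
      then have "ennreal ((W \<xi>)\<^sup>2 * (norm (fourier u \<xi>))\<^sup>2) \<le> ennreal (C * ((norm (fourier u \<xi>))\<^sup>2 / R \<xi>))"
        by (intro ennreal_leI) simp
      also have "\<dots> = ennreal C * ennreal ((norm (fourier u \<xi>))\<^sup>2 / R \<xi>)"
        using c(2) by (intro ennreal_mult') auto
      finally show "ennreal ((W \<xi>)\<^sup>2 * (norm (fourier u \<xi>))\<^sup>2) \<le> \<dots>" .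
    qed
    also have "\<dots> = ennreal C * ennreal (nrm2 u)"
      unfolding nn[OF u] by (rule nn_integral_cmult) measurable
    also have "\<dots> = ennreal (C * nrm2 u)" using c(2) by (intro ennreal_mult'[symmetric]) auto
    finally show "wnrm (fourier u) \<le> ennreal (C * nrm2 u)" .
  qed
qed

lemma ip_dist_nrm2: "ip_dist ip u v = sqrt (K * nrm2 (\<lambda>x. u x - v x))"
  unfolding ip_dist_def ip_self by simp

lemma wnrm_diff:
  assumes "u \<in> V" "v \<in> V"
  shows "wnrm (fourier (\<lambda>x. u x - v x)) = L2n (\<lambda>\<xi>. complex_of_real (W \<xi>) * fourier u \<xi> - complex_of_real (W \<xi>) * fourier v \<xi>)"
  unfolding wnrm_def
  by (rule L2n_cong_AE, use fourier_diff_AE[OF assms] in eventually_elim) (simp add: right_diff_distrib)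

text \<open>Equivalence of norms makes the weighted transforms a Cauchy sequence in L2. Their limit
  divided by \<open>W\<close> lies in both L1 and L2, so its inverse transform is a continuous
  function; it lies in the space and is the limit sought.\<close>

lemma sobolev_complete:
  assumes U: "\<And>n. U n \<in> V"
    and C: "\<And>e. e > 0 \<Longrightarrow> \<exists>M. \<forall>m\<ge>M. \<forall>n\<ge>M. ip_dist ip (U m) (U n) < e"
  shows "\<exists>u\<in>V. (\<lambda>n. ip_dist ip (U n) u) \<longlonglongrightarrow> 0"
proof -
  obtain A B where AB: "A > 0" "B > 0" "\<And>u. u \<in> V \<Longrightarrow> ennreal (nrm2 u) \<le> ennreal A * wnrm (fourier u)"
    "\<And>u. u \<in> V \<Longrightarrow> wnrm (fourier u) \<le> ennreal (B * nrm2 u)" using nrm2_wnrm by metis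
  define F where "F n \<xi> = complex_of_real (W \<xi>) * fourier (U n) \<xi>" for n \<xi>
  have F: "square_integrable (F n)" for n
    unfolding F_def[abs_def] by (rule sobolevD(3)[OF U])
  have "\<exists>M. \<forall>m\<ge>M. \<forall>n\<ge>M. L2n (\<lambda>x. F m x - F n x) < ennreal e" if e: "e > 0" for e
  proof -
    \<comment> \<open>The squared distance is \<open>K\<close> times \<open>nrm2\<close>, and the
      weighted L2 norm is at most \<open>B\<close> times \<open>nrm2\<close>; this threshold makes
      the latter smaller than \<open>e\<close>.\<close>
    have "sqrt (e * K / B) > 0" using e K_pos AB by simp
    then obtain M where M: "\<And>m n. m \<ge> M \<Longrightarrow> n \<ge> M \<Longrightarrow> ip_dist ip (U m) (U n) < sqrt (e * K / B)"
      using C by blast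
    have "L2n (\<lambda>x. F m x - F n x) < ennreal e" if "m \<ge> M" "n \<ge> M" for m n
    proof -
      have "K * nrm2 (\<lambda>x. U m x - U n x) < e * K / B"
        using M[OF that] unfolding ip_dist_nrm2 by simp
      then have "B * nrm2 (\<lambda>x. U m x - U n x) < e"
        using K_pos AB by (simp add: field_simps)
      then have "ennreal (B * nrm2 (\<lambda>x. U m x - U n x)) < ennreal e" using e by (intro ennreal_lessI)
      moreover have "L2n (\<lambda>x. F m x - F n x) \<le> ennreal (B * nrm2 (\<lambda>x. U m x - U n x))"
        using AB(4)[OF sobolev_diff[OF U U], of m n] unfolding wnrm_diff[OF U U] F_def[symmetric] .
      ultimately show ?thesis by simp
    qed
    then show ?thesis by blast
  qed
  from L2_complete[OF F this] obtain f where f: "square_integrable f" "tendsto_L2 F f" by blast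
  note [measurable] = square_integrableD[OF f(1)]
  define g where "g \<xi> = complex_of_real (1 / W \<xi>) * f \<xi>" for \<xi>
  have Wg: "complex_of_real (W \<xi>) * g \<xi> = f \<xi>" for \<xi>
    using sob_weight_pos[of \<delta> \<xi>] by (simp add: g_def)
  have g1: "integrable lborel g"
    unfolding g_def[abs_def] by (rule L2_integrable_mult(1)[OF inverse_weight f(1)])
  have g2: "square_integrable g"
  proof (rule square_integrable_bound[OF f(1)])
    show "g \<in> borel_measurable borel" unfolding g_def[abs_def] by measurable
    show "norm (g x) \<le> norm (f x)" for x
      using sob_weight_ge_1[of \<delta> x] delta_gt_half
      by (simp add: g_def norm_mult norm_divide divide_le_eq mult_left_le_one_le mult_left_le)
        (metis mult_left_mono mult.right_neutral norm_ge_zero)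
  qed
  define u where "u x = fourier_L1 g (- x) / complex_of_real ((2 * pi) ^ DIM('a))" for x
  note inv = fourier_inverse[OF g1 g2, folded u_def]
  have u: "u \<in> V"
    by (rule sobolevI[OF inv(2,3)]) (simp add: Wg f(1))
  have ae: "AE \<xi> in lborel. fourier u \<xi> = g \<xi>" by (rule fourier_AE_eq[OF inv(3)])
  have eq: "wnrm (fourier (\<lambda>x. U n x - u x)) = L2n (\<lambda>\<xi>. F n \<xi> - f \<xi>)" for n
    unfolding wnrm_diff[OF U u]
    by (rule L2n_cong_AE, use ae in eventually_elim) (simp add: F_def Wg)
  have "(\<lambda>n. ennreal (nrm2 (\<lambda>x. U n x - u x))) \<longlonglongrightarrow> 0"
  proof (rule tendsto_sandwich[OF _ _ tendsto_const])
    show "(\<lambda>n. ennreal A * L2n (\<lambda>\<xi>. F n \<xi> - f \<xi>)) \<longlonglongrightarrow> 0"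
      using f(2) by (intro ennreal_tendsto_cmult_0) (auto simp: tendsto_L2_L2n)
    show "\<forall>\<^sub>F n in sequentially. ennreal (nrm2 (\<lambda>x. U n x - u x)) \<le> ennreal A * L2n (\<lambda>\<xi>. F n \<xi> - f \<xi>)"
      using AB(3)[OF sobolev_diff[OF U u]] unfolding eq by (intro always_eventually allI)
  qed simp
  then have "(\<lambda>n. nrm2 (\<lambda>x. U n x - u x)) \<longlonglongrightarrow> 0"
    using tendsto_ennreal_iff[of "\<lambda>n. nrm2 (\<lambda>x. U n x - u x)" sequentially 0] nrm2_nonneg by simp
  then have "(\<lambda>n. sqrt (K * nrm2 (\<lambda>x. U n x - u x))) \<longlonglongrightarrow> sqrt (K * 0)"
    by (intro tendsto_intros)
  then have "(\<lambda>n. ip_dist ip (U n) u) \<longlonglongrightarrow> 0" unfolding ip_dist_nrm2 by simp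
  then show ?thesis using u by blast
qed

lemma hilbert: "hilbert_space_on V ip"
  unfolding hilbert_space_on_def using subspace inner_product sobolev_complete by blast

section \<open>Translates of \<open>\<Psi>\<close>: reproducing property and positive
  definiteness\<close>

lemma fourier_Psi_shift:
  "fourier (\<lambda>y::'a. \<Psi> d \<delta> (y - x)) \<xi> = wave \<xi> x * complex_of_real (\<eta> d \<delta> * R \<xi>)"
  "integrable lborel (\<lambda>y::'a. \<Psi> d \<delta> (y - x) :: complex)"
proof -
  show i: "integrable lborel (\<lambda>y::'a. \<Psi> d \<delta> (y - x) :: complex)"
    using integral_translate(1)[of "\<Psi> d \<delta> :: 'a \<Rightarrow> complex" "- x"] Psi_integrable(1)[OF \<delta> d1] by simp
  \<comment> \<open>The translate is integrable, so \<open>fourier\<close> is the genuine integral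
    here and the formula holds at every frequency, not just almost everywhere.\<close>
  have "fourier (\<lambda>y::'a. \<Psi> d \<delta> (y - x)) \<xi> = (LBINT y. wave \<xi> (x + y) * \<Psi> d \<delta> (x + y - x))"
    using i unfolding fourier_def fourier_L1_wave by (simp only: if_True) (rule integral_translate(2)[symmetric])
  also have "\<dots> = (LBINT y. wave \<xi> x * (wave \<xi> y * \<Psi> d \<delta> y))"
    by (simp add: wave_add_right mult.assoc)
  also have "\<dots> = wave \<xi> x * fourier_L1 (\<Psi> d \<delta>) \<xi>"
    unfolding fourier_L1_wave by (rule integral_mult_right_zero)
  finally show "fourier (\<lambda>y::'a. \<Psi> d \<delta> (y - x)) \<xi> = wave \<xi> x * complex_of_real (\<eta> d \<delta> * R \<xi>)"
    unfolding fourier_Psi[OF \<delta> d] .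
qed

text \<open>The upper bound for \<open>Q\<close> gives W R <= C / W, so the weighted transform is
  dominated by a multiple of the square integrable 1 / W.\<close>

lemma Psi_shift_mem: "(\<lambda>y. \<Psi> d \<delta> (y - x)) \<in> V"
proof -
  obtain c C where c: "0 < C" "\<And>\<xi>::'a. (W \<xi>)\<^sup>2 * R \<xi> \<le> C" using weight_bounds by metis
  have cont: "continuous_on UNIV (\<lambda>y::'a. \<Psi> d \<delta> (y - x) :: complex)"
    by (rule continuous_on_compose2[OF continuous_Psi[OF \<delta> d1]]) (auto intro!: continuous_intros)
  have "integrable lborel (\<lambda>y::'a. (norm (\<Psi> d \<delta> (- x + y) :: complex))\<^sup>2)"
    using Psi_integrable(2)[OF \<delta> d1, where 'a='a] by (subst integral_translate(1)[of "\<lambda>y. (norm (\<Psi> d \<delta> y :: complex))\<^sup>2"]) (simp add: square_integrable_def)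
  then have sq: "square_integrable (\<lambda>y::'a. \<Psi> d \<delta> (y - x) :: complex)"
    using borel_measurable_continuous_onI[OF cont] by (simp add: square_integrable_def)
  show ?thesis
  proof (rule sobolevI[OF cont is_fourier_L2_fourier[OF sq]])
    show "square_integrable (\<lambda>\<xi>. complex_of_real (W \<xi>) * fourier (\<lambda>y. \<Psi> d \<delta> (y - x)) \<xi>)"
    proof (rule square_integrable_bound[OF square_integrable_cmult[OF inverse_weight, of "complex_of_real (\<eta> d \<delta> * C)"]])
      show "(\<lambda>\<xi>. complex_of_real (W \<xi>) * fourier (\<lambda>y. \<Psi> d \<delta> (y - x)) \<xi>) \<in> borel_measurable borel"
        unfolding fourier_Psi_shift by measurable
      fix \<xi> :: 'a
      have w: "W \<xi> > 0" by (rule sob_weight_pos)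
      have "W \<xi> * R \<xi> \<le> C * (1 / W \<xi>)"
        using c(2)[of \<xi>] w by (simp add: field_simps power2_eq_square)
      then have "\<eta> d \<delta> * (W \<xi> * R \<xi>) \<le> \<eta> d \<delta> * (C * (1 / W \<xi>))"
        using eta_pos by (intro mult_left_mono) auto
      then show "norm (complex_of_real (W \<xi>) * fourier (\<lambda>y. \<Psi> d \<delta> (y - x)) \<xi>) \<le> norm (complex_of_real (\<eta> d \<delta> * C) * complex_of_real (1 / W \<xi>))"
        unfolding fourier_Psi_shift using w eta_pos c(1) R_pos[of \<xi>]
        by (simp add: norm_mult norm_divide mult_ac abs_mult)
    qed
  qed
qed

lemma inversion:
  assumes "u \<in> V"
  shows "u x = (LBINT \<xi>. wave (- x) \<xi> * fourier u \<xi>) / complex_of_real ((2 * pi) ^ DIM('a))"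
  using fourier_inversion[OF sobolevD(1,2)[OF assms] sobolevD(5)[OF assms], of x] by (simp add: fourier_L1_wave)

text \<open>The factor \<open>R\<close> in the transform of the translate cancels the denominator of
  the inner product. What remains is the inversion integral of \<open>u\<close> at x, with constant
  K \<eta> = (2 pi)^(-d).\<close>

lemma reproducing:
  assumes u: "u \<in> V"
  shows "u x = ip u (\<lambda>y. \<Psi> d \<delta> (y - x))"
proof -
  have "(LBINT \<xi>. ipf u (\<lambda>y. \<Psi> d \<delta> (y - x)) \<xi>)
    = (LBINT \<xi>. complex_of_real (\<eta> d \<delta>) * (wave (- x) \<xi> * fourier u \<xi>))"
  proof (rule Bochner_Integration.integral_cong)
    fix \<xi> :: 'a
    show "ipf u (\<lambda>y. \<Psi> d \<delta> (y - x)) \<xi>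
      = complex_of_real (\<eta> d \<delta>) * (wave (- x) \<xi> * fourier u \<xi>)"
      unfolding fourier_Psi_shift using R_pos[of \<xi>]
      by (simp add: cnj_wave wave_minus wave_commute[of x] wave_commute[of "- x"])
  qed simp
  also have "\<dots> = complex_of_real (\<eta> d \<delta>) * (LBINT \<xi>. wave (- x) \<xi> * fourier u \<xi>)"
    by (rule integral_mult_right_zero)
  finally have "ip u (\<lambda>y. \<Psi> d \<delta> (y - x)) = complex_of_real (K * \<eta> d \<delta>) * (LBINT \<xi>. wave (- x) \<xi> * fourier u \<xi>)"
    unfolding ip_eq by simp
  also have "K * \<eta> d \<delta> = 1 / (2 * pi) ^ DIM('a)"
    using eta_pos unfolding K_def two_pi_powr by simp
  finally show ?thesis unfolding inversion[OF u, of x] by simp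
qed

lemma kernel: "translation_reproducing_kernel (\<Psi> d \<delta>) V ip"
  unfolding translation_reproducing_kernel_def using hilbert Psi_shift_mem reproducing by blast

text \<open>Inversion for the translate by 0, which lies in the space; the integrability of
  \<open>R\<close> comes from its being a multiple of a Sobolev transform.\<close>

lemma Psi_inversion:
  "\<Psi> d \<delta> (x::'a) = complex_of_real (\<eta> d \<delta> / (2 * pi) ^ DIM('a)) * (LBINT \<xi>. wave (- x) \<xi> * complex_of_real (R \<xi>))"
  "integrable lborel (\<lambda>\<xi>::'a. complex_of_real (R \<xi>))"
proof -
  have F: "fourier (\<Psi> d \<delta>) \<xi> = complex_of_real (\<eta> d \<delta> * R \<xi>)" for \<xi> :: 'a
    using fourier_Psi_shift(1)[of 0 \<xi>] by simp
  have mem: "\<Psi> d \<delta> \<in> V" using Psi_shift_mem[of 0] by simp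
  have "\<Psi> d \<delta> x = (LBINT \<xi>. complex_of_real (\<eta> d \<delta>) * (wave (- x) \<xi> * complex_of_real (R \<xi>))) / complex_of_real ((2 * pi) ^ DIM('a))"
    using inversion[OF mem, of x] unfolding F by (simp add: mult_ac)
  then show "\<Psi> d \<delta> (x::'a) = complex_of_real (\<eta> d \<delta> / (2 * pi) ^ DIM('a)) * (LBINT \<xi>. wave (- x) \<xi> * complex_of_real (R \<xi>))"
    unfolding integral_mult_right_zero by simp
  have "integrable lborel (\<lambda>\<xi>::'a. complex_of_real (1 / \<eta> d \<delta>) * fourier (\<Psi> d \<delta>) \<xi>)"
    by (intro integrable_mult_right sobolevD(5) mem)
  then show "integrable lborel (\<lambda>\<xi>::'a. complex_of_real (R \<xi>))"
    unfolding F using eta_pos by simp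
qed

text \<open>Integration against \<open>wave (x m)\<close> times a Gaussian replaces each wave by a Gaussian centred at the
  point \<open>x j\<close>; narrow Gaussians isolate the coefficient \<open>z m\<close>.\<close>

lemma waves_independent:
  fixes x :: "nat \<Rightarrow> 'a"
  assumes inj: "inj_on x {..<N}" and 0: "\<And>\<xi>. (\<Sum>j<N. z j * wave (- x j) \<xi>) = 0" and m: "m < N"
  shows "z m = 0"
proof -
  have g: "(\<Sum>j<N. z j * cgauss b (x m - x j)) = 0" if b: "b > 0" for b
  proof -
    \<comment> \<open>Chosen so that the transform of \<open>gauss a\<close> is a multiple of
      \<open>gauss b\<close>; large \<open>b\<close> makes it narrow.\<close>
    define a where "a = 1 / (4 * b)"
    have a: "a > 0" "1 / (4 * a) = b" using b by (auto simp: a_def)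
    let ?s = "complex_of_real (sqrt (pi / a) ^ DIM('a))"
    have "0 = (LBINT \<xi>. (\<Sum>j<N. z j * wave (- x j) \<xi>) * (wave (x m) \<xi> * cgauss a \<xi>))"
      unfolding 0 by simp
    also have "\<dots> = (LBINT \<xi>. (\<Sum>j<N. z j * (wave (x m - x j) \<xi> * cgauss a \<xi>)))"
      unfolding sum_distrib_right
      by (intro Bochner_Integration.integral_cong sum.cong refl) (simp add: diff_conv_add_uminus wave_add mult_ac del: add_uminus_conv_diff)
    also have "\<dots> = (\<Sum>j<N. LBINT \<xi>. z j * (wave (x m - x j) \<xi> * cgauss a \<xi>))"
      by (intro Bochner_Integration.integral_sum integrable_mult_right integrable_wave_gauss a)
    also have "\<dots> = (\<Sum>j<N. z j * (?s * cgauss b (x m - x j)))"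
      by (simp only: integral_mult_right_zero gauss_fourier(2)[OF a(1)] a(2) of_real_mult)
    also have "\<dots> = ?s * (\<Sum>j<N. z j * cgauss b (x m - x j))"
      unfolding sum_distrib_left by (intro sum.cong refl) (simp only: mult_ac)
    finally show ?thesis using a by simp
  qed
  have lim: "(\<lambda>n. cgauss (real (Suc n)) (x m - x j)) \<longlonglongrightarrow> (if j = m then 1 else 0)" if "j < N" for j
  proof (cases "j = m")
    case True
    then show ?thesis by (simp add: gauss_def)
  next
    case False
    then have "x m \<noteq> x j" using inj m that by (auto simp: inj_on_def)
    then have p: "(norm (x m - x j))\<^sup>2 > 0" by simp
    have "(\<lambda>n. exp (- (norm (x m - x j))\<^sup>2) ^ Suc n) \<longlonglongrightarrow> 0"
      by (intro LIMSEQ_Suc LIMSEQ_power_zero) (use p in simp)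
    moreover have "exp (- (norm (x m - x j))\<^sup>2) ^ Suc n = gauss (real (Suc n)) (x m - x j)" for n
      unfolding gauss_def exp_of_nat_mult[symmetric] by (simp only: mult_minus_left mult_minus_right)
    ultimately have "(\<lambda>n. gauss (real (Suc n)) (x m - x j)) \<longlonglongrightarrow> 0" by (simp only:)
    then have "(\<lambda>n. cgauss (real (Suc n)) (x m - x j)) \<longlonglongrightarrow> complex_of_real 0"
      by (rule tendsto_of_real)
    then show ?thesis using False by simp
  qed
  have "(\<lambda>n. \<Sum>j<N. z j * cgauss (real (Suc n)) (x m - x j)) \<longlonglongrightarrow> (\<Sum>j<N. z j * (if j = m then 1 else 0))"
    by (intro tendsto_sum tendsto_mult tendsto_const lim) simp
  moreover have "(\<Sum>j<N. z j * cgauss (real (Suc n)) (x m - x j)) = 0" for n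
    by (rule g) simp
  ultimately have "(\<Sum>j<N. z j * (if j = m then 1 else 0)) = 0" by (simp add: LIMSEQ_const_iff)
  moreover have "(\<Sum>j<N. z j * (if j = m then 1 else 0)) = (\<Sum>j<N. if j = m then z j else 0)"
    by (intro sum.cong) auto
  ultimately show ?thesis using m by (simp add: sum.delta)
qed

text \<open>Inserting the inversion formula turns the quadratic form into a positive multiple of the
  integral of R |S|^2. As R > 0 and S is continuous, the form vanishes only if S is identically 0,
  and distinct points give independent waves.\<close>

lemma Psi_positive_definite: "positive_definite (\<Psi> d \<delta> :: 'a \<Rightarrow> complex)"
  unfolding positive_definite_def
proof (intro allI impI)
  fix N :: nat and x :: "nat \<Rightarrow> 'a" and z :: "nat \<Rightarrow> complex"
  assume inj: "inj_on x {..<N}"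
  define S where "S \<xi> = (\<Sum>j<N. z j * wave (- x j) \<xi>)" for \<xi>
  let ?c = "\<eta> d \<delta> / (2 * pi) ^ DIM('a)"
  have cpos: "?c > 0" using eta_pos by simp
  let ?T = "\<lambda>j k \<xi>. (wave (- (x j - x k)) \<xi> * complex_of_real (R \<xi>)) * (z j * cnj (z k))"
  have Ti: "integrable lborel (?T j k)" for j k
    by (intro integrable_mult_left integrable_wave Psi_inversion(2))
  have Scont: "continuous_on UNIV S"
    unfolding S_def by (intro continuous_intros)
  \<comment> \<open>The character of a difference x_j - x_k factors into one wave times the
    conjugate of another, so the double sum is R times S times its conjugate.\<close>
  have TS: "(\<Sum>j<N. \<Sum>k<N. ?T j k \<xi>) = complex_of_real (R \<xi> * (norm (S \<xi>))\<^sup>2)" for \<xi>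
  proof -
    have w: "wave (- (x j - x k)) \<xi> = wave (- x j) \<xi> * cnj (wave (- x k) \<xi>)" for j k
      using wave_add[of "- x j" "x k" \<xi>] by (simp add: cnj_wave)
    have "complex_of_real (R \<xi> * (norm (S \<xi>))\<^sup>2) = complex_of_real (R \<xi>) * (S \<xi> * cnj (S \<xi>))"
      by (simp only: of_real_mult complex_norm_square)
    also have "S \<xi> * cnj (S \<xi>) = (\<Sum>j<N. \<Sum>k<N. (z j * wave (- x j) \<xi>) * cnj (z k * wave (- x k) \<xi>))"
      unfolding S_def cnj_sum by (rule sum_product)
    also have "complex_of_real (R \<xi>) * \<dots> = (\<Sum>j<N. \<Sum>k<N. complex_of_real (R \<xi>) * ((z j * wave (- x j) \<xi>) * cnj (z k * wave (- x k) \<xi>)))"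
      by (simp only: sum_distrib_left)
    also have "\<dots> = (\<Sum>j<N. \<Sum>k<N. ?T j k \<xi>)"
      unfolding w by (intro sum.cong refl) (simp add: mult_ac)
    finally show ?thesis by simp
  qed
  have SSi: "integrable lborel (\<lambda>\<xi>. complex_of_real (R \<xi> * (norm (S \<xi>))\<^sup>2))"
    unfolding TS[symmetric] by (intro Bochner_Integration.integrable_sum Ti)
  let ?J = "LBINT \<xi>. R \<xi> * (norm (S \<xi>))\<^sup>2"
  have Ji: "integrable lborel (\<lambda>\<xi>. R \<xi> * (norm (S \<xi>))\<^sup>2)" using integrable_Re[OF SSi] by simp
  have "(\<Sum>j<N. \<Sum>k<N. \<Psi> d \<delta> (x j - x k) * z j * cnj (z k)) = (\<Sum>j<N. \<Sum>k<N. complex_of_real ?c * (LBINT \<xi>. ?T j k \<xi>))"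
    unfolding integral_mult_left_zero by (intro sum.cong refl, subst Psi_inversion(1)) (simp only: mult.assoc)
  also have "\<dots> = complex_of_real ?c * (\<Sum>j<N. \<Sum>k<N. LBINT \<xi>. ?T j k \<xi>)"
    by (simp only: sum_distrib_left)
  also have "(\<Sum>j<N. \<Sum>k<N. LBINT \<xi>. ?T j k \<xi>) = (LBINT \<xi>. (\<Sum>j<N. \<Sum>k<N. ?T j k \<xi>))"
    by (simp only: Bochner_Integration.integral_sum Bochner_Integration.integrable_sum Ti)
  also have "\<dots> = complex_of_real ?J" unfolding TS by (rule integral_complex_of_real)
  finally have eq: "(\<Sum>j<N. \<Sum>k<N. \<Psi> d \<delta> (x j - x k) * z j * cnj (z k)) = complex_of_real (?c * ?J)" by simp
  have J0: "?J \<ge> 0" using R_pos by (intro Bochner_Integration.integral_nonneg mult_nonneg_nonneg) (auto simp: less_imp_le)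
  show "(\<Sum>j<N. \<Sum>k<N. \<Psi> d \<delta> (x j - x k) * z j * cnj (z k)) \<in> \<real>\<^sub>\<ge>\<^sub>0 \<and>
    ((\<Sum>j<N. \<Sum>k<N. \<Psi> d \<delta> (x j - x k) * z j * cnj (z k)) = 0 \<longrightarrow> (\<forall>j<N. z j = 0))"
    unfolding eq
  proof (intro conjI impI)
    show "complex_of_real (?c * ?J) \<in> \<real>\<^sub>\<ge>\<^sub>0"
      using mult_nonneg_nonneg[OF less_imp_le[OF cpos] J0] by (simp only: nonneg_Reals_of_real_iff)
    assume "complex_of_real (?c * ?J) = 0"
    then have "?J = 0" using eta_pos by simp
    then have "AE \<xi> in lborel. R \<xi> * (norm (S \<xi>))\<^sup>2 = 0"
      using integral_nonneg_eq_0_iff_AE[OF Ji] R_pos by (simp add: less_imp_le)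
    then have "AE \<xi> in lborel. S \<xi> = 0"
    proof eventually_elim
      case (elim \<xi>)
      then show ?case using R_pos[of \<xi>] by simp
    qed
    then have "S = (\<lambda>_. 0)" by (intro continuous_AE_eq Scont) auto
    then have "(\<Sum>j<N. z j * wave (- x j) \<xi>) = 0" for \<xi> unfolding S_def by (rule fun_cong)
    then show "\<forall>j<N. z j = 0" using waves_independent[OF inj] by blast
  qed
qed

end

theorem corollary7p1:
  fixes d :: nat and \<delta> :: real
  assumes "d = CARD('n::finite)" and "\<delta> > real d / 2"
  shows "continuous_on UNIV (\<Psi> d \<delta> :: real ^ 'n \<Rightarrow> complex) \<and>
         positive_definite (\<Psi> d \<delta> :: real ^ 'n \<Rightarrow> complex) \<and>
         (\<forall>\<xi> :: real ^ 'n. fourier (\<Psi> d \<delta>) \<xi> = complex_of_real (\<eta> d \<delta> * Q \<delta> (norm \<xi>))) \<and>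
         translation_reproducing_kernel (\<Psi> d \<delta> :: real ^ 'n \<Rightarrow> complex) (sobolev \<delta>) (\<Psi>_inner d \<delta>)"
proof -
  interpret sobolev_setting d \<delta> "TYPE(real ^ 'n)"
    by standard (use assms in auto)
  have "fourier (\<Psi> d \<delta>) \<xi> = complex_of_real (\<eta> d \<delta> * Q \<delta> (norm \<xi>))" for \<xi> :: "real ^ 'n"
    using fourier_Psi_shift(1)[of 0 \<xi>] by simp
  then show ?thesis
    using continuous_Psi[OF \<delta> d1] Psi_positive_definite kernel by blast
qed

end
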